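(* Let $d\ge 2$, $B:=[0,\tfrac12]^d$, $B_2:=[-\tfrac12,\tfrac12]^d$, and let $\partial\Omega\subset B$ be a boundary geometry, so that $x-y\in B_2$ for all $x,y\in\partial\Omega$. Define the linear integral operator $$(\mathcal K f)(x)=\int_{\partial\Omega}\kappa(x-y)f(y)\,dS_y,\qquad x\in\partial\Omega .$$ For $\delta\in(0,\tfrac12)$ let $\rho_\delta(y)=\frac{1}{(2\pi\delta^2)^{d/2}}e^{-\|y\|_2^2/(2\delta^2)}$. Extend $\kappa$ periodically from $B_2$ to $\mathbb R^d$ and put $(\kappa*\rho_\delta)(x):=\int_{\mathbb R^d}\kappa(x-y)\rho_\delta(y)\,dy$, $$\kappa_{\rm long}:=\kappa*\rho_\delta,\qquad \kappa_{\rm short}:=\kappa-\kappa*\rho_\delta,$$ $$(\mathcal K_{\rm long}f)(x)=\int_{\partial\Omega}\kappa_{\rm long}(x-y)f(y)\,dS_y,\qquad (\mathcal K_{\rm short}f)(x)=\int_{\partial\Omega}\kappa_{\rm short}(x-y)f(y)\,dS_y .$$ For $p\in\mathbb N$ (with $p\geq 1$), let $\widehat{\kappa_{\rm long}}_k$, $k\in\mathbb Z^d$, denote the Fourier coefficients of $\kappa_{\rm long}$ and set $$\hat\kappa_{\rm long}(x)=\sum_{k\in\mathbb Z^d:\ \|k\|_\infty\le p}\widehat{\kappa_{\rm long}}_k\,e^{2\pi i k\cdot x},\qquad (\widehat{\mathcal K}_{\rm long}f)(x)=\int_{\partial\Omega}\hat\kappa_{\rm long}(x-y)f(y)\,dS_y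 .$$ For $\epsilon>\delta$ let $B_\epsilon(x):=\{y\in\mathbb R^d:\|y-x\|_2\le\epsilon\}$ and $$(\mathcal K^{\epsilon}_{\rm short}f)(x):=\int_{\partial\Omega\cap B_\epsilon(x)}\kappa_{\rm short}(x-y)f(y)\,dS_y,\qquad x\in\partial\Omega .$$ Assume the following. (A1) The kernel $\kappa$ is periodic and translation-invariant, $\kappa\in L^1(B_2)\cap C^2(B_2\setminus\{0\})$, and there is a constant $C_\kappa>0$ such that $\|\nabla^j\kappa(x)\|_2\le \dfrac{C_\kappa}{\|x\|_2^{\,j+d-1}}$ for $j=0,1,2$ and all $x\in B_2\setminus\{0\}$. (A2) $\partial\Omega\subset B$ is a compact embedded $(d-1)$-dimensional Lipschitz hypersurface with Lipschitz character bounded by $C_L$. (A3) $f\in W^{2,\infty}(\partial\Omega)$. (A4) There exist $\epsilon_0>0$, a local approximation order $q\ge0$, and a constant $C_{\rm short}=C_{\rm short}(C_\kappa,C_L,d)>0$ such that for every $0<\epsilon\le\epsilon_0$ there is a linear local operator $\widehat{\mathcal K}^{\epsilon}_{\rm short}$ with $$\big\|\mathcal K^{\epsilon}_{\rm short}f-\widehat{\mathcal K}^{\epsilon}_{\rm short}f\big\|_{L^\infty(\partial\Omega)}\le C_{\rm short}\,\|f\|_{W^{2,\infty}(\partial\Omega)}\,\epsilon^{d+q}.$$ Then the following hold. (P1) With $C_{\rm long}=\dfrac{d\,\|\kappa\|_{L^1(B_2)}}{2\pi^2}\Big(1+\dfrac1{\sqrt{2\pi}}\Big)^{d-1}$, $$\big\|\widehat{\mathcal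 K}_{\rm long}f-\mathcal K_{\rm long}f\big\|_{L^\infty(\partial\Omega)}\le C_{\rm long}\,\frac{e^{-2\pi^2\delta^2p^2}}{\delta^{d+1}p}\,\|f\|_{L^1(\partial\Omega)} .$$ (P2) For every $x\in B_2$ with $\|x\|_2\ge\delta$, $$|\kappa_{\rm short}(x)|\le \frac{d\,C_\kappa}{2\big(1-\frac1{\sqrt d}\big)^{d+1}}\,\frac{\delta^2}{\|x\|_2^{d+1}}+c_{\rm short}\,\frac{e^{-\frac1{2d}\frac{\|x\|_2^2}{\delta^2}}}{\delta^d},$$ where $$c_{\rm short}=\frac{\|\kappa\|_{L^1(B_2)}}{(2\pi)^{d/2}}\Big(1+\frac{2^d d}{(1-e^{-1/2})^d}\Big)+\frac{C_\kappa C_{d/2}}{\Gamma(\frac d2)}\Big(\frac1{2^{d/2}}+d\Big).$$ (P3) Define $\widehat{\mathcal K}=\widehat{\mathcal K}_{\rm long}+\widehat{\mathcal K}^{\epsilon}_{\rm short}$. Fix $\gamma\in(0,1)$ and set $t=\frac{2}{q+d+2}$, $\delta=p^{-\gamma}$, $\epsilon=\delta^t=p^{-\gamma t}$. Then for every integer $p>\max\{2^{1/\gamma},\ \epsilon_0^{-1/(\gamma t)}\}$, $$\|\widehat{\mathcal K}f-\mathcal Kf\|_{L^\infty(\partial\Omega)}\le C\Big(p^{-1+\gamma(d+1)}e^{-2\pi^2p^{2-2\gamma}}+p^{d\gamma}e^{-\frac1{2d}p^{\gamma(2-2t)}}+2p^{-\gamma t(q+d)}\Big)=\mathcal O\Big(p^{-\gamma\left(1+\frac{q+d-2}{q+d+2}\right)}\Big),$$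 where $C>0$ depends on $C_\kappa$, $\|\kappa\|_{L^1(B_2)}$, $C_L$, $d$ and $\|f\|_{W^{2,\infty}(\partial\Omega)}$.
   Context: $dS_y$ is the $(d-1)$-dimensional surface measure on $\partial\Omega$; $\|\cdot\|_2$ is the Euclidean (operator) norm; $\nabla^j\kappa$ is the $j$-th derivative of $\kappa$ ($\nabla^0\kappa=\kappa$). Periodicity: "$\kappa$ is periodic" means $\kappa$ is the restriction to $B_2$ of a $\mathbb Z^d$-periodic function on $\mathbb R^d$ (still denoted $\kappa$), with the $C^2$ regularity understood for the periodic function on $\mathbb R^d\setminus\mathbb Z^d$. "Translation-invariant" means the kernel enters the integral operator only through $x-y$. Fourier coefficients of a $\mathbb Z^d$-periodic function $g$ are $\hat g_k=\int_{B_2}g(x)e^{-2\pi i k\cdot x}\,dx$. Singular integrals: when $\kappa$ is singular at the origin, the integrals over $\partial\Omega$ or $\partial\Omega\cap B_\epsilon(x)$ against $\kappa$ or $\kappa_{\rm short}$ are understood in the Cauchy principal value sense, i.e. as $\lim_{\eta\to0^+}$ of the integral with $B_\eta(x)$ removed; it is implicit in the hypotheses that $\mathcal Kf$, $\mathcal K_{\rm short}f$ and $\mathcal K^\epsilon_{\rm short}f$ are well defined. Lipschitz character: $\partial\Omega$ is a compact embedded $(d-1)$-dimensional Lipschitz hypersurface with Lipschitz character bounded by $C_L$ if it can be covered by at most $C_L$ open coordinate cylinders, of radius and height at least $1/C_L$, in each of which, after a rigid motion, $\partial\Omega$ coincides with the graph of a Lipschitz function of $d-1$ variables with Lipschitz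 constant at most $C_L$. Constant $C_{d/2}$: for $\alpha>0$, $C_\alpha$ denotes a constant depending only on $\alpha$ such that the upper incomplete Gamma function satisfies $\Gamma(\alpha,x)=\int_x^\infty s^{\alpha-1}e^{-s}\,ds\le C_\alpha(x^{\alpha-1}+x^{-1})e^{-x}$ for all $x>0$; $C_{d/2}$ is this constant for $\alpha=d/2$. $\Gamma(\cdot)$ is the Gamma function. The $\mathcal O$ in (P3) is as $p\to\infty$ with all other quantities (including $\gamma$, $q$, $d$) fixed. *)

theory Defs
  imports "HOL-Probability.Probability" "HOL-Library.Landau_Symbols"
begin

section \<open>Hausdorff and surface measure\<close>

text \<open>
  The factor \<open>unit_ball_vol k / 2 ^ k\<close> is the normalisation for which the \<open>k\<close>-dimensional
  Hausdorff measure is the usual \<open>k\<close>-dimensional surface measure. Only \<open>k \<ge> 1\<close> is intended (for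
  \<open>k = 0\<close> the empty set would get weight 1). Boundedness is required because
  \<^const>\<open>diameter\<close> is meaningless on unbounded sets.
\<close>

definition hausdorff_pre :: "nat \<Rightarrow> real \<Rightarrow> 'a::metric_space set \<Rightarrow> ennreal" where
  "hausdorff_pre k \<eta> A =
     (INF C \<in> {C :: nat \<Rightarrow> 'a set. A \<subseteq> (\<Union>i. C i) \<and> (\<forall>i. bounded (C i) \<and> diameter (C i) \<le> \<eta>)}.
        (\<Sum>i. ennreal (unit_ball_vol (real k) * (diameter (C i) / 2) ^ k)))"

definition hausdorff_outer :: "nat \<Rightarrow> 'a::metric_space set \<Rightarrow> ennreal" where
  "hausdorff_outer k A = (SUP \<eta> \<in> {0<..}. hausdorff_pre k \<eta> A)"

definition hausdorff_measure :: "nat \<Rightarrow> 'a::metric_space measure" where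
  "hausdorff_measure k = measure_of UNIV (sets borel) (hausdorff_outer k)"

text \<open>The measure is not degenerate: \<open>hausdorff_outer k\<close> is countably additive on Borel sets.\<close>

lemma hausdorff_pre_mono: "A \<subseteq> B \<Longrightarrow> hausdorff_pre k \<eta> A \<le> hausdorff_pre k \<eta> B"
  unfolding hausdorff_pre_def by (rule INF_superset_mono) auto

lemma hausdorff_pre_antimono: "\<eta> \<le> \<eta>' \<Longrightarrow> hausdorff_pre k \<eta>' A \<le> hausdorff_pre k \<eta> A"
  unfolding hausdorff_pre_def by (rule INF_superset_mono) (auto intro: order_trans)

lemma hausdorff_outer_mono: "A \<subseteq> B \<Longrightarrow> hausdorff_outer k A \<le> hausdorff_outer k B"
  unfolding hausdorff_outer_def by (intro SUP_mono') (rule hausdorff_pre_mono)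

lemma hausdorff_outer_empty:
  assumes "k \<ge> 1"
  shows "hausdorff_outer k {} = 0"
proof -
  have "hausdorff_pre k \<eta> ({} :: 'a set) \<le> 0" if "\<eta> > 0" for \<eta>
    unfolding hausdorff_pre_def
    by (rule INF_lower2[of "\<lambda>_. {}"]) (use that assms in \<open>auto simp: power_0_left\<close>)
  then show ?thesis
    unfolding hausdorff_outer_def by (auto simp: SUP_eq_const)
qed

lemma hausdorff_pre_subadditive:
  "hausdorff_pre k \<eta> (\<Union>n::nat. A n) \<le> (\<Sum>n. hausdorff_pre k \<eta> (A n))"
proof (rule ennreal_le_epsilon)
  fix e :: real
  assume e: "0 < e" "(\<Sum>n. hausdorff_pre k \<eta> (A n)) < top"
  let ?w = "\<lambda>D :: 'a set. ennreal (unit_ball_vol (real k) * (diameter D / 2) ^ k)"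
  have "\<exists>B. A n \<subseteq> (\<Union>i. B i) \<and> (\<forall>i. bounded (B i) \<and> diameter (B i) \<le> \<eta>) \<and>
            (\<Sum>i. ?w (B i)) \<le> hausdorff_pre k \<eta> (A n) + e * (1/2) ^ Suc n" for n
  proof -
    have "hausdorff_pre k \<eta> (A n) < top"
      using e(2) by (auto simp: less_top dest!: ennreal_suminf_lessD)
    then have "hausdorff_pre k \<eta> (A n) < hausdorff_pre k \<eta> (A n) + e * (1/2) ^ Suc n"
      using e(1) by auto
    then show ?thesis
      unfolding hausdorff_pre_def[of k \<eta> "A n"] INF_less_iff by (auto intro: less_imp_le)
  qed
  then obtain B where B: "\<And>n. A n \<subseteq> (\<Union>i. B n i)"
      "\<And>n i. bounded (B n i) \<and> diameter (B n i) \<le> \<eta>"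
      "\<And>n. (\<Sum>i. ?w (B n i)) \<le> hausdorff_pre k \<eta> (A n) + e * (1/2) ^ Suc n"
    by metis
  define C where "C = case_prod B \<circ> prod_decode"
  have "(\<Union>n. A n) \<subseteq> (\<Union>i. C i)"
    using B(1) by (auto simp: C_def subset_eq) (metis prod.case prod_encode_inverse)
  then have "hausdorff_pre k \<eta> (\<Union>n. A n) \<le> (\<Sum>i. ?w (C i))"
    unfolding hausdorff_pre_def using B(2) by (intro INF_lower) (auto simp: C_def split_beta)
  also have "\<dots> = (\<Sum>i. (case_prod (\<lambda>n i. ?w (B n i)) \<circ> prod_decode) i)"
    by (simp add: C_def split_beta)
  also have "\<dots> = (\<Sum>n. \<Sum>i. ?w (B n i))"
    unfolding comp_def by (intro suminf_ennreal_2dimen) auto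
  also have "\<dots> \<le> (\<Sum>n. hausdorff_pre k \<eta> (A n) + e * (1/2) ^ Suc n)"
    by (intro suminf_le allI B(3)) auto
  also have "\<dots> = (\<Sum>n. hausdorff_pre k \<eta> (A n)) + (\<Sum>n. ennreal e * ennreal ((1/2) ^ Suc n))"
    using e(1) by (subst suminf_add[symmetric])
      (auto simp del: ennreal_suminf_cmult simp add: ennreal_mult[symmetric])
  also have "\<dots> = (\<Sum>n. hausdorff_pre k \<eta> (A n)) + e"
    unfolding ennreal_suminf_cmult
    by (subst suminf_ennreal_eq[OF zero_le_power power_half_series]) auto
  finally show "hausdorff_pre k \<eta> (\<Union>n. A n) \<le> (\<Sum>n. hausdorff_pre k \<eta> (A n)) + e" .
qed

lemma hausdorff_outer_subadditive:
  "hausdorff_outer k (\<Union>n::nat. A n) \<le> (\<Sum>n. hausdorff_outer k (A n))"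
  unfolding hausdorff_outer_def[of k "\<Union>n. A n"]
proof (rule SUP_least)
  fix \<eta> :: real
  assume "\<eta> \<in> {0<..}"
  then have "(\<Sum>n. hausdorff_pre k \<eta> (A n)) \<le> (\<Sum>n. hausdorff_outer k (A n))"
    unfolding hausdorff_outer_def by (intro suminf_le SUP_upper) auto
  with hausdorff_pre_subadditive
  show "hausdorff_pre k \<eta> (\<Union>n. A n) \<le> (\<Sum>n. hausdorff_outer k (A n))"
    by (rule order_trans)
qed

lemma hausdorff_outer_measure_space:
  "k \<ge> 1 \<Longrightarrow> outer_measure_space (Pow UNIV) (hausdorff_outer k)"
  by (auto simp: outer_measure_space_def positive_def increasing_def countably_subadditive_def
      hausdorff_outer_empty hausdorff_outer_mono hausdorff_outer_subadditive)

lemma hausdorff_outer_separated: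
  assumes "k \<ge> 1" "r > 0" and r: "\<And>a b. a \<in> A \<Longrightarrow> b \<in> B \<Longrightarrow> r \<le> dist a b"
  shows "hausdorff_outer k A + hausdorff_outer k B \<le> hausdorff_outer k (A \<union> B)"
proof -
  let ?w = "\<lambda>D :: 'a set. ennreal (unit_ball_vol (real k) * (diameter D / 2) ^ k)"
  have *: "hausdorff_pre k \<eta> A + hausdorff_pre k \<eta> B \<le> hausdorff_pre k \<eta> (A \<union> B)"
    if \<eta>: "0 < \<eta>" "\<eta> < r" for \<eta>
    unfolding hausdorff_pre_def[of k \<eta> "A \<union> B"]
  proof (rule INF_greatest)
    fix C :: "nat \<Rightarrow> 'a set"
    assume C: "C \<in> {C. A \<union> B \<subseteq> (\<Union>i. C i) \<and> (\<forall>i. bounded (C i) \<and> diameter (C i) \<le> \<eta>)}"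
    define CA where "CA i = (if C i \<inter> A = {} then {} else C i)" for i
    define CB where "CB i = (if C i \<inter> B = {} then {} else C i)" for i
    have disj: "C i \<inter> A = {} \<or> C i \<inter> B = {}" for i
    proof (rule ccontr)
      assume "\<not> ?thesis"
      then obtain a b where ab: "a \<in> C i" "a \<in> A" "b \<in> C i" "b \<in> B"
        by blast
      have "dist a b \<le> \<eta>"
        using C ab diameter_bounded_bound[of "C i" a b] by (auto intro: order_trans)
      with r[of a b] ab \<eta> show False
        by simp
    qed
    have "A \<subseteq> (\<Union>i. CA i)" "B \<subseteq> (\<Union>i. CB i)"
      using C by (fastforce simp: CA_def CB_def)+
    then have "hausdorff_pre k \<eta> A + hausdorff_pre k \<eta> B \<le> (\<Sum>i. ?w (CA i)) + (\<Sum>i. ?w (CB i))"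
      unfolding hausdorff_pre_def using C \<eta>
      by (intro add_mono INF_lower) (auto simp: CA_def CB_def)
    also have "\<dots> = (\<Sum>i. ?w (CA i) + ?w (CB i))"
      by (intro suminf_add) auto
    also have "\<dots> \<le> (\<Sum>i. ?w (C i))"
    proof (intro suminf_le allI)
      show "?w (CA i) + ?w (CB i) \<le> ?w (C i)" for i
        using disj[of i] \<open>k \<ge> 1\<close> by (auto simp: CA_def CB_def power_0_left)
    qed auto
    finally show "hausdorff_pre k \<eta> A + hausdorff_pre k \<eta> B \<le> (\<Sum>i. ?w (C i))" .
  qed
  have "hausdorff_outer k A + hausdorff_outer k B =
      (SUP \<eta>\<in>{0<..}. hausdorff_pre k \<eta> A + hausdorff_pre k \<eta> B)"
    unfolding hausdorff_outer_def
  proof (rule SUP_add_directed_ennreal[symmetric])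
    fix i j :: real
    assume "i \<in> {0<..}" "j \<in> {0<..}"
    then show "\<exists>l\<in>{0<..}. hausdorff_pre k i A + hausdorff_pre k j B
        \<le> hausdorff_pre k l A + hausdorff_pre k l B"
      by (intro bexI[of _ "min i j"] add_mono hausdorff_pre_antimono) auto
  qed
  also have "\<dots> \<le> hausdorff_outer k (A \<union> B)"
  proof (rule SUP_least)
    fix \<eta> :: real
    assume \<eta>: "\<eta> \<in> {0<..}"
    let ?\<eta> = "min \<eta> (r / 2)"
    have "hausdorff_pre k \<eta> A + hausdorff_pre k \<eta> B \<le> hausdorff_pre k ?\<eta> A + hausdorff_pre k ?\<eta> B"
      by (intro add_mono hausdorff_pre_antimono) auto
    also have "\<dots> \<le> hausdorff_pre k ?\<eta> (A \<union> B)"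
      using \<eta> \<open>r > 0\<close> by (intro *) auto
    also have "\<dots> \<le> hausdorff_outer k (A \<union> B)"
      unfolding hausdorff_outer_def using \<eta> \<open>r > 0\<close> by (intro SUP_upper) auto
    finally show "hausdorff_pre k \<eta> A + hausdorff_pre k \<eta> B \<le> hausdorff_outer k (A \<union> B)" .
  qed
  finally show ?thesis .
qed

lemma hausdorff_outer_Un:
  assumes "k \<ge> 1"
  shows "hausdorff_outer k (A \<union> B) \<le> hausdorff_outer k A + hausdorff_outer k B"
proof -
  have "countably_subadditive (Pow UNIV) (hausdorff_outer k :: 'a set \<Rightarrow> _)"
       "positive (Pow UNIV) (hausdorff_outer k :: 'a set \<Rightarrow> _)"
    using hausdorff_outer_measure_space[OF assms] by (auto simp: outer_measure_space_def)
  then have "subadditive (Pow UNIV) (hausdorff_outer k :: 'a set \<Rightarrow> _)"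
    using ring_of_sets.countably_subadditive_subadditive[of UNIV "Pow UNIV"]
    by (simp add: ring_of_sets_iff)
  from subadditiveD[OF this, of A "B - A"] have
    "hausdorff_outer k (A \<union> (B - A)) \<le> hausdorff_outer k A + hausdorff_outer k (B - A)"
    by auto
  also have "\<dots> \<le> hausdorff_outer k A + hausdorff_outer k B"
    by (intro add_left_mono hausdorff_outer_mono) auto
  finally show ?thesis
    by simp
qed

lemma hausdorff_outer_closed:
  fixes F :: "'a::metric_space set"
  assumes k: "k \<ge> 1" and F: "closed F" "F \<noteq> {}"
  shows "hausdorff_outer k (X \<inter> F) + hausdorff_outer k (X - F) \<le> hausdorff_outer k X"
proof (cases "hausdorff_outer k X = top")
  case False
  let ?H = "hausdorff_outer k :: 'a set \<Rightarrow> ennreal"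
  define A where "A n = {x \<in> X - F. inverse (real (Suc n)) \<le> infdist x F}" for n
  define R where "R n = A (Suc n) - A n" for n
  have A_mono: "A m \<subseteq> A n" if "m \<le> n" for m n
    using that unfolding A_def
    by (auto intro: order_trans[of "inverse (real (Suc n))" "inverse (real (Suc m))"]
        simp del: of_nat_Suc)
  have AX: "A n \<subseteq> X - F" for n
    by (auto simp: A_def)
  have UA: "X - F = (\<Union>n. A n)"
  proof -
    have "\<exists>n. x \<in> A n" if "x \<in> X - F" for x
    proof -
      have "infdist x F > 0"
        using that F in_closed_iff_infdist_zero[OF F, of x] infdist_nonneg[of x F] by auto
      then obtain n where "inverse (real (Suc n)) < infdist x F"
        using reals_Archimedean by blast
      with that show ?thesis
        by (auto simp: A_def intro!: exI[of _ n])
    qed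
    then show ?thesis
      using AX by blast
  qed
  have XA: "?H (X \<inter> F) + ?H (A n) \<le> ?H X" for n
  proof -
    have "?H (X \<inter> F) + ?H (A n) \<le> ?H ((X \<inter> F) \<union> A n)"
    proof (rule hausdorff_outer_separated[OF k])
      show "0 < inverse (real (Suc n))"
        by simp
      show "inverse (real (Suc n)) \<le> dist a b" if "a \<in> X \<inter> F" "b \<in> A n" for a b
        using that infdist_le[of a F b] by (auto simp: A_def dist_commute)
    qed
    also have "\<dots> \<le> ?H X"
      using AX[of n] by (intro hausdorff_outer_mono) auto
    finally show ?thesis .
  qed
  have sep: "?H (A (Suc n)) + ?H (R (Suc (Suc n))) \<le> ?H (A (Suc n) \<union> R (Suc (Suc n)))" for n
  proof (rule hausdorff_outer_separated[OF k])
    let ?r = "inverse (real (Suc (Suc n))) - inverse (real (Suc (Suc (Suc n))))"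
    show "0 < ?r"
      by simp
    show "?r \<le> dist a b" if "a \<in> A (Suc n)" "b \<in> R (Suc (Suc n))" for a b
      using that infdist_triangle[of a F b] by (auto simp: A_def R_def)
  qed
  have sums: "(\<Sum>m\<le>N. ?H (R (2 * m + j))) \<le> ?H (A (Suc (2 * N + j)))" for N j
  proof (induction N)
    case 0
    show ?case
      by (auto simp: R_def intro!: hausdorff_outer_mono)
  next
    case (Suc N)
    have "(\<Sum>m\<le>Suc N. ?H (R (2 * m + j)))
        \<le> ?H (A (Suc (2 * N + j))) + ?H (R (Suc (Suc (2 * N + j))))"
      using Suc by (auto intro: add_right_mono)
    also have "\<dots> \<le> ?H (A (Suc (2 * N + j)) \<union> R (Suc (Suc (2 * N + j))))"
      by (rule sep)
    also have "\<dots> \<le> ?H (A (Suc (2 * Suc N + j)))"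
      using A_mono[of "Suc (2 * N + j)" "Suc (2 * Suc N + j)"]
      by (intro hausdorff_outer_mono) (auto simp: R_def)
    finally show ?case .
  qed
  have HAX: "?H (A n) \<le> ?H X" for n
    using AX[of n] by (intro hausdorff_outer_mono) auto
  have partial: "(\<Sum>m<n. ?H (R m)) \<le> 2 * ?H X" for n
  proof -
    have "(\<Sum>m<n. ?H (R m)) \<le> (\<Sum>m<2 * Suc n. ?H (R m))"
      by (intro sum_mono2) auto
    also have "\<dots> = (\<Sum>m\<le>n. ?H (R (2 * m + 0))) + (\<Sum>m\<le>n. ?H (R (2 * m + 1)))"
      by (induction n) (auto simp: algebra_simps)
    also have "\<dots> \<le> ?H X + ?H X"
      by (intro add_mono order_trans[OF sums HAX])
    finally show ?thesis
      by (simp add: mult_2)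
  qed
  have "(\<Sum>m. ?H (R m)) \<le> 2 * ?H X"
    by (intro suminf_le_const partial) auto
  also have "2 * ?H X < top"
    using False by (simp add: ennreal_mult_less_top less_top)
  finally have fin: "(\<Sum>m. ?H (R m)) < top" .
  define r where "r m = enn2real (?H (R m))" for m
  have HR: "?H (R m) = ennreal (r m)" for m
    using ennreal_suminf_lessD[OF fin, of m] by (simp add: r_def)
  have r_nonneg: "0 \<le> r m" for m
    by (simp add: r_def)
  have summ: "summable r"
    using fin by (intro summable_suminf_not_top r_nonneg) (simp flip: HR)
  have tail: "?H (X - F) \<le> ?H (A n) + ennreal (\<Sum>m. r (m + n))" for n
  proof -
    have "X - F \<subseteq> A n \<union> (\<Union>m. R (m + n))"
    proof
      fix x
      assume "x \<in> X - F"
      then obtain j where "x \<in> A j"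
        using UA by blast
      show "x \<in> A n \<union> (\<Union>m. R (m + n))"
      proof (cases "x \<in> A n")
        case False
        define i where "i = (LEAST i. x \<in> A i)"
        have i: "x \<in> A i"
          unfolding i_def by (rule LeastI) fact
        then have "i > n"
          using False A_mono[of i n] by (meson not_le_imp_less subsetD)
        then obtain l where l: "i = Suc (l + n)"
          using less_imp_Suc_add by (metis add.commute)
        have "x \<notin> A (l + n)"
          using not_less_Least[of "l + n" "\<lambda>i. x \<in> A i"] l by (auto simp: i_def)
        with i l show ?thesis
          by (auto simp: R_def)
      qed auto
    qed
    then have "?H (X - F) \<le> ?H (A n \<union> (\<Union>m. R (m + n)))"
      by (rule hausdorff_outer_mono)
    also have "\<dots> \<le> ?H (A n) + ?H (\<Union>m. R (m + n))"
      by (rule hausdorff_outer_Un[OF k])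
    also have "\<dots> \<le> ?H (A n) + (\<Sum>m. ?H (R (m + n)))"
      by (intro add_left_mono hausdorff_outer_subadditive)
    also have "(\<Sum>m. ?H (R (m + n))) = ennreal (\<Sum>m. r (m + n))"
      unfolding HR using summ by (intro suminf_ennreal2) (auto simp: r_nonneg summable_iff_shift)
    finally show ?thesis .
  qed
  have bound: "?H (X \<inter> F) + ?H (X - F) \<le> ?H X + ennreal (\<Sum>m. r (m + n))" for n
  proof -
    have "?H (X \<inter> F) + ?H (X - F) \<le> ?H (X \<inter> F) + (?H (A n) + ennreal (\<Sum>m. r (m + n)))"
      by (rule add_left_mono[OF tail])
    also have "\<dots> \<le> ?H X + ennreal (\<Sum>m. r (m + n))"
      unfolding add.assoc[symmetric] by (rule add_right_mono[OF XA])
    finally show ?thesis .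
  qed
  show ?thesis
  proof (rule ennreal_le_epsilon)
    fix e :: real
    assume "0 < e"
    from suminf_exist_split[OF this summ] obtain n where "norm (\<Sum>m. r (m + n)) < e"
      by blast
    then have "ennreal (\<Sum>m. r (m + n)) \<le> ennreal e"
      by (intro ennreal_leI) auto
    with bound[of n] show "?H (X \<inter> F) + ?H (X - F) \<le> ?H X + ennreal e"
      by (meson add_left_mono order_trans)
  qed
qed auto

lemma measure_space_hausdorff:
  assumes k: "k \<ge> 1"
  shows "measure_space (UNIV :: 'a::metric_space set) (sets borel) (hausdorff_outer k)"
proof -
  let ?L = "lambda_system UNIV (Pow UNIV) (hausdorff_outer k :: 'a set \<Rightarrow> ennreal)"
  interpret P: sigma_algebra UNIV "Pow UNIV :: 'a set set"
    by (rule sigma_algebra_Pow)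
  have L: "measure_space UNIV ?L (hausdorff_outer k)"
    by (rule P.caratheodory_lemma) (rule hausdorff_outer_measure_space[OF k])
  have "F \<in> ?L" if "closed F" for F
  proof (cases "F = {}")
    case False
    have "hausdorff_outer k X \<le> hausdorff_outer k (X \<inter> F) + hausdorff_outer k (X - F)" for X
      using hausdorff_outer_Un[OF k, of "X \<inter> F" "X - F"] by (simp add: Int_Diff_Un)
    then show ?thesis
      unfolding P.lambda_system_eq using hausdorff_outer_closed[OF k that False]
      by (auto intro: antisym)
  qed (auto simp: lambda_system_def hausdorff_outer_empty[OF k])
  then have "sigma_sets UNIV (Collect closed) \<subseteq> ?L"
    using L by (intro sigma_algebra.sigma_sets_subset) (auto simp: measure_space_def)
  then have "sets (borel :: 'a measure) \<subseteq> ?L"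
    by (simp add: borel_eq_closed)
  then show ?thesis
    using measure_down[OF L] sets.sigma_algebra_axioms[of "borel :: 'a measure"] by simp
qed

lemma emeasure_hausdorff_measure:
  fixes A :: "'a::metric_space set"
  assumes "k \<ge> 1" "A \<in> sets borel"
  shows "emeasure (hausdorff_measure k) A = hausdorff_outer k A"
  unfolding hausdorff_measure_def
proof (rule emeasure_measure_of_sigma)
  show "sigma_algebra UNIV (sets (borel :: 'a measure))"
    using sets.sigma_algebra_axioms[of "borel :: 'a measure"] by simp
qed (use measure_space_hausdorff[of k, where 'a = 'a] assms in \<open>simp_all add: measure_space_def\<close>)

lemma sets_hausdorff_measure [simp, measurable_cong]: "sets (hausdorff_measure k) = sets borel"
  unfolding hausdorff_measure_def
  by (metis sets.sets_measure_of_eq space_borel)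

lemma space_hausdorff_measure [simp]: "space (hausdorff_measure k) = UNIV"
  using sets_eq_imp_space_eq[OF sets_hausdorff_measure] by simp

definition surface_measure :: "(real^'n) set \<Rightarrow> (real^'n) measure" where
  "surface_measure S = restrict_space (hausdorff_measure (CARD('n) - 1)) S"

text \<open>
  The norm of a non-measurable function is infinite. \<^const>\<open>esssup\<close> alone would only account for
  measurability of the absolute value.
\<close>

definition Linf_norm :: "(real^'n) set \<Rightarrow> (real^'n \<Rightarrow> complex) \<Rightarrow> ennreal" where
  "Linf_norm S g =
     (if g \<in> borel_measurable (surface_measure S)
      then esssup (surface_measure S) (\<lambda>x. ennreal (norm (g x))) else \<infinity>)"

definition L1_norm :: "(real^'n) set \<Rightarrow> (real^'n \<Rightarrow> complex) \<Rightarrow> ennreal" where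
  "L1_norm S g = (\<integral>\<^sup>+x. ennreal (norm (g x)) \<partial>surface_measure S)"


section \<open>Lipschitz hypersurfaces\<close>

text \<open>
  A coordinate cylinder with centre \<open>ctr\<close>, unit axis \<open>axis_dir\<close>, radius \<open>rad\<close> and (full) height
  \<open>hgt\<close>, together with the function \<open>graph_fun\<close> whose graph is the hypersurface there. A function
  of \<open>d - 1\<close> variables is a function on the hyperplane orthogonal to the axis; centre and axis
  play the role of the rigid motion.
\<close>

record 'n graph_chart =
  ctr :: "real^'n"
  axis_dir :: "real^'n"
  rad :: real
  hgt :: real
  graph_fun :: "real^'n \<Rightarrow> real"

definition tangential :: "real^'n \<Rightarrow> real^'n \<Rightarrow> real^'n" where
  "tangential a z = z - (z \<bullet> a) *\<^sub>R a"

definition cylinder :: "'n::finite graph_chart \<Rightarrow> (real^'n) set" where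
  "cylinder c = {y. norm (tangential (axis_dir c) (y - ctr c)) < rad c \<and>
                    \<bar>(y - ctr c) \<bullet> axis_dir c\<bar> < hgt c / 2}"

definition lipschitz_chart :: "real \<Rightarrow> (real^'n) set \<Rightarrow> 'n::finite graph_chart \<Rightarrow> bool" where
  "lipschitz_chart L S c \<longleftrightarrow>
     norm (axis_dir c) = 1 \<and> rad c > 0 \<and> hgt c > 0 \<and> rad c \<ge> 1 / L \<and> hgt c \<ge> 1 / L \<and>
     L-lipschitz_on {z. z \<bullet> axis_dir c = 0 \<and> norm z < rad c} (graph_fun c) \<and>
     S \<inter> cylinder c =
       {y \<in> cylinder c. (y - ctr c) \<bullet> axis_dir c = graph_fun c (tangential (axis_dir c) (y - ctr c))}"

text \<open>
  \<open>\<A>\<close> exhibits \<open>S\<close> as a compact embedded Lipschitz hypersurface with Lipschitz character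
  bounded by \<open>L\<close>.
\<close>

definition lipschitz_atlas :: "real \<Rightarrow> (real^'n) set \<Rightarrow> 'n::finite graph_chart set \<Rightarrow> bool" where
  "lipschitz_atlas L S \<A> \<longleftrightarrow>
     compact S \<and> finite \<A> \<and> real (card \<A>) \<le> L \<and> S \<subseteq> (\<Union>c\<in>\<A>. cylinder c) \<and>
     (\<forall>c\<in>\<A>. lipschitz_chart L S c)"


section \<open>The Sobolev space of order two and exponent infinity on a hypersurface\<close>

text \<open>Infinitely differentiable: differentiable, with infinitely differentiable partial derivatives.\<close>

coinductive smooth :: "(real^'n \<Rightarrow> real) \<Rightarrow> bool" where
  "(\<And>x. (\<phi> has_derivative (\<lambda>h. D x \<bullet> h)) (at x)) \<Longrightarrow> (\<And>i. smooth (\<lambda>x. D x $ i)) \<Longrightarrow> smooth \<phi>"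

definition test_functions :: "(real^'n) set \<Rightarrow> (real^'n \<Rightarrow> real) set" where
  "test_functions U =
     {\<phi>. smooth \<phi> \<and> compact (closure {x. \<phi> x \<noteq> 0}) \<and> closure {x. \<phi> x \<noteq> 0} \<subseteq> U}"

definition locally_integrable_on ::
    "(real^'n) set \<Rightarrow> (real^'n \<Rightarrow> 'b::euclidean_space) \<Rightarrow> bool" where
  "locally_integrable_on U u \<longleftrightarrow> (\<forall>K. compact K \<and> K \<subseteq> U \<longrightarrow> set_integrable lebesgue K u)"

definition weak_gradient ::
    "(real^'n) set \<Rightarrow> (real^'n \<Rightarrow> complex) \<Rightarrow> (real^'n \<Rightarrow> complex^'n) \<Rightarrow> bool" where
  "weak_gradient U u G \<longleftrightarrow>
     locally_integrable_on U u \<and> locally_integrable_on U G \<and>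
     (\<forall>\<phi> \<in> test_functions U. \<forall>i.
        (LINT x:U|lebesgue. frechet_derivative \<phi> (at x) (axis i 1) *\<^sub>R u x)
        = - (LINT x:U|lebesgue. \<phi> x *\<^sub>R G x $ i))"

definition sup_norm_on :: "(real^'n) set \<Rightarrow> (real^'n \<Rightarrow> 'b::euclidean_space) \<Rightarrow> ennreal" where
  "sup_norm_on U u = esssup (lebesgue_on U) (\<lambda>x. ennreal (norm (u x)))"

text \<open>
  Infinite if \<open>u\<close> has no weak derivatives up to order two. The pairs \<open>(G, H)\<close> over which the
  infimum is taken (gradient and Hessian) agree almost everywhere.
\<close>

definition W2inf_norm_on :: "(real^'n) set \<Rightarrow> (real^'n \<Rightarrow> complex) \<Rightarrow> ennreal" where
  "W2inf_norm_on U u =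
     (INF (G, H) \<in> {(G :: real^'n \<Rightarrow> complex^'n, H :: real^'n \<Rightarrow> complex^'n^'n).
                     weak_gradient U u G \<and> (\<forall>i. weak_gradient U (\<lambda>z. G z $ i) (\<lambda>z. H z $ i))}.
        sup (sup_norm_on U u) (sup (sup_norm_on U G) (sup_norm_on U H)))"

text \<open>
  In a chart, \<open>f\<close> is read off through the graph parametrisation over the part of the base of the
  cylinder over which the graph lies inside the cylinder. The resulting function on the hyperplane
  is extended to be constant along the axis, so that derivatives and their norms are those of the
  function of \<open>d - 1\<close> variables.
\<close>

definition chart_dom :: "'n::finite graph_chart \<Rightarrow> (real^'n) set" where
  "chart_dom c = {z. norm (tangential (axis_dir c) z) < rad c \<and>
                     \<bar>graph_fun c (tangential (axis_dir c) z)\<bar> < hgt c / 2}"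

definition pullback :: "'n::finite graph_chart \<Rightarrow> (real^'n \<Rightarrow> complex) \<Rightarrow> real^'n \<Rightarrow> complex" where
  "pullback c f z =
     f (ctr c + tangential (axis_dir c) z + graph_fun c (tangential (axis_dir c) z) *\<^sub>R axis_dir c)"

definition W2inf_norm :: "'n::finite graph_chart set \<Rightarrow> (real^'n \<Rightarrow> complex) \<Rightarrow> ennreal" where
  "W2inf_norm \<A> f = (SUP c\<in>\<A>. W2inf_norm_on (chart_dom c) (pullback c f))"

text \<open>As usual, an element of the space is identified with its continuous representative.\<close>

definition W2inf ::
    "(real^'n) set \<Rightarrow> 'n::finite graph_chart set \<Rightarrow> (real^'n \<Rightarrow> complex) set" where
  "W2inf S \<A> = {f. continuous_on S f \<and> W2inf_norm \<A> f < \<infinity>}"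


section \<open>Kernels\<close>

definition int_lattice :: "(real^'n) set" where
  "int_lattice = {x. \<forall>i. x $ i \<in> \<int>}"

text \<open>The cube \<open>[-1/2, 1/2]\<^sup>d\<close>.\<close>

definition cell :: "(real^'n) set" where
  "cell = cbox (\<chi> i. - (1/2)) (\<chi> i. 1/2)"

definition L1_cell :: "(real^'n \<Rightarrow> complex) \<Rightarrow> real" where
  "L1_cell \<kappa> = (LINT x:cell|lborel. norm (\<kappa> x))"

text \<open>
  \<open>D1\<close>, \<open>D2\<close> are the first two derivatives on the complement of the lattice (where the periodic
  kernel is twice continuously differentiable); their norms are operator norms.
\<close>

definition admissible_kernel :: "real \<Rightarrow> (real^'n \<Rightarrow> complex) \<Rightarrow> bool" where
  "admissible_kernel K \<kappa> \<longleftrightarrow>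
     K > 0 \<and>
     (\<forall>x. \<forall>k\<in>int_lattice. \<kappa> (x + k) = \<kappa> x) \<and>
     set_integrable lborel cell \<kappa> \<and>
     (\<exists>(D1 :: real^'n \<Rightarrow> (real^'n) \<Rightarrow>\<^sub>L complex)
       (D2 :: real^'n \<Rightarrow> (real^'n) \<Rightarrow>\<^sub>L (real^'n) \<Rightarrow>\<^sub>L complex).
        (\<forall>x\<in>- int_lattice. (\<kappa> has_derivative blinfun_apply (D1 x)) (at x) \<and>
                           (D1 has_derivative blinfun_apply (D2 x)) (at x)) \<and>
        continuous_on (- int_lattice) D2 \<and>
        (\<forall>x\<in>cell - {0}.
           norm (\<kappa> x) \<le> K / norm x ^ (CARD('n) - 1) \<and>
           norm (D1 x) \<le> K / norm x ^ CARD('n) \<and>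
           norm (D2 x) \<le> K / norm x ^ (CARD('n) + 1)))"

definition gauss :: "real \<Rightarrow> real^'n \<Rightarrow> real" where
  "gauss \<delta> y = 1 / (2 * pi * \<delta>\<^sup>2) powr (real CARD('n) / 2) * exp (- ((norm y)\<^sup>2 / (2 * \<delta>\<^sup>2)))"

definition k_long :: "real \<Rightarrow> (real^'n \<Rightarrow> complex) \<Rightarrow> real^'n \<Rightarrow> complex" where
  "k_long \<delta> \<kappa> x = (LINT y|lborel. \<kappa> (x - y) * complex_of_real (gauss \<delta> y))"

definition k_short :: "real \<Rightarrow> (real^'n \<Rightarrow> complex) \<Rightarrow> real^'n \<Rightarrow> complex" where
  "k_short \<delta> \<kappa> x = \<kappa> x - k_long \<delta> \<kappa> x"

definition int_vec :: "int^'n \<Rightarrow> real^'n" where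
  "int_vec k = (\<chi> i. real_of_int (k $ i))"

definition fourier_coeff :: "(real^'n \<Rightarrow> complex) \<Rightarrow> int^'n \<Rightarrow> complex" where
  "fourier_coeff g k = (LINT x:cell|lborel. g x * cis (- 2 * pi * (int_vec k \<bullet> x)))"

definition fourier_trunc :: "nat \<Rightarrow> (real^'n \<Rightarrow> complex) \<Rightarrow> real^'n \<Rightarrow> complex" where
  "fourier_trunc p g x =
     (\<Sum>k | \<forall>i. \<bar>k $ i\<bar> \<le> int p. fourier_coeff g k * cis (2 * pi * (int_vec k \<bullet> x)))"


section \<open>Integral operators\<close>

definition layer_op ::
    "(real^'n) set \<Rightarrow> (real^'n \<Rightarrow> complex) \<Rightarrow> (real^'n \<Rightarrow> complex) \<Rightarrow> real^'n \<Rightarrow> complex" where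
  "layer_op S g f x = (LINT y|surface_measure S. g (x - y) * f y)"

text \<open>
  Principal values over \<open>S \<inter> A\<close>; below \<open>A\<close> is the whole space or a closed ball around \<open>x\<close>.
\<close>

definition pv_trunc ::
    "(real^'n) set \<Rightarrow> (real^'n) set \<Rightarrow> (real^'n \<Rightarrow> complex) \<Rightarrow> (real^'n \<Rightarrow> complex) \<Rightarrow> real^'n
     \<Rightarrow> real \<Rightarrow> complex" where
  "pv_trunc S A g f x \<eta> = (LINT y:(A - cball x \<eta>)|surface_measure S. g (x - y) * f y)"

definition pv_exists ::
    "(real^'n) set \<Rightarrow> (real^'n) set \<Rightarrow> (real^'n \<Rightarrow> complex) \<Rightarrow> (real^'n \<Rightarrow> complex) \<Rightarrow> real^'n
     \<Rightarrow> bool" where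
  "pv_exists S A g f x \<longleftrightarrow> (\<exists>l. (pv_trunc S A g f x \<longlongrightarrow> l) (at_right 0))"

definition pv_op ::
    "(real^'n) set \<Rightarrow> (real^'n \<Rightarrow> complex) \<Rightarrow> (real^'n \<Rightarrow> complex) \<Rightarrow> real^'n \<Rightarrow> complex" where
  "pv_op S g f x = Lim (at_right 0) (pv_trunc S UNIV g f x)"

definition pv_local_op ::
    "real \<Rightarrow> (real^'n) set \<Rightarrow> (real^'n \<Rightarrow> complex) \<Rightarrow> (real^'n \<Rightarrow> complex) \<Rightarrow> real^'n \<Rightarrow> complex" where
  "pv_local_op \<epsilon> S g f x = Lim (at_right 0) (pv_trunc S (cball x \<epsilon>) g f x)"

definition operators_well_defined ::
    "(real^'n) set \<Rightarrow> (real^'n \<Rightarrow> complex) \<Rightarrow> (real^'n \<Rightarrow> complex) \<Rightarrow> bool" where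
  "operators_well_defined S \<kappa> f \<longleftrightarrow>
     (\<forall>x\<in>S. pv_exists S UNIV \<kappa> f x \<and>
        (\<forall>\<delta>. 0 < \<delta> \<and> \<delta> < 1/2 \<longrightarrow>
           pv_exists S UNIV (k_short \<delta> \<kappa>) f x \<and>
           (\<forall>\<epsilon>>\<delta>. pv_exists S (cball x \<epsilon>) (k_short \<delta> \<kappa>) f x)))"

text \<open>
  Operators on the Sobolev space which are linear, and local at scale \<open>\<epsilon>\<close>: the value at \<open>x\<close>
  depends only on the argument on \<open>S \<inter> cball x \<epsilon>\<close>.
\<close>

definition linear_local_op ::
    "real \<Rightarrow> (real^'n) set \<Rightarrow> 'n::finite graph_chart set
     \<Rightarrow> ((real^'n \<Rightarrow> complex) \<Rightarrow> real^'n \<Rightarrow> complex) \<Rightarrow> bool" where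
  "linear_local_op \<epsilon> S \<A> T \<longleftrightarrow>
     (\<forall>f\<in>W2inf S \<A>. \<forall>g\<in>W2inf S \<A>. \<forall>a b. \<forall>x\<in>S.
        T (\<lambda>y. a * f y + b * g y) x = a * T f x + b * T g x) \<and>
     (\<forall>f\<in>W2inf S \<A>. \<forall>g\<in>W2inf S \<A>. \<forall>x\<in>S.
        (\<forall>y\<in>S \<inter> cball x \<epsilon>. f y = g y) \<longrightarrow> T f x = T g x)"

text \<open>
  The approximate local operators \<open>T \<delta> \<epsilon>\<close> depend on \<open>\<delta>\<close> since the short-range kernel does; the
  threshold \<open>\<epsilon>0\<close>, the order \<open>q\<close> and the constant \<open>C\<close> do not.
\<close>

definition local_approximation ::
    "real \<Rightarrow> real \<Rightarrow> real \<Rightarrow> (real^'n) set \<Rightarrow> 'n::finite graph_chart set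
     \<Rightarrow> (real^'n \<Rightarrow> complex) \<Rightarrow> (real^'n \<Rightarrow> complex)
     \<Rightarrow> (real \<Rightarrow> real \<Rightarrow> (real^'n \<Rightarrow> complex) \<Rightarrow> real^'n \<Rightarrow> complex) \<Rightarrow> bool" where
  "local_approximation C \<epsilon>0 q S \<A> \<kappa> f T \<longleftrightarrow>
     \<epsilon>0 > 0 \<and> q \<ge> 0 \<and>
     (\<forall>\<delta> \<epsilon>. 0 < \<delta> \<and> \<delta> < 1/2 \<and> \<delta> < \<epsilon> \<and> \<epsilon> \<le> \<epsilon>0 \<longrightarrow>
        linear_local_op \<epsilon> S \<A> (T \<delta> \<epsilon>) \<and>
        Linf_norm S (\<lambda>x. pv_local_op \<epsilon> S (k_short \<delta> \<kappa>) f x - T \<delta> \<epsilon> f x)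
          \<le> ennreal C * W2inf_norm \<A> f * ennreal (\<epsilon> powr (real CARD('n) + q)))"


section \<open>Constants\<close>

definition upper_Gamma :: "real \<Rightarrow> real \<Rightarrow> real" where
  "upper_Gamma \<alpha> x = (LINT s:{x..}|lborel. s powr (\<alpha> - 1) * exp (- s))"

definition upper_Gamma_const :: "real \<Rightarrow> real \<Rightarrow> bool" where
  "upper_Gamma_const \<alpha> C \<longleftrightarrow>
     (\<forall>x>0. upper_Gamma \<alpha> x \<le> C * (x powr (\<alpha> - 1) + x powr (- 1)) * exp (- x))"

definition C_long :: "(real^'n \<Rightarrow> complex) \<Rightarrow> real" where
  "C_long \<kappa> = real CARD('n) * L1_cell \<kappa> / (2 * pi\<^sup>2) * (1 + 1 / sqrt (2 * pi)) ^ (CARD('n) - 1)"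

definition c_short :: "real \<Rightarrow> real \<Rightarrow> (real^'n \<Rightarrow> complex) \<Rightarrow> real" where
  "c_short C\<^sub>\<kappa> C\<^sub>\<Gamma> \<kappa> =
     (let d = real CARD('n) in
        L1_cell \<kappa> / (2 * pi) powr (d / 2)
          * (1 + 2 ^ CARD('n) * d / (1 - exp (- 1/2)) ^ CARD('n))
        + C\<^sub>\<kappa> * C\<^sub>\<Gamma> / Gamma (d / 2) * (1 / 2 powr (d / 2) + d))"

end

theory Submission
  imports Defs "HOL-Real_Asymp.Real_Asymp"
begin

text \<open>
  Periodising the Gaussian and applying Poisson summation coordinatewise gives an absolutely
  convergent Fourier series for the long-range kernel, with coefficients
  \<open>exp (- 2 \<pi>\<^sup>2 \<delta>\<^sup>2 |k|\<^sup>2)\<close> times those of \<open>\<kappa>\<close>; its tail bounds the truncation error. For the short-range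
  kernel, the convolution is split at the radius \<open>|x| / \<surd>d\<close>. Inside, a second-order Taylor expansion
  is used, whose linear part vanishes by symmetry. Outside, the mass of the Gaussian is an incomplete
  Gamma function, and the contribution of \<open>\<kappa>\<close> is unfolded to a sum over the lattice. Covering the
  Lipschitz graphs by grids shows that the surface measure of a ball of radius \<open>r\<close> is \<open>O(r\<^sup>d\<^sup>-\<^sup>1)\<close>, so that
  a dyadic decomposition bounds the integral of \<open>|x - y|\<^sup>-\<^sup>d\<^sup>-\<^sup>1\<close> over \<open>|x - y| > \<epsilon>\<close> by \<open>O(\<epsilon>\<^sup>-\<^sup>2)\<close>. The
  principal value of \<open>\<kappa>\<close> is the long-range integral, plus the local principal value, plus this far part.
\<close>

section \<open>Integration over fundamental domains\<close>

text \<open>The radius |x| / sqrt d is dictated by the cube: points of the cell have norm at most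
  sqrt d / 2, so the radius r is at most 1/2, and the lattice images of the Gaussian tail, of size
  exp (- 1 / (8 \<delta>^2)), are absorbed by exp (- r^2 / (2 \<delta>^2)). This is the origin of
  the exponent 1 / (2 d). The radius also stays below |x|, since d \<ge> 2, so Taylor segments keep
  the distance (1 - 1 / sqrt d) |x| from every lattice point. The kernel need not be absolutely
  integrable over the surface. As the long-range kernel is bounded, its principal value is an
  ordinary integral, and the whole singularity sits in the local principal value, whose error is
  controlled by hypothesis. The final constant is chosen before the kernel, the surface, the density
  and the incomplete Gamma constant. Hence every bound is explicit in these data, and the density
  enters only through a pointwise bound. A nonmeasurable function has infinite
  \<open>Linf_norm\<close>, so each error term must be shown measurable. For the approximate local
  operator this is read off from the finiteness of the norm in the hypothesis.\<close>

lemma sigma_finite_restrict_lborel: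
  "Q \<in> sets borel \<Longrightarrow> sigma_finite_measure (restrict_space (lborel :: 'a::euclidean_space measure) Q)"
  by (intro sigma_finite_measure_restrict_space lborel.sigma_finite_measure_axioms) simp

lemma sigma_finite_count_space: "sigma_finite_measure (count_space (UNIV :: 'k::countable set))"
  by (rule sigma_finite_measure_count_space_countable) simp

text \<open>After translating back, Tonelli puts the sum over k inside. Each point lies in exactly
  one translate of Q, so the inner sum has a single nonzero term.\<close>

lemma nn_integral_tiling:
  fixes v :: "'k::countable \<Rightarrow> 'a::euclidean_space" and F :: "'a \<Rightarrow> ennreal"
  assumes Q[measurable]: "Q \<in> sets borel" and tile: "\<And>x. \<exists>!k. x - v k \<in> Q"
    and F[measurable]: "F \<in> borel_measurable borel"
  shows "(\<integral>\<^sup>+k. (\<integral>\<^sup>+z. F (z + v k) * indicator Q z \<partial>lborel) \<partial>count_space UNIV)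
    = (\<integral>\<^sup>+x. F x \<partial>lborel)"
proof -
  interpret C: sigma_finite_measure "count_space (UNIV::'k set)"
    by (rule sigma_finite_count_space)
  interpret P: pair_sigma_finite "count_space (UNIV::'k set)" "lborel :: 'a measure" ..
  have "(\<integral>\<^sup>+z. F (z + v k) * indicator Q z \<partial>lborel)
      = (\<integral>\<^sup>+x. F x * indicator Q (x - v k) \<partial>lborel)" for k
    by (subst (2) lborel_distr_plus[symmetric, of "v k"], subst nn_integral_distr)
      (auto simp: add.commute)
  then have "(\<integral>\<^sup>+k. (\<integral>\<^sup>+z. F (z + v k) * indicator Q z \<partial>lborel) \<partial>count_space UNIV)
      = (\<integral>\<^sup>+k. (\<integral>\<^sup>+x. F x * indicator Q (x - v k) \<partial>lborel) \<partial>count_space UNIV)"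
    by simp
  also have "\<dots> = (\<integral>\<^sup>+x. (\<integral>\<^sup>+k. F x * indicator Q (x - v k) \<partial>count_space UNIV) \<partial>lborel)"
    by (rule P.Fubini'[symmetric]) (auto intro!: measurable_pair_measure_countable1)
  also have "\<dots> = (\<integral>\<^sup>+x. F x \<partial>lborel)"
  proof (rule nn_integral_cong)
    fix x
    obtain k0 where k0: "\<And>k. x - v k \<in> Q \<longleftrightarrow> k = k0"
      using tile[of x] by metis
    have "(\<integral>\<^sup>+k. F x * indicator Q (x - v k) \<partial>count_space UNIV)
        = (\<integral>\<^sup>+k. F x * indicator {k0} k \<partial>count_space UNIV)"
      by (rule nn_integral_cong) (auto simp: indicator_def k0)
    then show "(\<integral>\<^sup>+k. F x * indicator Q (x - v k) \<partial>count_space UNIV) = F x"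
      by (simp add: nn_integral_cmult_indicator)
  qed
  finally show ?thesis .
qed

text \<open>Tiling stated as an equality of measures, so that it transfers integrability and Bochner
  integrals and not only nonnegative integrals.\<close>

lemma distr_tiling:
  fixes v :: "'k::countable \<Rightarrow> 'a::euclidean_space"
  assumes Q[measurable]: "Q \<in> sets borel" and tile: "\<And>x. \<exists>!k. x - v k \<in> Q"
  shows "(\<lambda>(k, z). z + v k) \<in> count_space UNIV \<Otimes>\<^sub>M restrict_space lborel Q \<rightarrow>\<^sub>M borel"
    and "distr (count_space UNIV \<Otimes>\<^sub>M restrict_space lborel Q) borel (\<lambda>(k, z). z + v k) = lborel"
proof -
  let ?P = "count_space (UNIV :: 'k set) \<Otimes>\<^sub>M restrict_space (lborel :: 'a measure) Q"
  interpret R: sigma_finite_measure "restrict_space (lborel :: 'a measure) Q"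
    by (rule sigma_finite_restrict_lborel[OF Q])
  show *[measurable]: "(\<lambda>(k, z). z + v k) \<in> ?P \<rightarrow>\<^sub>M borel"
    by (intro measurable_pair_measure_countable1) (auto intro!: measurable_restrict_space1)
  show "distr ?P borel (\<lambda>(k, z). z + v k) = lborel"
  proof (rule measure_eqI)
    fix A assume "A \<in> sets (distr ?P borel (\<lambda>(k, z). z + v k))"
    then have [measurable]: "A \<in> sets borel"
      by simp
    have "emeasure (distr ?P borel (\<lambda>(k, z). z + v k)) A
        = (\<integral>\<^sup>+w. indicator A ((\<lambda>(k, z). z + v k) w) \<partial>?P)"
      by (subst nn_integral_distr[symmetric, of _ _ borel]) auto
    also have "\<dots> = (\<integral>\<^sup>+k. (\<integral>\<^sup>+z. indicator A (z + v k) \<partial>restrict_space lborel Q) \<partial>count_space UNIV)"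
      by (subst R.nn_integral_fst[symmetric]) auto
    also have "\<dots> = (\<integral>\<^sup>+k. (\<integral>\<^sup>+z. indicator A (z + v k) * indicator Q z \<partial>lborel) \<partial>count_space UNIV)"
      by (simp add: nn_integral_restrict_space)
    also have "\<dots> = emeasure lborel A"
      by (subst nn_integral_tiling[OF Q tile]) auto
    finally show "emeasure (distr ?P borel (\<lambda>(k, z). z + v k)) A = emeasure lborel A" .
  qed simp
qed

lemma integral_tiling:
  fixes v :: "'k::countable \<Rightarrow> 'a::euclidean_space"
    and F :: "'a \<Rightarrow> 'b::{banach, second_countable_topology}"
  assumes Q: "Q \<in> sets borel" and tile: "\<And>x. \<exists>!k. x - v k \<in> Q" and F: "integrable lborel F"
  shows "(LINT x|lborel. F x)
      = (LINT z|restrict_space lborel Q. LINT k|count_space UNIV. F (z + v k))"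
proof -
  interpret R: sigma_finite_measure "restrict_space (lborel :: 'a measure) Q"
    by (rule sigma_finite_restrict_lborel[OF Q])
  interpret C: sigma_finite_measure "count_space (UNIV::'k set)"
    by (rule sigma_finite_count_space)
  interpret P: pair_sigma_finite "count_space (UNIV::'k set)" "restrict_space (lborel :: 'a measure) Q" ..
  note d = distr_tiling[OF Q tile]
  have F': "F \<in> borel_measurable borel"
    using F by (simp add: borel_measurable_integrable)
  have *: "integrable (count_space UNIV \<Otimes>\<^sub>M restrict_space lborel Q) (\<lambda>(k, z). F (z + v k))"
    using F by (subst (asm) d(2)[symmetric], subst (asm) integrable_distr_eq[OF d(1) F'])
      (simp add: case_prod_unfold)
  show "(LINT x|lborel. F x)
      = (LINT z|restrict_space lborel Q. LINT k|count_space UNIV. F (z + v k))"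
    by (subst d(2)[symmetric], subst integral_distr[OF d(1) F'])
      (subst P.integral_snd[OF *], simp add: case_prod_unfold)
qed

text \<open>A majorant of product form makes the double integral absolutely convergent, so Fubini
  applies.\<close>

lemma integral_count_space_swap:
  fixes f :: "'k::countable \<Rightarrow> 'a \<Rightarrow> complex"
  assumes M: "sigma_finite_measure M" and f: "\<And>k. f k \<in> borel_measurable M"
    and w: "integrable (count_space UNIV) w" and v: "integrable M v"
    and le: "\<And>k z. z \<in> space M \<Longrightarrow> norm (f k z) \<le> w k * v z"
  shows "(LINT z|M. LINT k|count_space UNIV. f k z) = (LINT k|count_space UNIV. LINT z|M. f k z)"
proof -
  interpret M: sigma_finite_measure M
    by (rule M)
  interpret C: sigma_finite_measure "count_space (UNIV::'k set)"
    by (rule sigma_finite_count_space)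
  interpret P: pair_sigma_finite "count_space (UNIV::'k set)" M ..
  have int: "integrable M (f k)" for k
    by (rule Bochner_Integration.integrable_bound[OF integrable_mult_right[OF v, of "w k"] f])
      (use le in \<open>auto intro!: AE_I2 intro: order_trans[OF _ abs_ge_self]\<close>)
  have "integrable (count_space UNIV \<Otimes>\<^sub>M M) (\<lambda>(k, z). f k z)"
  proof (rule P.Fubini_integrable)
    show "(\<lambda>(k, z). f k z) \<in> borel_measurable (count_space UNIV \<Otimes>\<^sub>M M)"
      by (intro measurable_pair_measure_countable1) (auto intro: f)
    have "(LINT z|M. norm (f k z)) \<le> (LINT z|M. w k * v z)" for k
      using le by (intro integral_mono integrable_norm int integrable_mult_right v)
    then have "norm (LINT z|M. norm (f k z)) \<le> norm (w k * (LINT z|M. v z))" for k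
      by (auto intro: order_trans[OF _ abs_ge_self])
    then show "integrable (count_space UNIV) (\<lambda>k. LINT z|M. norm (case (k, z) of (k, z) \<Rightarrow> f k z))"
      by (intro Bochner_Integration.integrable_bound[OF integrable_mult_left[OF w, of "LINT z|M. v z"]]) auto
  qed (auto intro: int)
  then show ?thesis
    by (rule P.Fubini_integral)
qed

text \<open>A convergent sequence together with its limit is compact, so a majorant for each compact
  set suffices for dominated convergence along sequences.\<close>

lemma continuous_on_integral_dominated:
  fixes f :: "'a::heine_borel \<Rightarrow> 'k \<Rightarrow> 'b::{banach, second_countable_topology}"
  assumes cont: "\<And>k. k \<in> space M \<Longrightarrow> continuous_on S (\<lambda>s. f s k)"
    and meas: "\<And>s. s \<in> S \<Longrightarrow> f s \<in> borel_measurable M"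
    and dom: "\<And>C. compact C \<Longrightarrow> C \<subseteq> S \<Longrightarrow>
      \<exists>w. integrable M w \<and> (\<forall>s\<in>C. \<forall>k\<in>space M. norm (f s k) \<le> w k)"
  shows "continuous_on S (\<lambda>s. LINT k|M. f s k)"
  unfolding continuous_on_sequentially
proof (intro allI ballI impI, elim conjE)
  fix X s assume X: "s \<in> S" "\<forall>n. X n \<in> S" "X \<longlonglongrightarrow> s"
  have "compact (insert s (range X))"
    using X(3) by (rule compact_sequence_with_limit)
  then obtain w where w: "integrable M w" "\<And>s' k. s' \<in> insert s (range X) \<Longrightarrow> k \<in> space M \<Longrightarrow> norm (f s' k) \<le> w k"
    using dom[of "insert s (range X)"] X by blast
  have "(\<lambda>n. LINT k|M. f (X n) k) \<longlonglongrightarrow> (LINT k|M. f s k)"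
  proof (rule integral_dominated_convergence[OF _ _ w(1)])
    show "AE k in M. (\<lambda>n. f (X n) k) \<longlonglongrightarrow> f s k"
      using cont X by (intro AE_I2) (auto simp: continuous_on_sequentially comp_def)
    show "AE k in M. norm (f (X n) k) \<le> w k" for n
      using w(2) by (intro AE_I2) auto
  qed (use X meas in auto)
  then show "((\<lambda>s. LINT k|M. f s k) \<circ> X) \<longlonglongrightarrow> (LINT k|M. f s k)"
    by (simp add: comp_def)
qed

section \<open>Two-sided geometric series, the majorants for all lattice sums\<close>

lemma has_sum_geometric_int_tail:
  fixes q :: real
  assumes q: "0 \<le> q" "q < 1"
  shows "((\<lambda>m. q ^ nat \<bar>m\<bar>) has_sum (2 * q ^ Suc p / (1 - q))) {m :: int. \<bar>m\<bar> > int p}"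
proof -
  have g: "((\<lambda>n. q ^ Suc p * q ^ n) has_sum (q ^ Suc p * (1 / (1 - q)))) (UNIV :: nat set)"
    using q by (intro has_sum_cmult_right has_sum_geometric_from_1 norm_summable_imp_has_sum)
      (auto simp: geometric_sums intro!: summable_geometric)
  define i where "i n = int (Suc p + n)" for n
  have 1: "((\<lambda>m. q ^ nat \<bar>m\<bar>) has_sum (q ^ Suc p * (1 / (1 - q)))) (range i)"
    by (subst has_sum_reindex) (use g in \<open>auto simp: i_def inj_on_def comp_def power_add nat_add_distrib mult.assoc simp flip: of_nat_Suc\<close>)
  have 2: "((\<lambda>m. q ^ nat \<bar>m\<bar>) has_sum (q ^ Suc p * (1 / (1 - q)))) (range (\<lambda>n. - i n))"
    by (subst has_sum_reindex) (use g in \<open>auto simp: i_def inj_on_def comp_def power_add nat_add_distrib mult.assoc simp flip: of_nat_Suc\<close>)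
  have "{m :: int. \<bar>m\<bar> > int p} = range i \<union> range (\<lambda>n. - i n)"
  proof safe
    fix m :: int assume *: "\<bar>m\<bar> > int p" "m \<notin> range (\<lambda>n. - i n)"
    have "m > 0"
    proof (rule ccontr)
      assume "\<not> 0 < m"
      then have "m = - i (nat (- m) - Suc p)"
        using * by (auto simp: i_def)
      with * show False by blast
    qed
    then show "m \<in> range i"
      using * by (intro image_eqI[of _ _ "nat m - Suc p"]) (auto simp: i_def)
  qed (auto simp: i_def)
  moreover have "range i \<inter> range (\<lambda>n. - i n) = {}"
    by (auto simp: i_def)
  ultimately show ?thesis
    using has_sum_Un_disjoint[OF 1 2] by (simp add: add_divide_distrib)
qed

lemma
  fixes q :: real
  assumes q: "0 \<le> q" "q < 1"
  shows integrable_geometric_int_tail: "integrable (count_space {m :: int. \<bar>m\<bar> > int p}) (\<lambda>m. q ^ nat \<bar>m\<bar>)"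
    and integral_geometric_int_tail:
      "(LINT m|count_space {m :: int. \<bar>m\<bar> > int p}. q ^ nat \<bar>m\<bar>) = 2 * q ^ Suc p / (1 - q)"
    and integrable_geometric_int: "integrable (count_space (UNIV :: int set)) (\<lambda>m. q ^ nat \<bar>m\<bar>)"
proof -
  have *: "Infinite_Set_Sum.abs_summable_on (\<lambda>m. q ^ nat \<bar>m\<bar>) {m :: int. \<bar>m\<bar> > int p}" for p
    unfolding abs_summable_equivalent[symmetric]
    using has_sum_geometric_int_tail[OF q, of p] q by (auto simp: summable_on_def)
  show "integrable (count_space {m :: int. \<bar>m\<bar> > int p}) (\<lambda>m. q ^ nat \<bar>m\<bar>)"
    using *[of p] by (simp add: Infinite_Set_Sum.abs_summable_on_def)
  show "(LINT m|count_space {m :: int. \<bar>m\<bar> > int p}. q ^ nat \<bar>m\<bar>) = 2 * q ^ Suc p / (1 - q)"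
    using infsumI[OF has_sum_geometric_int_tail[OF q, of p]] infsetsum_infsum[OF *[of p]]
    by (simp add: infsetsum_def)
  have "UNIV = insert 0 {m :: int. \<bar>m\<bar> > int 0}"
    by auto
  then show "integrable (count_space (UNIV :: int set)) (\<lambda>m. q ^ nat \<bar>m\<bar>)"
    using *[of 0] abs_summable_on_insert_iff[of "\<lambda>m. q ^ nat \<bar>m\<bar>" 0 "{m :: int. \<bar>m\<bar> > int 0}"]
    by (metis Infinite_Set_Sum.abs_summable_on_def)
qed

section \<open>Poisson summation for the normal density\<close>

definition unit_ivl :: "real measure" where
  "unit_ivl = restrict_space lborel {-1/2..<1/2}"

lemma space_unit_ivl [simp]: "space unit_ivl = {-1/2..<1/2}"
  by (simp add: unit_ivl_def space_restrict_space)

interpretation unit_ivl: prob_space unit_ivl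
  by (rule prob_spaceI) (simp add: unit_ivl_def emeasure_restrict_space space_restrict_space)

lemma measurable_unit_ivl: "f \<in> borel_measurable borel \<Longrightarrow> f \<in> borel_measurable unit_ivl"
  unfolding unit_ivl_def by (intro measurable_restrict_space1) simp

lemma integrable_unit_ivl:
  fixes f :: "real \<Rightarrow> 'b::{banach, second_countable_topology}"
  assumes "continuous_on UNIV f"
  shows "integrable unit_ivl f"
proof -
  have "set_integrable lborel {-1/2..1/2} f"
    by (rule borel_integrable_atLeastAtMost') (rule continuous_on_subset[OF assms], simp)
  then have "set_integrable lborel {-1/2..<1/2} f"
    by (rule set_integrable_subset) auto
  then show ?thesis
    unfolding unit_ivl_def set_integrable_def by (subst integrable_restrict_space) auto
qed

lemma tile_unit_ivl: "\<exists>!m::int. x - real_of_int m \<in> {-1/2..<1/2}"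
proof (rule ex1I[of _ "\<lfloor>x + 1/2\<rfloor>"])
  show "x - real_of_int \<lfloor>x + 1/2\<rfloor> \<in> {-1/2..<1/2}"
    by simp linarith
  show "m = \<lfloor>x + 1/2\<rfloor>" if "x - real_of_int m \<in> {-1/2..<1/2}" for m
    using that by (intro floor_unique[symmetric]) auto
qed

lemma integral_cis_unit_ivl:
  "(LINT s|unit_ivl. cis (2 * pi * real_of_int m * s)) = (if m = 0 then 1 else 0)"
proof (cases "m = 0")
  case True
  then show ?thesis
    by (simp add: unit_ivl_def space_restrict_space measure_restrict_space)
next
  case False
  let ?f = "\<lambda>s. cis (2 * pi * real_of_int m * s)"
  let ?F = "\<lambda>s. cis (2 * pi * real_of_int m * s) / (\<i> * of_real (2 * pi * real_of_int m))"
  have F: "(?F has_vector_derivative ?f s) (at s within A)" for s A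
    unfolding has_vector_derivative_def using False
    by (auto intro!: derivative_eq_intros simp: scaleR_conv_of_real fun_eq_iff mult.left_commute mult.commute)
  have "(LINT s|unit_ivl. ?f s) = (LINT s:{-1/2..<1/2}|lborel. ?f s)"
    by (simp add: unit_ivl_def integral_restrict_space set_lebesgue_integral_def)
  also have "\<dots> = (LINT s:{-1/2..1/2}|lborel. ?f s)"
    unfolding set_lebesgue_integral_def
  proof (rule integral_cong_AE)
    have [measurable]: "?f \<in> borel_measurable borel"
      by (intro borel_measurable_continuous_onI continuous_intros)
    show "(\<lambda>s. indicator {-1/2..<1/2} s *\<^sub>R ?f s) \<in> borel_measurable lborel"
      "(\<lambda>s. indicator {-1/2..1/2} s *\<^sub>R ?f s) \<in> borel_measurable lborel"
      by measurable
    show "AE s in lborel. indicator {-1/2..<1/2} s *\<^sub>R ?f s = indicator {-1/2..1/2} s *\<^sub>R ?f s"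
      using AE_lborel_singleton[of "1/2::real"] by (auto elim!: eventually_mono simp: indicator_def)
  qed
  also have "\<dots> = ?F (1/2) - ?F (-1/2)"
    unfolding set_lebesgue_integral_def
    by (rule integral_FTC_atLeastAtMost[of "-1/2" "1/2" ?F ?f, OF _ F]) (simp, intro continuous_intros)
  also have "\<dots> = 0"
  proof -
    have "cis (pi * real_of_int m) = cis (- (pi * real_of_int m))"
      by (simp add: complex_eq_iff)
    then show ?thesis
      by (simp add: field_simps)
  qed
  finally show ?thesis
    using False by simp
qed

text \<open>
  If \<open>g 0 \<noteq> 0\<close>, integrate \<open>g\<close> against the powers of a trigonometric polynomial which exceeds
  \<open>1\<close> in absolute value only close to \<open>0\<close>.
\<close>

lemma fourier_uniqueness_at_0:
  fixes g :: "real \<Rightarrow> complex"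
  assumes cont: "continuous_on UNIV g"
    and zero: "\<And>m::int. (LINT s|unit_ivl. g s * cis (2 * pi * real_of_int m * s)) = 0"
  shows "g 0 = 0"
proof (rule ccontr)
  assume g0: "g 0 \<noteq> 0"
  \<comment> \<open>Rotating by the phase of \<open>g 0\<close> makes the relevant part real, with
    value |g 0|^2 > 0 at 0.\<close>
  define h where "h s = Re (g s * cnj (g 0))" for s
  define c where "c = h 0"
  have c: "c > 0"
    using g0 by (simp add: c_def h_def complex_neq_0 flip: power2_eq_square)
  have conth: "continuous_on UNIV h"
    unfolding h_def by (intro continuous_intros cont)
  then have "isCont h 0"
    by (simp add: continuous_on_eq_continuous_at)
  then have "\<exists>e>0. \<forall>s. dist s 0 < e \<longrightarrow> dist (h s) (h 0) < c / 2"
    using half_gt_zero[OF c] unfolding continuous_at_eps_delta by blast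
  then obtain \<eta>0 where \<eta>0: "\<eta>0 > 0" "\<And>s. \<bar>s\<bar> < \<eta>0 \<Longrightarrow> \<bar>h s - c\<bar> < c / 2"
    by (auto simp: dist_real_def c_def)
  define \<eta> where "\<eta> = min (\<eta>0 / 2) (1/4)"
  have \<eta>: "0 < \<eta>" "\<eta> \<le> 1/4" "\<And>s. \<bar>s\<bar> \<le> \<eta> \<Longrightarrow> h s \<ge> c / 2"
  proof -
    fix s assume "\<bar>s\<bar> \<le> \<eta>"
    then have "\<bar>s\<bar> < \<eta>0"
      using \<eta>0(1) by (auto simp: \<eta>_def min_def split: if_splits)
    then show "h s \<ge> c / 2"
      using \<eta>0(2)[of s] by linarith
  qed (use \<eta>0 in \<open>auto simp: \<eta>_def\<close>)
  \<comment> \<open>Within one period, p exceeds 1 exactly for |s| < \<eta>.\<close>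
  define p where "p s = 1 + cos (2 * pi * s) - cos (2 * pi * \<eta>)" for s :: real
  have contp: "continuous_on UNIV p"
    unfolding p_def by (intro continuous_intros)
  have p_cis: "complex_of_real (p s) = complex_of_real (1 - cos (2 * pi * \<eta>))
      + cis (2 * pi * s) / 2 + cis (- (2 * pi * s)) / 2" for s
    by (simp add: p_def complex_eq_iff)
  \<comment> \<open>Multiplication by p shifts frequencies by at most 1, so the induction on n needs
    all frequencies m at once.\<close>
  have trig0: "(LINT s|unit_ivl. g s * of_real (p s ^ n) * cis (2 * pi * real_of_int m * s)) = 0" for n m
  proof (induction n arbitrary: m)
    case 0
    show ?case
      using zero by simp
  next
    case (Suc n)
    let ?G = "\<lambda>m s. g s * of_real (p s ^ n) * cis (2 * pi * real_of_int m * s)"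
    have int: "integrable unit_ivl (?G m)" for m
      by (intro integrable_unit_ivl continuous_intros cont contp)
    have eq: "g s * of_real (p s ^ Suc n) * cis (2 * pi * real_of_int m * s)
        = of_real (1 - cos (2 * pi * \<eta>)) * ?G m s + (1/2) * ?G (m + 1) s + (1/2) * ?G (m - 1) s" for s
    proof -
      have *: "cis (2 * pi * real_of_int (m + 1) * s) = cis (2 * pi * real_of_int m * s) * cis (2 * pi * s)"
        "cis (2 * pi * real_of_int (m - 1) * s) = cis (2 * pi * real_of_int m * s) * cis (- (2 * pi * s))"
        unfolding cis_mult by (simp_all add: algebra_simps)
      show ?thesis
        unfolding * power_Suc of_real_mult p_cis by (simp add: algebra_simps)
    qed
    show ?case
      unfolding eq
      by (simp only: Bochner_Integration.integral_add integral_mult_right_zero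
          Bochner_Integration.integrable_add integrable_mult_right int Suc.IH) simp
  qed
  have hp0: "(LINT s|unit_ivl. h s * p s ^ n) = 0" for n
  proof -
    have "integrable unit_ivl (\<lambda>s. g s * of_real (p s ^ n) * cnj (g 0))"
      by (intro integrable_unit_ivl continuous_intros cont contp)
    from integral_Re[OF this] have "(LINT s|unit_ivl. Re (g s * of_real (p s ^ n) * cnj (g 0))) = 0"
      using trig0[of n 0] by simp
    moreover have "Re (g s * of_real (p s ^ n) * cnj (g 0)) = h s * p s ^ n" for s
      by (simp add: h_def algebra_simps)
    ultimately show ?thesis
      by simp
  qed
  \<comment> \<open>This is the value of p at \<eta> / 2, its minimum over the middle half of the
    interval around 0.\<close>
  define \<beta> where "\<beta> = 1 + cos (pi * \<eta>) - cos (2 * pi * \<eta>)"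
  have \<beta>: "\<beta> > 1"
    unfolding \<beta>_def using \<eta> cos_monotone_0_pi[of "pi * \<eta>" "2 * pi * \<eta>"] by simp
  \<comment> \<open>For |s| \<le> \<eta> both h and p are nonnegative, with p at least \<beta> on
    the middle half. Elsewhere |p| \<le> 1, so the loss is at most |h|, uniformly in n.\<close>
  have lower: "c / 2 * \<beta> ^ n * indicator {-\<eta>/2..\<eta>/2} s - \<bar>h s\<bar> \<le> h s * p s ^ n"
    if s: "s \<in> {-1/2..<1/2}" for s n
  proof (cases "\<bar>s\<bar> \<le> \<eta>")
    case True
    have c2: "cos (2 * pi * \<bar>s\<bar>) = cos (2 * pi * s)"
      by (cases "s \<ge> 0") auto
    have "cos (2 * pi * \<eta>) \<le> cos (2 * pi * \<bar>s\<bar>)"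
      using \<eta> True by (intro cos_monotone_0_pi_le) auto
    then have p1: "p s \<ge> 1"
      using c2 by (simp add: p_def)
    show ?thesis
    proof (cases "\<bar>s\<bar> \<le> \<eta> / 2")
      case s2: True
      have "cos (pi * \<eta>) \<le> cos (2 * pi * \<bar>s\<bar>)"
        using \<eta> s2 by (intro cos_monotone_0_pi_le) (auto simp: field_simps)
      then have "p s \<ge> \<beta>"
        using c2 by (simp add: p_def \<beta>_def)
      then have "\<beta> ^ n \<le> p s ^ n"
        using \<beta> by (intro power_mono) auto
      then have "c / 2 * \<beta> ^ n \<le> h s * p s ^ n"
        using \<eta>(3)[OF True] c \<beta> by (intro mult_mono) auto
      moreover have "c / 2 * \<beta> ^ n * indicator {-\<eta>/2..\<eta>/2} s \<le> c / 2 * \<beta> ^ n"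
        using c \<beta> by (auto simp: indicator_def)
      ultimately show ?thesis
        by linarith
    next
      case False
      then have "s \<notin> {-\<eta>/2..\<eta>/2}"
        by auto
      moreover have "0 \<le> h s * p s ^ n"
        using \<eta>(3)[OF True] c p1 by simp
      ultimately show ?thesis
        by simp
    qed
  next
    case False
    have c2: "cos (2 * pi * \<bar>s\<bar>) = cos (2 * pi * s)"
      by (cases "s \<ge> 0") auto
    have "pi * \<bar>s\<bar> * 2 \<le> pi * 1"
      using s by (subst mult.assoc, intro mult_left_mono) auto
    then have "cos (2 * pi * \<bar>s\<bar>) \<le> cos (2 * pi * \<eta>)"
      using \<eta> False by (intro cos_monotone_0_pi_le) auto
    moreover have "0 \<le> 2 * pi * \<eta>" "2 * pi * \<eta> \<le> pi / 2"
      using \<eta> by auto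
    then have "cos (2 * pi * \<eta>) \<ge> 0"
      using cos_ge_zero[of "2 * pi * \<eta>"] pi_gt_zero by linarith
    moreover have "cos (2 * pi * \<eta>) \<le> 1" "cos (2 * pi * s) \<ge> -1"
      by auto
    ultimately have "\<bar>p s\<bar> \<le> 1"
      using c2 unfolding p_def abs_le_iff by linarith
    then have "\<bar>p s\<bar> ^ n \<le> 1"
      by (simp add: power_le_one)
    then have "\<bar>h s * p s ^ n\<bar> \<le> \<bar>h s\<bar>"
      by (simp add: abs_mult power_abs mult_left_le)
    moreover have "s \<notin> {-\<eta>/2..\<eta>/2}"
      using False \<eta> by auto
    ultimately show ?thesis
      by (simp add: abs_le_iff)
  qed
  define I where "I = {-\<eta>/2..\<eta>/2}"
  define H where "H = (LINT s|unit_ivl. \<bar>h s\<bar>)"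
  have inth: "integrable unit_ivl (\<lambda>s. \<bar>h s\<bar>)"
    by (intro integrable_unit_ivl continuous_intros conth)
  have m\<eta>: "measure unit_ivl {-\<eta>/2..\<eta>/2} = \<eta>"
  proof -
    have "{-\<eta>/2..\<eta>/2} \<subseteq> {-1/2..<1/2}"
      using \<eta> by auto
    then show ?thesis
      using \<eta> by (simp add: unit_ivl_def measure_restrict_space)
  qed
  have "c / 2 * \<beta> ^ n * \<eta> - H \<le> 0" for n
  proof -
    have S: "{-\<eta>/2..\<eta>/2} \<in> sets unit_ivl"
      using \<eta> by (auto simp: unit_ivl_def sets_restrict_space image_iff intro!: exI[of _ "{-\<eta>/2..\<eta>/2}"])
    have ii: "integrable unit_ivl (\<lambda>s. c / 2 * \<beta> ^ n * indicator {-\<eta>/2..\<eta>/2} s)"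
      by (intro integrable_mult_right integrable_real_indicator S) (simp add: unit_ivl.emeasure_eq_measure)
    have "c / 2 * \<beta> ^ n * \<eta> - H
        = (LINT s|unit_ivl. c / 2 * \<beta> ^ n * indicator {-\<eta>/2..\<eta>/2} s - \<bar>h s\<bar>)"
      using inth ii S m\<eta> unfolding I_def[symmetric]
      by (subst Bochner_Integration.integral_diff) (auto simp: H_def sets.Int_space_eq2 simp del: space_unit_ivl)
    also have "\<dots> \<le> (LINT s|unit_ivl. h s * p s ^ n)"
    proof (rule integral_mono)
      show "integrable unit_ivl (\<lambda>s. h s * p s ^ n)"
        by (intro integrable_unit_ivl continuous_intros conth contp)
    qed (use lower inth ii in auto)
    finally show ?thesis
      using hp0 by simp
  qed
  \<comment> \<open>The contribution near 0 grows geometrically in n while the loss H is fixed, yet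
    the integrals all vanish.\<close>
  moreover obtain n where "\<beta> ^ n > H / (c / 2 * \<eta>)"
    using real_arch_pow[OF \<beta>] by blast
  then have "c / 2 * \<beta> ^ n * \<eta> - H > 0"
    using c \<eta> by (simp add: field_simps)
  ultimately show False
    by (meson not_le)
qed

lemma integral_count_space_single:
  fixes f :: "'k \<Rightarrow> 'b::{banach, second_countable_topology}"
  assumes "\<And>m. m \<noteq> a \<Longrightarrow> f m = 0"
  shows "integral\<^sup>L (count_space UNIV) f = f a"
  using infsetsum_cong_neutral[of UNIV "{a}" f f] assms by (simp flip: infsetsum_def)

text \<open>The Fourier transform of the normal density with standard deviation \<delta> at the
  frequency 2 pi m, hence a Fourier coefficient of its periodisation.\<close>

definition heat_coeff :: "real \<Rightarrow> int \<Rightarrow> real" where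
  "heat_coeff \<delta> m = exp (- (2 * pi\<^sup>2 * \<delta>\<^sup>2 * (real_of_int m)\<^sup>2))"

lemma heat_coeff_nonneg [simp]: "0 \<le> heat_coeff \<delta> m"
  by (simp add: heat_coeff_def)

lemma norm_cis_mult_heat [simp]: "norm (complex_of_real (heat_coeff \<delta> m) * cis x) = heat_coeff \<delta> m"
  by (simp add: norm_mult)

lemma integrable_heat_coeff:
  assumes "\<delta> > 0"
  shows "integrable (count_space UNIV) (heat_coeff \<delta>)"
proof (rule Bochner_Integration.integrable_bound)
  let ?q = "exp (- (2 * pi\<^sup>2 * \<delta>\<^sup>2))"
  show "integrable (count_space UNIV) (\<lambda>m::int. ?q ^ nat \<bar>m\<bar>)"
    using assms by (intro integrable_geometric_int) auto
  have "heat_coeff \<delta> m \<le> ?q ^ nat \<bar>m\<bar>" for m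
  proof -
    have "real_of_int \<bar>m\<bar> \<le> (real_of_int m)\<^sup>2"
      using self_le_power[of "\<bar>m\<bar>" 2] by (cases "m = 0") (simp_all flip: of_int_power of_int_abs, linarith?)
    then have "2 * pi\<^sup>2 * \<delta>\<^sup>2 * real (nat \<bar>m\<bar>) \<le> 2 * pi\<^sup>2 * \<delta>\<^sup>2 * (real_of_int m)\<^sup>2"
      by (intro mult_left_mono) auto
    then show ?thesis
      by (simp add: heat_coeff_def mult_ac flip: exp_of_nat_mult)
  qed
  then show "AE m in count_space UNIV. norm (heat_coeff \<delta> m) \<le> norm (?q ^ nat \<bar>m\<bar>)"
    by simp
qed simp

lemma integrable_heat_series:
  assumes "\<delta> > 0"
  shows "integrable (count_space UNIV) (\<lambda>m. complex_of_real (heat_coeff \<delta> m) * cis (x m))"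
  by (rule Bochner_Integration.integrable_bound[OF integrable_heat_coeff[OF assms]]) auto

text \<open>Expanding (|x| / \<delta> - \<delta>)^2 \<ge> 0 trades the Gaussian for an exponential:
  x^2 / (2 \<delta>^2) \<ge> |x| - \<delta>^2 / 2. The resulting majorant is uniform for |s| \<le>
  R.\<close>

lemma normal_density_le_geometric:
  assumes "\<delta> > 0" "\<bar>s\<bar> \<le> R"
  shows "normal_density 0 \<delta> (s - real_of_int m)
    \<le> exp (\<delta>\<^sup>2 / 2 + R) / sqrt (2 * pi * \<delta>\<^sup>2) * exp (-1) ^ nat \<bar>m\<bar>"
proof -
  let ?x = "s - real_of_int m"
  have "0 \<le> (\<bar>?x\<bar> / \<delta> - \<delta>)\<^sup>2"
    by simp
  also have "\<dots> = ?x\<^sup>2 / \<delta>\<^sup>2 - 2 * \<bar>?x\<bar> + \<delta>\<^sup>2"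
    using assms by (simp add: power2_diff power_divide)
  finally have "- (?x\<^sup>2 / (2 * \<delta>\<^sup>2)) \<le> \<delta>\<^sup>2 / 2 - \<bar>?x\<bar>"
    by (simp add: field_simps)
  also have "\<dots> \<le> \<delta>\<^sup>2 / 2 + R - real (nat \<bar>m\<bar>)"
    using assms(2) by auto
  finally have "exp (- (?x\<^sup>2 / (2 * \<delta>\<^sup>2))) \<le> exp (\<delta>\<^sup>2 / 2 + R - real (nat \<bar>m\<bar>))"
    by simp
  also have "\<dots> = exp (\<delta>\<^sup>2 / 2 + R) * exp (-1) ^ nat \<bar>m\<bar>"
    by (simp only: exp_of_nat_mult[symmetric] exp_add[symmetric]) simp
  finally show ?thesis
    using assms by (simp add: normal_density_def field_simps)
qed

definition periodic_normal :: "real \<Rightarrow> real \<Rightarrow> real" where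
  "periodic_normal \<delta> s = (LINT m|count_space UNIV. normal_density 0 \<delta> (s - real_of_int m))"

lemma
  assumes "\<delta> > 0"
  shows integrable_periodic_normal:
      "integrable (count_space UNIV) (\<lambda>m::int. normal_density 0 \<delta> (s - real_of_int m))"
    and continuous_periodic_normal: "continuous_on UNIV (periodic_normal \<delta>)"
proof -
  let ?w = "\<lambda>R m::int. exp (\<delta>\<^sup>2 / 2 + R) / sqrt (2 * pi * \<delta>\<^sup>2) * exp (-1) ^ nat \<bar>m\<bar>"
  have w: "integrable (count_space UNIV) (?w R)" for R :: real
    by (intro integrable_mult_right integrable_geometric_int) auto
  show "integrable (count_space UNIV) (\<lambda>m::int. normal_density 0 \<delta> (s - real_of_int m))"
    by (rule Bochner_Integration.integrable_bound[OF w[of "\<bar>s\<bar>"]])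
      (use normal_density_le_geometric[OF assms, of s "\<bar>s\<bar>"] in auto)
  show "continuous_on UNIV (periodic_normal \<delta>)"
    unfolding periodic_normal_def[abs_def]
  proof (rule continuous_on_integral_dominated)
    show "continuous_on UNIV (\<lambda>s. normal_density 0 \<delta> (s - real_of_int m))" for m
      unfolding normal_density_def using assms by (intro continuous_intros) auto
    fix C :: "real set" assume "compact C"
    then obtain R where R: "\<And>s. s \<in> C \<Longrightarrow> \<bar>s\<bar> \<le> R"
      using compact_imp_bounded bounded_real by metis
    then show "\<exists>w. integrable (count_space UNIV) w \<and>
        (\<forall>s\<in>C. \<forall>m\<in>space (count_space UNIV). norm (normal_density 0 \<delta> (s - real_of_int m)) \<le> w m)"
      using w[of R] normal_density_le_geometric[OF assms] by (intro exI[of _ "?w R"]) auto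
  qed simp
qed

lemma fourier_normal_density:
  assumes "\<delta> > 0"
  shows "(LINT u|lborel. complex_of_real (normal_density 0 \<delta> u) * cis (t * u))
    = complex_of_real (exp (- (\<delta>\<^sup>2 * t\<^sup>2 / 2)))"
proof -
  have nd: "normal_density 0 \<delta> (\<delta> * x) = std_normal_density x / \<delta>" for x
    using assms by (simp add: normal_density_def real_sqrt_mult power_mult_distrib)
  have step: "\<delta> *\<^sub>R (complex_of_real (normal_density 0 \<delta> (\<delta> * x)) * cis (t * (\<delta> * x)))
      = std_normal_density x *\<^sub>R iexp (t * \<delta> * x)" for x
    unfolding nd using assms by (simp add: scaleR_conv_of_real cis_conv_exp mult_ac)
  have "(LINT u|lborel. complex_of_real (normal_density 0 \<delta> u) * cis (t * u))
      = (LINT x|lborel. \<delta> *\<^sub>R (complex_of_real (normal_density 0 \<delta> (\<delta> * x)) * cis (t * (\<delta> * x))))"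
    using assms by (subst lborel_integral_real_affine[where c = \<delta> and t = 0]) simp_all
  also have "\<dots> = (LINT x|lborel. std_normal_density x *\<^sub>R iexp (t * \<delta> * x))"
    unfolding step ..
  also have "\<dots> = char std_normal_distribution (t * \<delta>)"
    unfolding char_def by (subst integral_density) auto
  also have "\<dots> = complex_of_real (exp (- (\<delta>\<^sup>2 * t\<^sup>2 / 2)))"
    by (simp add: char_std_normal_distribution power_mult_distrib mult.commute)
  finally show ?thesis .
qed

lemma bij_uminus_int: "bij_betw (uminus :: int \<Rightarrow> int) UNIV UNIV"
  by (rule bij_betwI[of _ _ _ uminus]) auto

text \<open>Characters of integer frequency are invariant under integer shifts, so the integral over
  one period unfolds to the Fourier transform on the line. The shift s is carried along because
  uniqueness is available only at the point 0.\<close>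

lemma fourier_coeff_periodic_normal:
  assumes "\<delta> > 0"
  shows "(LINT x|unit_ivl. complex_of_real (periodic_normal \<delta> (x + s)) * cis (2 * pi * real_of_int k * x))
    = complex_of_real (heat_coeff \<delta> k) * cis (- (2 * pi * real_of_int k * s))"
proof -
  let ?F = "\<lambda>x. complex_of_real (normal_density 0 \<delta> (x + s)) * cis (2 * pi * real_of_int k * x)"
  have int0: "integrable lborel (\<lambda>x. normal_density 0 \<delta> (x + s))"
    using lborel_integrable_real_affine[of "normal_density 0 \<delta>" 1 s] assms by (simp add: add.commute)
  have int: "integrable lborel ?F"
  proof (rule Bochner_Integration.integrable_bound[OF int0])
    show "?F \<in> borel_measurable lborel"
      by (simp, intro borel_measurable_times borel_measurable_of_real borel_measurable_continuous_onI[of "\<lambda>x. cis (2 * pi * real_of_int k * x)"])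
        (auto intro!: continuous_intros)
  qed (simp add: norm_mult)
  have "(LINT u|lborel. ?F u) = (LINT u|lborel. ?F (-s + 1 * u))"
    by (subst lborel_integral_real_affine[where c = 1 and t = "-s"]) auto
  also have "\<dots> = (LINT u|lborel. cis (- (2 * pi * real_of_int k * s)) *
      (complex_of_real (normal_density 0 \<delta> u) * cis (2 * pi * real_of_int k * u)))"
    by (intro Bochner_Integration.integral_cong) (auto simp: cis_mult algebra_simps)
  also have "\<dots> = cis (- (2 * pi * real_of_int k * s)) * complex_of_real (heat_coeff \<delta> k)"
    unfolding integral_mult_right_zero fourier_normal_density[OF assms]
    by (simp add: heat_coeff_def power_mult_distrib algebra_simps)
  finally have 1: "(LINT u|lborel. ?F u) = complex_of_real (heat_coeff \<delta> k) * cis (- (2 * pi * real_of_int k * s))"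
    by simp
  have "(LINT m|count_space UNIV. ?F (x + real_of_int m))
      = complex_of_real (periodic_normal \<delta> (x + s)) * cis (2 * pi * real_of_int k * x)" for x
  proof -
    have "cis (2 * pi * real_of_int k * (x + real_of_int m)) = cis (2 * pi * real_of_int k * x)" for m
    proof -
      have "2 * pi * real_of_int k * (x + real_of_int m)
          = 2 * pi * real_of_int k * x + 2 * pi * real_of_int (k * m)"
        by (simp add: algebra_simps)
      then show ?thesis
        using cis_multiple_2pi[of "real_of_int (k * m)"] by (simp flip: cis_mult)
    qed
    then have "(LINT m|count_space UNIV. ?F (x + real_of_int m))
        = complex_of_real (LINT m|count_space UNIV. normal_density 0 \<delta> (x + s - real_of_int (- m)))
          * cis (2 * pi * real_of_int k * x)"
      by (simp add: algebra_simps flip: integral_of_real)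
    then show ?thesis
      using integral_bij_count_space[OF bij_uminus_int, of "\<lambda>m. normal_density 0 \<delta> (x + s - real_of_int m)"]
      by (simp add: periodic_normal_def)
  qed
  then have "(LINT u|lborel. ?F u)
      = (LINT x|unit_ivl. complex_of_real (periodic_normal \<delta> (x + s)) * cis (2 * pi * real_of_int k * x))"
    unfolding unit_ivl_def by (subst integral_tiling[OF _ tile_unit_ivl int]) auto
  with 1 show ?thesis
    by simp
qed

definition heat_series :: "real \<Rightarrow> real \<Rightarrow> complex" where
  "heat_series \<delta> s = (LINT m|count_space UNIV. complex_of_real (heat_coeff \<delta> m) * cis (2 * pi * real_of_int m * s))"

lemma continuous_heat_series:
  assumes "\<delta> > 0"
  shows "continuous_on UNIV (heat_series \<delta>)"
  unfolding heat_series_def[abs_def]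
proof (rule continuous_on_integral_dominated)
  show "\<exists>w. integrable (count_space UNIV) w \<and> (\<forall>s\<in>C. \<forall>m\<in>space (count_space UNIV).
      norm (complex_of_real (heat_coeff \<delta> m) * cis (2 * pi * real_of_int m * s)) \<le> w m)" for C
    using integrable_heat_coeff[OF assms] by (intro exI[of _ "heat_coeff \<delta>"]) auto
qed (auto intro!: continuous_intros)

text \<open>Orthogonality leaves only the term m = - k, and \<open>heat_coeff\<close> is even in
  m.\<close>

lemma fourier_coeff_heat_series:
  assumes "\<delta> > 0"
  shows "(LINT x|unit_ivl. heat_series \<delta> (x + s) * cis (2 * pi * real_of_int k * x))
    = complex_of_real (heat_coeff \<delta> k) * cis (- (2 * pi * real_of_int k * s))"
proof -
  let ?f = "\<lambda>m x. complex_of_real (heat_coeff \<delta> m) * cis (2 * pi * real_of_int m * (x + s)) * cis (2 * pi * real_of_int k * x)"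
  have "(LINT x|unit_ivl. heat_series \<delta> (x + s) * cis (2 * pi * real_of_int k * x))
      = (LINT x|unit_ivl. LINT m|count_space UNIV. ?f m x)"
    by (simp add: heat_series_def)
  also have "\<dots> = (LINT m|count_space UNIV. LINT x|unit_ivl. ?f m x)"
    by (rule integral_count_space_swap[where w = "heat_coeff \<delta>" and v = "\<lambda>_. 1"])
      (auto simp: norm_mult unit_ivl.sigma_finite_measure_axioms integrable_heat_coeff[OF assms]
        intro!: measurable_unit_ivl borel_measurable_continuous_onI continuous_intros)
  also have "\<dots> = (LINT m|count_space UNIV.
      complex_of_real (heat_coeff \<delta> k) * cis (- (2 * pi * real_of_int k * s)) * indicator {-k} m)"
  proof (rule Bochner_Integration.integral_cong[OF refl])
    fix m
    have eq: "?f m x = complex_of_real (heat_coeff \<delta> m) * cis (2 * pi * real_of_int m * s)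
        * cis (2 * pi * real_of_int (m + k) * x)" for x
      by (simp add: cis_mult algebra_simps)
    have "(LINT x|unit_ivl. ?f m x) = complex_of_real (heat_coeff \<delta> m) * cis (2 * pi * real_of_int m * s)
        * (if m + k = 0 then 1 else 0)"
      unfolding eq integral_mult_right_zero integral_cis_unit_ivl ..
    also have "\<dots> = complex_of_real (heat_coeff \<delta> k) * cis (- (2 * pi * real_of_int k * s)) * indicator {-k} m"
      by (auto simp: indicator_def heat_coeff_def add_eq_0_iff)
    finally show "(LINT x|unit_ivl. ?f m x)
      = complex_of_real (heat_coeff \<delta> k) * cis (- (2 * pi * real_of_int k * s)) * indicator {-k} m" .
  qed
  also have "\<dots> = complex_of_real (heat_coeff \<delta> k) * cis (- (2 * pi * real_of_int k * s))"
    by (subst integral_count_space_single[of "-k"]) auto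
  finally show ?thesis .
qed

text \<open>Both sides are continuous and, after every translation, have the same Fourier
  coefficients. Translating the difference by s brings the point s to 0, where uniqueness
  applies.\<close>

theorem poisson_summation_normal:
  assumes "\<delta> > 0"
  shows "complex_of_real (periodic_normal \<delta> s) = heat_series \<delta> s"
proof -
  define g where "g x = complex_of_real (periodic_normal \<delta> (x + s)) - heat_series \<delta> (x + s)" for x
  have c: "continuous_on UNIV (\<lambda>x. periodic_normal \<delta> (x + s))" "continuous_on UNIV (\<lambda>x. heat_series \<delta> (x + s))"
    by (rule continuous_on_compose2[OF continuous_periodic_normal[OF assms]]
        continuous_on_compose2[OF continuous_heat_series[OF assms]]; auto intro!: continuous_intros)+
  have "g 0 = 0"
  proof (rule fourier_uniqueness_at_0)
    show "continuous_on UNIV g"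
      unfolding g_def by (intro continuous_intros c)
    fix k
    have i: "integrable unit_ivl (\<lambda>x. complex_of_real (periodic_normal \<delta> (x + s)) * cis (2 * pi * real_of_int k * x))"
      "integrable unit_ivl (\<lambda>x. heat_series \<delta> (x + s) * cis (2 * pi * real_of_int k * x))"
      by (intro integrable_unit_ivl continuous_intros c)+
    show "(LINT x|unit_ivl. g x * cis (2 * pi * real_of_int k * x)) = 0"
      unfolding g_def left_diff_distrib using i
      by (simp add: fourier_coeff_periodic_normal[OF assms] fourier_coeff_heat_series[OF assms])
  qed
  then show ?thesis
    by (simp add: g_def)
qed

section \<open>Total size and tails of the heat coefficients\<close>

text \<open>For small \<delta> the coefficients decay slowly, but Poisson summation at 0 trades
  their sum for \<open>periodic_normal \<delta> 0\<close>, whose terms decay fast. The term 0 is 1 /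
  (sqrt (2 pi) \<delta>). Since \<delta> < 1/2 gives m^2 / (2 \<delta>^2) \<ge> 2 |m|, the other
  terms add at most two thirds of it.\<close>

lemma integral_heat_coeff_le:
  assumes \<delta>: "0 < \<delta>" "\<delta> < 1/2"
  shows "(LINT m|count_space UNIV. heat_coeff \<delta> m) \<le> (1 + 1 / sqrt (2 * pi)) / \<delta>"
proof -
  let ?q = "exp (-2) :: real"
  let ?S = "1 / (sqrt (2 * pi) * \<delta>)"
  have "complex_of_real (LINT m|count_space UNIV. heat_coeff \<delta> m) = heat_series \<delta> 0"
    by (simp add: heat_series_def)
  also have "\<dots> = complex_of_real (periodic_normal \<delta> 0)"
    using \<delta> by (simp add: poisson_summation_normal)
  finally have "(LINT m|count_space UNIV. heat_coeff \<delta> m) = periodic_normal \<delta> 0"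
    by (simp only: of_real_eq_iff)
  also have "\<dots> \<le> (LINT m::int|count_space UNIV. ?S * ?q ^ nat \<bar>m\<bar>)"
    unfolding periodic_normal_def
  proof (rule integral_mono)
    show "integrable (count_space UNIV) (\<lambda>m::int. ?S * ?q ^ nat \<bar>m\<bar>)"
      by (intro integrable_mult_right integrable_geometric_int) auto
    show "normal_density 0 \<delta> (0 - real_of_int m) \<le> ?S * ?q ^ nat \<bar>m\<bar>" for m
    proof -
      have m: "real_of_int \<bar>m\<bar> \<le> (real_of_int m)\<^sup>2"
        using self_le_power[of "\<bar>m\<bar>" 2] by (cases "m = 0") (simp_all flip: of_int_power of_int_abs, linarith?)
      have d: "\<delta>\<^sup>2 \<le> (1/2)\<^sup>2"
        using \<delta> by (intro power_mono) auto
      then have "2 * (2 * \<delta>\<^sup>2) * real_of_int \<bar>m\<bar> \<le> 1 * (real_of_int m)\<^sup>2"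
        using m by (intro mult_mono) (auto simp: power2_eq_square)
      then have "2 * real (nat \<bar>m\<bar>) \<le> (real_of_int m)\<^sup>2 / (2 * \<delta>\<^sup>2)"
        using \<delta> by (simp add: field_simps)
      then have "exp (- ((real_of_int m)\<^sup>2 / (2 * \<delta>\<^sup>2))) \<le> ?q ^ nat \<bar>m\<bar>"
        by (simp flip: exp_of_nat_mult)
      then show ?thesis
        using \<delta> by (simp add: normal_density_def real_sqrt_mult field_simps)
    qed
  qed (use integrable_periodic_normal[of \<delta> 0] \<delta> in auto)
  also have "\<dots> = ?S * (1 + 2 * ?q / (1 - ?q))"
  proof -
    define B where "B = {m::int. \<bar>m\<bar> > int 0}"
    define g where "g = (\<lambda>m::int. ?q ^ nat \<bar>m\<bar>)"
    have "(LINT m::int|count_space UNIV. g m) = infsetsum g ({0} \<union> B)"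
      unfolding infsetsum_def by (rule arg_cong[where f = "\<lambda>A. integral\<^sup>L (count_space A) _"]) (auto simp: B_def)
    also have "\<dots> = infsetsum g {0} + infsetsum g B"
    proof (rule infsetsum_Un_disjoint)
      show "Infinite_Set_Sum.abs_summable_on g {0}"
        by (rule abs_summable_on_finite) simp
      show "Infinite_Set_Sum.abs_summable_on g B"
        using integrable_geometric_int_tail[of ?q 0]
        unfolding Infinite_Set_Sum.abs_summable_on_def B_def g_def by simp
    qed (simp add: B_def)
    also have "infsetsum g {0} = 1"
      by (simp add: g_def)
    also have "infsetsum g B = 2 * ?q / (1 - ?q)"
      using integral_geometric_int_tail[of ?q 0] unfolding infsetsum_def g_def B_def by simp
    finally have "(LINT m::int|count_space UNIV. ?q ^ nat \<bar>m\<bar>) = 1 + 2 * ?q / (1 - ?q)"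
      by (simp only: g_def)
    then show ?thesis
      by simp
  qed
  also have "\<dots> \<le> ?S * (5/3)"
  proof -
    have "(2::real) * 2 \<le> exp 1 * exp 1"
      using exp_ge_add_one_self[of 1] by (intro mult_mono) auto
    then have "exp (2::real) \<ge> 4"
      by (simp flip: exp_add)
    then have "?q \<le> 1/4"
      by (simp add: exp_minus field_simps)
    then have "1 + 2 * ?q / (1 - ?q) \<le> 5/3"
      by (simp add: field_simps)
    then show ?thesis
      using \<delta> by (intro mult_left_mono) auto
  qed
  \<comment> \<open>The excess 2 / (3 r) is absorbed by the summand 1, because r \<ge> 1.\<close>
  also have "\<dots> \<le> (1 + 1 / sqrt (2 * pi)) / \<delta>"
  proof -
    define r where "r = sqrt (2 * pi)"
    have "r \<ge> 1"
      using pi_gt3 by (simp add: r_def)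
    then show ?thesis
      using \<delta> unfolding r_def[symmetric] by (simp add: field_simps)
  qed
  finally show ?thesis .
qed

text \<open>The parabola a m^2 lies above its tangent at m = p, that is, a m^2 \<ge> 2 a p |m| - a
  p^2. This turns the tail into a geometric series with ratio q = exp (- 2 a p), starting at p +
  1.\<close>

lemma
  assumes "\<delta> > 0" "p \<ge> 1"
  shows integrable_heat_coeff_tail:
      "integrable (count_space UNIV) (\<lambda>m. indicator {m. \<bar>m\<bar> > int p} m * heat_coeff \<delta> m)"
    and integral_heat_coeff_tail_le:
      "(LINT m|count_space UNIV. indicator {m. \<bar>m\<bar> > int p} m * heat_coeff \<delta> m)
        \<le> exp (- 2 * pi\<^sup>2 * \<delta>\<^sup>2 * (real p)\<^sup>2) / (2 * pi\<^sup>2 * \<delta>\<^sup>2 * real p)"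
proof -
  define a where "a = 2 * pi\<^sup>2 * \<delta>\<^sup>2"
  define q where "q = exp (- (2 * a * real p))"
  have a: "a > 0"
    using assms by (simp add: a_def)
  have q: "0 < q" "q < 1"
    using a assms by (auto simp: q_def)
  show int: "integrable (count_space UNIV) (\<lambda>m. indicator {m. \<bar>m\<bar> > int p} m * heat_coeff \<delta> m)"
    by (rule Bochner_Integration.integrable_bound[OF integrable_heat_coeff[OF assms(1)]])
      (auto simp: indicator_def)
  have le: "heat_coeff \<delta> m \<le> exp (a * (real p)\<^sup>2) * q ^ nat \<bar>m\<bar>" for m
  proof -
    have "0 \<le> a * (real_of_int \<bar>m\<bar> - real p)\<^sup>2"
      using a by simp
    then have "- (a * (real_of_int m)\<^sup>2) \<le> a * (real p)\<^sup>2 - real (nat \<bar>m\<bar>) * (2 * a * real p)"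
      by (simp add: power2_diff algebra_simps)
    then have "exp (- (a * (real_of_int m)\<^sup>2)) \<le> exp (a * (real p)\<^sup>2 - real (nat \<bar>m\<bar>) * (2 * a * real p))"
      by simp
    also have "\<dots> = exp (a * (real p)\<^sup>2) * q ^ nat \<bar>m\<bar>"
      unfolding q_def by (simp only: exp_of_nat_mult[symmetric] exp_add[symmetric]) simp
    finally show ?thesis
      by (simp add: heat_coeff_def a_def)
  qed
  have "(LINT m|count_space UNIV. indicator {m. \<bar>m\<bar> > int p} m * heat_coeff \<delta> m)
      = (LINT m|count_space {m. \<bar>m\<bar> > int p}. heat_coeff \<delta> m)"
    using infsetsum_altdef[of "heat_coeff \<delta>" "{m. \<bar>m\<bar> > int p}"]
    by (simp add: infsetsum_def set_lebesgue_integral_def)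
  also have "\<dots> \<le> (LINT m|count_space {m. \<bar>m\<bar> > int p}. exp (a * (real p)\<^sup>2) * q ^ nat \<bar>m\<bar>)"
  proof (rule integral_mono)
    show "integrable (count_space {m. \<bar>m\<bar> > int p}) (heat_coeff \<delta>)"
      using abs_summable_on_subset[of "heat_coeff \<delta>" UNIV] integrable_heat_coeff[OF assms(1)]
      by (simp add: Infinite_Set_Sum.abs_summable_on_def)
    show "integrable (count_space {m. \<bar>m\<bar> > int p}) (\<lambda>m. exp (a * (real p)\<^sup>2) * q ^ nat \<bar>m\<bar>)"
      using q by (intro integrable_mult_right integrable_geometric_int_tail) auto
  qed (rule le)
  also have "\<dots> = exp (a * (real p)\<^sup>2) * q ^ p * (2 * q / (1 - q))"
    using q by (simp add: integral_geometric_int_tail)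
  also have "exp (a * (real p)\<^sup>2) * q ^ p = exp (- (a * (real p)\<^sup>2))"
    unfolding q_def by (simp only: exp_of_nat_mult[symmetric] exp_add[symmetric])
      (simp add: power2_eq_square algebra_simps)
  \<comment> \<open>Here 2 q / (1 - q) = 2 / (1 / q - 1), and 1 / q = exp (2 a p) \<ge> 1 + 2 a
    p.\<close>
  also have "exp (- (a * (real p)\<^sup>2)) * (2 * q / (1 - q)) \<le> exp (- (a * (real p)\<^sup>2)) * (1 / (a * real p))"
  proof (rule mult_left_mono)
    have "q * (1 + 2 * a * real p) \<le> q * exp (2 * a * real p)"
      using q by (intro mult_left_mono exp_ge_add_one_self) auto
    also have "\<dots> = 1"
      by (simp add: q_def flip: exp_add)
    finally show "2 * q / (1 - q) \<le> 1 / (a * real p)"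
      using q a assms(2) by (simp add: field_simps)
  qed simp
  finally show "(LINT m|count_space UNIV. indicator {m. \<bar>m\<bar> > int p} m * heat_coeff \<delta> m)
        \<le> exp (- 2 * pi\<^sup>2 * \<delta>\<^sup>2 * (real p)\<^sup>2) / (2 * pi\<^sup>2 * \<delta>\<^sup>2 * real p)"
    by (simp add: a_def)
qed

section \<open>Products over coordinates: Poisson summation in d dimensions\<close>

lemma
  fixes f :: "'n::finite \<Rightarrow> 'k::countable \<Rightarrow> 'c::{real_normed_field, banach, second_countable_topology}"
  assumes f: "\<And>i. integrable (count_space UNIV) (f i)"
  shows integrable_count_space_prod_vec:
      "integrable (count_space UNIV) (\<lambda>k::'k^'n. \<Prod>i\<in>UNIV. f i (k $ i))"
    and integral_count_space_prod_vec:
      "(LINT k::'k^'n|count_space UNIV. (\<Prod>i\<in>UNIV. f i (k $ i))) = (\<Prod>i\<in>UNIV. LINT m|count_space UNIV. f i m)"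
proof -
  have b: "bij_betw (vec_nth :: 'k^'n \<Rightarrow> _) UNIV (PiE UNIV (\<lambda>_. UNIV))"
    by (rule bij_betwI[of _ _ _ vec_lambda]) auto
  have "Infinite_Set_Sum.abs_summable_on (f i) UNIV" for i
    using f by (simp add: Infinite_Set_Sum.abs_summable_on_def)
  note P = abs_summable_on_prod_PiE[of UNIV "\<lambda>_. UNIV" f, OF _ _ this]
    infsetsum_prod_PiE[of UNIV "\<lambda>_. UNIV" f, OF _ _ this]
  show "integrable (count_space UNIV) (\<lambda>k::'k^'n. \<Prod>i\<in>UNIV. f i (k $ i))"
    using P(1) abs_summable_on_reindex_bij_betw[OF b, of "\<lambda>g. \<Prod>i\<in>UNIV. f i (g i)"]
    by (simp add: Infinite_Set_Sum.abs_summable_on_def)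
  show "(LINT k::'k^'n|count_space UNIV. (\<Prod>i\<in>UNIV. f i (k $ i))) = (\<Prod>i\<in>UNIV. LINT m|count_space UNIV. f i m)"
    using P(2) infsetsum_reindex_bij_betw[OF b, of "\<lambda>g. \<Prod>i\<in>UNIV. f i (g i)"]
    by (simp add: infsetsum_def)
qed

lemma gauss_eq_prod:
  assumes "\<delta> > 0"
  shows "gauss \<delta> (y :: real^'n) = (\<Prod>i\<in>UNIV. normal_density 0 \<delta> (y $ i))"
proof -
  have "(2 * pi * \<delta>\<^sup>2) powr (real CARD('n) / 2) = ((2 * pi * \<delta>\<^sup>2) powr (1 / 2)) powr real CARD('n)"
    by (simp add: powr_powr)
  also have "\<dots> = sqrt (2 * pi * \<delta>\<^sup>2) ^ CARD('n)"
    using assms by (simp add: powr_half_sqrt powr_realpow del: real_sqrt_mult)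
  finally have "(2 * pi * \<delta>\<^sup>2) powr (real CARD('n) / 2) = sqrt (2 * pi * \<delta>\<^sup>2) ^ CARD('n)" .
  moreover have "exp (- ((norm y)\<^sup>2 / (2 * \<delta>\<^sup>2))) = (\<Prod>i\<in>UNIV. exp (- (y $ i)\<^sup>2 / (2 * \<delta>\<^sup>2)))"
    by (simp add: exp_sum[symmetric] norm_vec_def L2_set_def sum_nonneg sum_negf sum_divide_distrib)
  ultimately show ?thesis
    by (simp add: gauss_def normal_density_def prod_dividef power_divide)
qed

lemma gauss_nonneg [simp]: "0 \<le> gauss \<delta> y"
  by (simp add: gauss_def)

lemma borel_measurable_gauss [measurable]: "gauss \<delta> \<in> borel_measurable borel"
  unfolding gauss_def[abs_def] by measurable

definition heat_coeff_vec :: "real \<Rightarrow> int^'n \<Rightarrow> real" where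
  "heat_coeff_vec \<delta> k = (\<Prod>i\<in>UNIV. heat_coeff \<delta> (k $ i))"

lemma heat_coeff_vec_nonneg [simp]: "0 \<le> heat_coeff_vec \<delta> k"
  by (simp add: heat_coeff_vec_def prod_nonneg)

lemma integrable_heat_coeff_vec: "\<delta> > 0 \<Longrightarrow> integrable (count_space UNIV) (heat_coeff_vec \<delta>)"
  unfolding heat_coeff_vec_def[abs_def]
  by (intro integrable_count_space_prod_vec integrable_heat_coeff)

lemma cis_int_vec_inner:
  "cis (2 * pi * (int_vec k \<bullet> x)) = (\<Prod>i\<in>UNIV. cis (2 * pi * real_of_int (k $ i) * x $ i))"
  by (simp add: cis_conv_exp exp_sum[symmetric] int_vec_def inner_vec_def sum_distrib_left mult_ac)

lemma
  fixes w :: "real^'n"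
  assumes "\<delta> > 0"
  shows integrable_gauss_lattice: "integrable (count_space UNIV) (\<lambda>k. gauss \<delta> (w - int_vec k))"
    and poisson_summation_gauss: "complex_of_real (LINT k|count_space UNIV. gauss \<delta> (w - int_vec k))
      = (LINT k|count_space UNIV. heat_coeff_vec \<delta> k * cis (2 * pi * (int_vec k \<bullet> w)))"
proof -
  note i = integrable_periodic_normal[OF assms]
  show "integrable (count_space UNIV) (\<lambda>k. gauss \<delta> (w - int_vec k))"
    unfolding gauss_eq_prod[OF assms]
    using integrable_count_space_prod_vec[where f = "\<lambda>i m. normal_density 0 \<delta> (w $ i - real_of_int m)", OF i] by (simp add: int_vec_def)
  have "complex_of_real (LINT k|count_space UNIV. gauss \<delta> (w - int_vec k))
      = (\<Prod>i\<in>UNIV. complex_of_real (periodic_normal \<delta> (w $ i)))"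
    unfolding gauss_eq_prod[OF assms] periodic_normal_def
    using integral_count_space_prod_vec[where f = "\<lambda>i m. normal_density 0 \<delta> (w $ i - real_of_int m)", OF i] by (simp add: int_vec_def)
  also have "\<dots> = (\<Prod>i\<in>UNIV. heat_series \<delta> (w $ i))"
    by (simp add: poisson_summation_normal[OF assms])
  also have "\<dots> = (LINT k|count_space UNIV. (\<Prod>i\<in>UNIV. complex_of_real (heat_coeff \<delta> (k $ i)) * cis (2 * pi * real_of_int (k $ i) * w $ i)))"
    unfolding heat_series_def by (subst integral_count_space_prod_vec) (auto intro: integrable_heat_series assms)
  finally show "complex_of_real (LINT k|count_space UNIV. gauss \<delta> (w - int_vec k))
      = (LINT k|count_space UNIV. heat_coeff_vec \<delta> k * cis (2 * pi * (int_vec k \<bullet> w)))"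
    by (simp add: cis_int_vec_inner heat_coeff_vec_def prod.distrib)
qed

text \<open>The Poisson series has nonnegative coefficients, so it is largest in absolute value at w
  = 0. This makes the bound uniform in w.\<close>

lemma integral_gauss_lattice_le:
  fixes w :: "real^'n"
  assumes "\<delta> > 0"
  shows "(LINT k|count_space UNIV. gauss \<delta> (w - int_vec k)) \<le> (LINT k::int^'n|count_space UNIV. heat_coeff_vec \<delta> k)"
proof -
  have "(LINT k|count_space UNIV. gauss \<delta> (w - int_vec k))
      \<le> norm (complex_of_real (LINT k|count_space UNIV. gauss \<delta> (w - int_vec k)))"
    by simp
  also have "\<dots> \<le> (LINT k::int^'n|count_space UNIV. heat_coeff_vec \<delta> k)"
    unfolding poisson_summation_gauss[OF assms]
    by (rule order_trans[OF integral_norm_bound]) (simp add: norm_mult)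
  finally show ?thesis .
qed

text \<open>Every k in B has some coordinate beyond p, so the sum over B is at most the sum, over
  the coordinates i, of the sums with coordinate i beyond p. Each of these factors into one
  one-dimensional tail and d - 1 complete sums.\<close>

lemma integral_heat_coeff_vec_tail_le:
  assumes \<delta>: "0 < \<delta>" "\<delta> < 1/2" and p: "p \<ge> 1"
  defines "B \<equiv> {k :: int^'n. \<not> (\<forall>i. \<bar>k $ i\<bar> \<le> int p)}"
  shows "(LINT k|count_space B. heat_coeff_vec \<delta> k)
    \<le> real CARD('n) * (exp (- 2 * pi\<^sup>2 * \<delta>\<^sup>2 * (real p)\<^sup>2) / (2 * pi\<^sup>2 * \<delta>\<^sup>2 * real p))
      * ((1 + 1 / sqrt (2 * pi)) / \<delta>) ^ (CARD('n) - 1)"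
proof -
  let ?t = "\<lambda>m. indicator {m. \<bar>m\<bar> > int p} m * heat_coeff \<delta> m"
  let ?f = "\<lambda>i j. if j = i then ?t else heat_coeff \<delta>"
  let ?g = "\<lambda>i (k::int^'n). \<Prod>j\<in>UNIV. ?f i j (k $ j)"
  have f: "integrable (count_space UNIV) (?f i j)" for i j :: 'n
    using integrable_heat_coeff_tail[OF \<delta>(1) p] integrable_heat_coeff[OF \<delta>(1)] by auto
  note g = integrable_count_space_prod_vec[OF f] integral_count_space_prod_vec[OF f]
  have g_eq: "?g i k = (if \<bar>k $ i\<bar> > int p then heat_coeff_vec \<delta> k else 0)" for i k
  proof -
    have "?g i k = ?t (k $ i) * (\<Prod>j\<in>UNIV - {i}. ?f i j (k $ j))"
      by (subst prod.remove[of _ i]) auto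
    also have "(\<Prod>j\<in>UNIV - {i}. ?f i j (k $ j)) = (\<Prod>j\<in>UNIV - {i}. heat_coeff \<delta> (k $ j))"
      by (intro prod.cong) auto
    finally show ?thesis
      unfolding heat_coeff_vec_def by (subst (2) prod.remove[of _ i]) (auto simp: indicator_def)
  qed
  have "(LINT k|count_space B. heat_coeff_vec \<delta> k) = (LINT k|count_space UNIV. indicator B k * heat_coeff_vec \<delta> k)"
    using infsetsum_altdef[of "heat_coeff_vec \<delta>" B]
    by (simp add: infsetsum_def set_lebesgue_integral_def)
  also have "\<dots> \<le> (LINT k|count_space UNIV. (\<Sum>i\<in>UNIV. ?g i k))"
  proof (rule integral_mono)
    show "integrable (count_space UNIV) (\<lambda>k. indicator B k * heat_coeff_vec \<delta> k)"
      by (rule Bochner_Integration.integrable_bound[OF integrable_heat_coeff_vec[OF \<delta>(1)]])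
        (auto simp: indicator_def)
    show "indicator B k * heat_coeff_vec \<delta> k \<le> (\<Sum>i\<in>UNIV. ?g i k)" for k
    proof (cases "k \<in> B")
      case True
      then obtain i where i: "\<bar>k $ i\<bar> > int p"
        by (auto simp: B_def not_le)
      then have "heat_coeff_vec \<delta> k = ?g i k"
        unfolding g_eq by simp
      also have "\<dots> \<le> (\<Sum>i\<in>UNIV. ?g i k)"
        by (rule member_le_sum) (auto simp: g_eq)
      finally show ?thesis
        using True by simp
    next
      case False
      then show ?thesis
        by (auto simp: g_eq intro!: sum_nonneg)
    qed
  qed (intro Bochner_Integration.integrable_sum g(1))
  also have "\<dots> = (\<Sum>i\<in>(UNIV::'n set). \<Prod>j\<in>UNIV. LINT m|count_space UNIV. ?f i j m)"
    by (subst Bochner_Integration.integral_sum) (auto simp only: g)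
  also have "\<dots> = (\<Sum>i\<in>(UNIV::'n set). (LINT m|count_space UNIV. ?t m) * (LINT m|count_space UNIV. heat_coeff \<delta> m) ^ (CARD('n) - 1))"
  proof (rule sum.cong[OF refl])
    fix i :: 'n
    have "(\<Prod>j\<in>UNIV. LINT m|count_space UNIV. ?f i j m)
        = (LINT m|count_space UNIV. ?t m) * (\<Prod>j\<in>UNIV - {i}. LINT m|count_space UNIV. ?f i j m)"
      by (subst prod.remove[of _ i]) auto
    also have "(\<Prod>j\<in>UNIV - {i}. LINT m|count_space UNIV. ?f i j m) = (\<Prod>j\<in>UNIV - {i}. LINT m|count_space UNIV. heat_coeff \<delta> m)"
      by (intro prod.cong) auto
    finally show "(\<Prod>j\<in>UNIV. LINT m|count_space UNIV. ?f i j m)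
        = (LINT m|count_space UNIV. ?t m) * (LINT m|count_space UNIV. heat_coeff \<delta> m) ^ (CARD('n) - 1)"
      by (simp add: card_Diff_singleton)
  qed
  also have "\<dots> \<le> (\<Sum>i\<in>(UNIV::'n set). (exp (- 2 * pi\<^sup>2 * \<delta>\<^sup>2 * (real p)\<^sup>2) / (2 * pi\<^sup>2 * \<delta>\<^sup>2 * real p))
      * ((1 + 1 / sqrt (2 * pi)) / \<delta>) ^ (CARD('n) - 1))"
    using \<delta> p by (intro sum_mono mult_mono power_mono integral_heat_coeff_tail_le integral_heat_coeff_le)
      auto
  finally show ?thesis
    by simp
qed

section \<open>Fourier expansion of the long-range kernel\<close>

text \<open>Half-open, so that lattice translates tile the space without overlap. It agrees with
  \<open>cell\<close> up to a null set.\<close>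

definition unit_cube :: "(real^'n) set" where
  "unit_cube = {x. \<forall>i. -1/2 \<le> x $ i \<and> x $ i < 1/2}"

definition cube_measure :: "(real^'n) measure" where
  "cube_measure = restrict_space lborel unit_cube"

lemma mem_cell: "x \<in> cell \<longleftrightarrow> (\<forall>i. -1/2 \<le> x $ i \<and> x $ i \<le> 1/2)"
  by (simp add: cell_def mem_box_cart)

lemma unit_cube_borel [measurable]: "unit_cube \<in> sets (borel :: (real^'n) measure)"
proof -
  have "unit_cube = (\<Inter>i. {x :: real^'n. -1/2 \<le> x $ i \<and> x $ i < 1/2})"
    by (auto simp: unit_cube_def)
  also have "\<dots> \<in> sets borel"
    by (intro sets.countable_INT'') auto
  finally show ?thesis .
qed

lemma space_cube_measure [simp]: "space cube_measure = unit_cube"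
  by (simp add: cube_measure_def space_restrict_space)

lemma unit_cube_subset_cell: "unit_cube \<subseteq> cell"
  by (auto simp: unit_cube_def mem_cell less_imp_le)

lemma AE_unit_cube_eq_cell: "AE x in lborel. x \<in> unit_cube \<longleftrightarrow> x \<in> (cell :: (real^'n) set)"
proof (rule AE_I')
  let ?a = "(\<chi> i. - (1/2)) :: real^'n" and ?b = "(\<chi> i. 1/2) :: real^'n"
  have "emeasure lborel (cbox ?a ?b - box ?a ?b) = emeasure lborel (cbox ?a ?b) - emeasure lborel (box ?a ?b)"
    using emeasure_lborel_box_finite[of ?a ?b] by (intro emeasure_Diff) (auto simp: box_subset_cbox)
  also have "\<dots> = 0"
    by (simp add: emeasure_lborel_cbox_eq emeasure_lborel_box_eq)
  finally show "cell - box ?a ?b \<in> null_sets lborel"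
    by (auto simp: null_sets_def cell_def)
  show "{x \<in> space lborel. \<not> (x \<in> unit_cube \<longleftrightarrow> x \<in> cell)} \<subseteq> cell - box ?a ?b"
    by (auto simp: unit_cube_def mem_cell mem_box_cart less_imp_le)
qed

lemma set_integral_cell:
  fixes f :: "real^'n \<Rightarrow> 'b::{banach, second_countable_topology}"
  assumes [measurable]: "f \<in> borel_measurable borel"
  shows "(LINT x:cell|lborel. f x) = integral\<^sup>L cube_measure f"
    and "set_integrable lborel cell f \<longleftrightarrow> integrable cube_measure f"
proof -
  have [measurable]: "cell \<in> sets (borel :: (real^'n) measure)"
    by (simp add: cell_def)
  have AE: "AE x in lborel. indicator cell x *\<^sub>R f x = indicator unit_cube x *\<^sub>R f x"
    using AE_unit_cube_eq_cell by eventually_elim (simp add: indicator_def)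
  show "(LINT x:cell|lborel. f x) = integral\<^sup>L cube_measure f"
    using integral_cong_AE[OF _ _ AE]
    by (simp add: cube_measure_def integral_restrict_space set_lebesgue_integral_def)
  show "set_integrable lborel cell f \<longleftrightarrow> integrable cube_measure f"
    using integrable_cong_AE[OF _ _ AE]
    by (simp add: cube_measure_def integrable_restrict_space set_integrable_def)
qed

interpretation cube: finite_measure "cube_measure :: (real^'n) measure"
proof (rule finite_measureI)
  have "emeasure lborel (unit_cube :: (real^'n) set) \<le> emeasure lborel (cell :: (real^'n) set)"
    by (rule emeasure_mono[OF unit_cube_subset_cell]) (simp add: cell_def)
  also have "\<dots> < \<infinity>"
    unfolding cell_def by (rule emeasure_lborel_cbox_finite)
  finally show "emeasure (cube_measure :: (real^'n) measure) (space cube_measure) \<noteq> \<infinity>"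
    by (simp add: cube_measure_def emeasure_restrict_space space_restrict_space)
qed

lemma measure_cube [simp]: "measure (cube_measure :: (real^'n) measure) unit_cube = 1"
proof -
  have "integral\<^sup>L (cube_measure :: (real^'n) measure) (\<lambda>_. 1 :: real) = (LINT x:cell|(lborel :: (real^'n) measure). 1)"
    by (rule set_integral_cell(1)[symmetric]) simp
  also have "\<dots> = measure lborel (cell :: (real^'n) set)"
    by (simp add: set_lebesgue_integral_def cell_def)
  also have "\<dots> = 1"
    by (simp add: cell_def content_cbox_cart interval_ne_empty_cart less_imp_le)
  finally show ?thesis
    by simp
qed

lemma measurable_cube: "f \<in> borel_measurable borel \<Longrightarrow> f \<in> borel_measurable cube_measure"
  unfolding cube_measure_def by (intro measurable_restrict_space1) simp

lemma tile_unit_cube: "\<exists>!k. x - int_vec k \<in> unit_cube"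
proof (rule ex1I[of _ "\<chi> i. \<lfloor>x $ i + 1/2\<rfloor>"])
  show "x - int_vec (\<chi> i. \<lfloor>x $ i + 1/2\<rfloor>) \<in> unit_cube"
    unfolding unit_cube_def int_vec_def by (simp, intro allI conjI; linarith)
  show "k = (\<chi> i. \<lfloor>x $ i + 1/2\<rfloor>)" if "x - int_vec k \<in> unit_cube" for k
  proof -
    have "\<lfloor>x $ i + 1/2\<rfloor> = k $ i" for i
    proof -
      have "-1/2 \<le> x $ i - real_of_int (k $ i)" "x $ i - real_of_int (k $ i) < 1/2"
        using that by (auto simp: unit_cube_def int_vec_def)
      then show ?thesis
        by (intro floor_unique) auto
    qed
    then show ?thesis
      by (simp add: vec_eq_iff)
  qed
qed

text \<open>The shifted cube is again a fundamental domain. Cutting it along the original tiling and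
  moving the pieces back by lattice vectors leaves the periodic function unchanged; the bound B
  provides integrability.\<close>

lemma integral_cube_translate:
  fixes h :: "real^'n \<Rightarrow> 'b::{banach, second_countable_topology}"
  assumes [measurable]: "h \<in> borel_measurable borel" and per: "\<And>x k. h (x + int_vec k) = h x"
    and bdd: "\<And>x. norm (h x) \<le> B"
  shows "(LINT x|cube_measure. h (x + s)) = (LINT x|cube_measure. h x)"
proof -
  let ?F = "\<lambda>x. indicator unit_cube (x - s) *\<^sub>R h x"
  have fin: "emeasure lborel (unit_cube :: (real^'n) set) < \<infinity>"
    using cube.emeasure_finite[of "unit_cube :: (real^'n) set"]
    by (simp add: cube_measure_def emeasure_restrict_space less_top)
  have i0: "integrable lborel (\<lambda>x. indicator unit_cube x *\<^sub>R h (x + s))"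
  proof (rule Bochner_Integration.integrable_bound)
    show "integrable lborel (\<lambda>x :: real^'n. B * indicator unit_cube x)"
      using fin by (intro integrable_mult_right integrable_real_indicator) auto
  qed (auto simp: indicator_def intro!: AE_I2 order_trans[OF bdd])
  have d: "distr lborel borel ((+) s) = (lborel :: (real^'n) measure)"
    by (rule lborel_distr_plus)
  have F: "integrable lborel ?F"
    by (subst d[symmetric], subst integrable_distr_eq) (use i0 in \<open>simp_all add: add.commute\<close>)
  have "(LINT x|cube_measure. h (x + s)) = (LINT x|lborel. indicator unit_cube x *\<^sub>R h (x + s))"
    by (simp add: cube_measure_def integral_restrict_space)
  also have "\<dots> = (LINT x|lborel. ?F x)"
    by (subst (2) d[symmetric], subst integral_distr) (simp_all add: add.commute)
  also have "\<dots> = (LINT z|cube_measure. LINT k|count_space UNIV. ?F (z + int_vec k))"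
    unfolding cube_measure_def by (rule integral_tiling[OF unit_cube_borel tile_unit_cube F])
  also have "\<dots> = (LINT z|cube_measure. h z)"
  proof (rule Bochner_Integration.integral_cong[OF refl])
    fix z :: "real^'n"
    obtain k1 where k1: "\<And>k. z - s - int_vec k \<in> unit_cube \<longleftrightarrow> k = k1"
      using tile_unit_cube[of "z - s"] by metis
    have mem: "z + int_vec k - s \<in> unit_cube \<longleftrightarrow> k = - k1" for k
    proof -
      have eq: "z + int_vec k - s = z - s - int_vec (- k)"
        by (simp add: int_vec_def vec_eq_iff)
      then show ?thesis
        unfolding eq k1 by auto
    qed
    show "(LINT k|count_space UNIV. ?F (z + int_vec k)) = h z"
      by (subst integral_count_space_single[of "- k1"]) (auto simp: mem per)
  qed
  finally show ?thesis .
qed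

lemma measurable_cis_int_vec [measurable]: "(\<lambda>x. cis (2 * pi * (int_vec k \<bullet> x))) \<in> borel_measurable borel"
  by (intro borel_measurable_continuous_onI continuous_intros)

lemma int_vec_inner_int_vec: "int_vec k \<bullet> int_vec l \<in> \<int>"
  unfolding int_vec_def inner_vec_def by (auto intro!: Ints_sum)

lemma cis_int_vec_periodic:
  "cis (2 * pi * (int_vec k \<bullet> (x + int_vec l))) = cis (2 * pi * (int_vec k \<bullet> x))"
  using cis_multiple_2pi[OF int_vec_inner_int_vec[of k l]]
  by (simp add: inner_add_right distrib_left flip: cis_mult)

text \<open>Translation by half a period in a direction with \<open>k $ i \<noteq> 0\<close> changes the sign of the integral.\<close>

lemma integral_cis_int_vec:
  fixes k :: "int^'n"
  shows "(LINT x|cube_measure. cis (2 * pi * (int_vec k \<bullet> x))) = (if k = 0 then 1 else 0)"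
proof (cases "k = 0")
  case True
  then show ?thesis
    by (simp add: int_vec_def inner_vec_def)
next
  case False
  then obtain i where i: "k $ i \<noteq> 0"
    by (auto simp: vec_eq_iff)
  define s :: "real^'n" where "s = axis i (1 / (2 * real_of_int (k $ i)))"
  have ks: "int_vec k \<bullet> s = 1 / 2"
    using i by (simp add: s_def inner_axis int_vec_def)
  then have "cis (2 * pi * (int_vec k \<bullet> s)) = -1"
    unfolding ks by simp
  then have shift: "cis (2 * pi * (int_vec k \<bullet> (x + s))) = - cis (2 * pi * (int_vec k \<bullet> x))" for x
    by (simp add: inner_add_right distrib_left flip: cis_mult)
  have "(LINT x|cube_measure. cis (2 * pi * (int_vec k \<bullet> (x + s)))) = (LINT x|cube_measure. cis (2 * pi * (int_vec k \<bullet> x)))"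
    by (rule integral_cube_translate[where B = 1]) (auto simp: cis_int_vec_periodic)
  then have "- (LINT x|cube_measure. cis (2 * pi * (int_vec k \<bullet> x))) = (LINT x|cube_measure. cis (2 * pi * (int_vec k \<bullet> x)))"
    unfolding shift by simp
  then show ?thesis
    using False by simp
qed

lemma lborel_reflect:
  fixes F :: "'a::euclidean_space \<Rightarrow> 'b::{banach, second_countable_topology}"
  assumes [measurable]: "F \<in> borel_measurable borel"
  shows "(LINT y|lborel. F (x - y)) = (LINT z|lborel. F z)"
    and "integrable lborel (\<lambda>y. F (x - y)) \<longleftrightarrow> integrable lborel F"
proof -
  have d: "lborel = distr lborel borel (\<lambda>y. x - y :: 'a)"
    using lborel_affine[of "-1" x] by (simp add: density_1)
  show "(LINT y|lborel. F (x - y)) = (LINT z|lborel. F z)"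
    by (subst (2) d, subst integral_distr) auto
  show "integrable lborel (\<lambda>y. F (x - y)) \<longleftrightarrow> integrable lborel F"
    by (subst (2) d, subst integrable_distr_eq) auto
qed

lemma finite_modes: "finite {k :: int^'n. \<forall>i. \<bar>k $ i\<bar> \<le> int p}"
proof -
  have "finite (PiE (UNIV::'n set) (\<lambda>_. {- int p..int p}))"
    by (intro finite_PiE) auto
  moreover have "{k :: int^'n. \<forall>i. \<bar>k $ i\<bar> \<le> int p} \<subseteq> vec_lambda ` PiE UNIV (\<lambda>_. {- int p..int p})"
    by (force simp: abs_le_iff intro!: image_eqI[of _ _ "vec_nth _"])
  ultimately show ?thesis
    by (meson finite_imageI finite_subset)
qed

lemma continuous_fourier_trunc: "continuous_on UNIV (fourier_trunc p g)"
  unfolding fourier_trunc_def[abs_def] by (intro continuous_intros)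

section \<open>Convolution of a periodic kernel with the Gaussian\<close>

locale periodic_kernel =
  fixes \<kappa> :: "real^'n \<Rightarrow> complex"
  assumes meas [measurable]: "\<kappa> \<in> borel_measurable borel"
    and periodic: "\<And>x k. \<kappa> (x + int_vec k) = \<kappa> x"
    and integrable_cube: "integrable cube_measure \<kappa>"
begin

lemma L1_cell_eq: "L1_cell \<kappa> = (LINT z|cube_measure. norm (\<kappa> z))"
  unfolding L1_cell_def by (rule set_integral_cell(1)) simp

lemma L1_cell_nonneg: "0 \<le> L1_cell \<kappa>"
  unfolding L1_cell_eq by simp

lemma fourier_coeff_eq: "fourier_coeff \<kappa> k = (LINT z|cube_measure. \<kappa> z * cis (- (2 * pi * (int_vec k \<bullet> z))))"
proof -
  have [measurable]: "(\<lambda>z. cis (- (2 * pi * (int_vec k \<bullet> z)))) \<in> borel_measurable borel"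
    by (intro borel_measurable_continuous_onI continuous_intros)
  show ?thesis
    unfolding fourier_coeff_def mult_minus_left by (rule set_integral_cell(1)) simp
qed

lemma norm_fourier_coeff_le: "norm (fourier_coeff \<kappa> k) \<le> L1_cell \<kappa>"
  unfolding fourier_coeff_eq L1_cell_eq by (rule order_trans[OF integral_norm_bound]) (simp add: norm_mult)

text \<open>The kernel is integrable only over a cell. Unfolding into cells replaces the Gaussian by
  its lattice sum, which is bounded uniformly in the base point.\<close>

lemma integrable_mult_gauss:
  assumes "\<delta> > 0"
  shows "integrable lborel (\<lambda>z. \<kappa> z * complex_of_real (gauss \<delta> (x - z)))"
proof (rule integrableI_bounded)
  show "(\<lambda>z. \<kappa> z * complex_of_real (gauss \<delta> (x - z))) \<in> borel_measurable lborel"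
    by measurable
  let ?M = "LINT k::int^'n|count_space UNIV. heat_coeff_vec \<delta> k"
  interpret C: sigma_finite_measure "count_space (UNIV::(int^'n) set)"
    by (rule sigma_finite_count_space)
  interpret P: pair_sigma_finite "count_space (UNIV::(int^'n) set)" "cube_measure :: (real^'n) measure" ..
  let ?G = "\<lambda>k z. ennreal (norm (\<kappa> z)) * ennreal (gauss \<delta> (x - z - int_vec k))"
  have "(\<integral>\<^sup>+z. ennreal (norm (\<kappa> z * complex_of_real (gauss \<delta> (x - z)))) \<partial>lborel)
      = (\<integral>\<^sup>+k. (\<integral>\<^sup>+z. ennreal (norm (\<kappa> (z + int_vec k) * complex_of_real (gauss \<delta> (x - (z + int_vec k))))) * indicator unit_cube z \<partial>lborel) \<partial>count_space UNIV)"
    by (rule nn_integral_tiling[OF unit_cube_borel tile_unit_cube, symmetric]) simp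
  also have "\<dots> = (\<integral>\<^sup>+k. (\<integral>\<^sup>+z. ?G k z \<partial>cube_measure) \<partial>count_space UNIV)"
    by (simp add: cube_measure_def nn_integral_restrict_space periodic norm_mult ennreal_mult' diff_diff_eq)
  also have "\<dots> = (\<integral>\<^sup>+z. (\<integral>\<^sup>+k. ?G k z \<partial>count_space UNIV) \<partial>cube_measure)"
    by (rule P.Fubini'[symmetric]) (intro measurable_pair_measure_countable1, simp, simp, intro measurable_cube, measurable)
  also have "\<dots> \<le> (\<integral>\<^sup>+z. ennreal (norm (\<kappa> z)) * ennreal ?M \<partial>cube_measure)"
  proof (rule nn_integral_mono)
    fix z
    have "(\<integral>\<^sup>+k. ?G k z \<partial>count_space UNIV) = ennreal (norm (\<kappa> z)) * (\<integral>\<^sup>+k. ennreal (gauss \<delta> (x - z - int_vec k)) \<partial>count_space UNIV)"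
      by (rule nn_integral_cmult) simp
    also have "(\<integral>\<^sup>+k. ennreal (gauss \<delta> (x - z - int_vec k)) \<partial>count_space UNIV)
        = ennreal (LINT k|count_space UNIV. gauss \<delta> (x - z - int_vec k))"
      by (rule nn_integral_eq_integral[OF integrable_gauss_lattice[OF assms]]) simp
    also have "\<dots> \<le> ennreal ?M"
      by (intro ennreal_leI integral_gauss_lattice_le assms)
    finally show "(\<integral>\<^sup>+k. ?G k z \<partial>count_space UNIV) \<le> ennreal (norm (\<kappa> z)) * ennreal ?M"
      by (simp add: mult_left_mono)
  qed
  also have "\<dots> = (\<integral>\<^sup>+z. ennreal (norm (\<kappa> z)) \<partial>cube_measure) * ennreal ?M"
    by (rule nn_integral_multc) (intro measurable_compose[OF _ measurable_ennreal] measurable_cube, measurable)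
  also have "\<dots> < \<infinity>"
    using integrable_cube by (auto simp: integrable_iff_bounded ennreal_mult_less_top)
  finally show "(\<integral>\<^sup>+z. ennreal (norm (\<kappa> z * complex_of_real (gauss \<delta> (x - z)))) \<partial>lborel) < \<infinity>" .
qed

lemma k_long_eq:
  "k_long \<delta> \<kappa> x = (LINT z|lborel. \<kappa> z * complex_of_real (gauss \<delta> (x - z)))"
  unfolding k_long_def
  using lborel_reflect(1)[of "\<lambda>z. \<kappa> z * complex_of_real (gauss \<delta> (x - z))" x] by simp

lemma integrable_k_long:
  assumes "\<delta> > 0"
  shows "integrable lborel (\<lambda>y. \<kappa> (x - y) * complex_of_real (gauss \<delta> y))"
  using lborel_reflect(2)[of "\<lambda>z. \<kappa> z * complex_of_real (gauss \<delta> (x - z))" x] integrable_mult_gauss[OF assms, of x]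
  by simp

text \<open>The convolution theorem: Fourier coefficients of a convolution are products.\<close>

definition long_coeff :: "real \<Rightarrow> int^'n \<Rightarrow> complex" where
  "long_coeff \<delta> k = complex_of_real (heat_coeff_vec \<delta> k) * fourier_coeff \<kappa> k"

lemma norm_long_coeff_le: "norm (long_coeff \<delta> k) \<le> L1_cell \<kappa> * heat_coeff_vec \<delta> k"
  using mult_left_mono[OF norm_fourier_coeff_le[of k] heat_coeff_vec_nonneg[of \<delta> k]]
  by (simp add: long_coeff_def norm_mult mult.commute)

lemma integrable_long_coeff_bound: "\<delta> > 0 \<Longrightarrow> integrable (count_space UNIV) (\<lambda>k. L1_cell \<kappa> * heat_coeff_vec \<delta> k)"
  by (intro integrable_mult_right integrable_heat_coeff_vec)

lemma norm_long_term_le: "norm (long_coeff \<delta> k * cis s) \<le> L1_cell \<kappa> * heat_coeff_vec \<delta> k"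
  using norm_long_coeff_le[of \<delta> k] by (simp add: norm_mult)

lemma integrable_long_series:
  assumes "\<delta> > 0"
  shows "integrable (count_space UNIV) (\<lambda>k. long_coeff \<delta> k * cis (s k))"
  by (rule Bochner_Integration.integrable_bound[OF integrable_long_coeff_bound[OF assms]])
    (auto intro!: AE_I2 order_trans[OF norm_long_term_le] abs_ge_self)

text \<open>Folding the convolution onto the cube turns the Gaussian into its lattice sum, which
  Poisson summation expands. The character at x - z splits, and its z part produces the Fourier
  coefficient of the kernel.\<close>

lemma k_long_series:
  assumes "\<delta> > 0"
  shows "k_long \<delta> \<kappa> x = (LINT k|count_space UNIV. long_coeff \<delta> k * cis (2 * pi * (int_vec k \<bullet> x)))"
proof -
  let ?f = "\<lambda>k z. \<kappa> z * (complex_of_real (heat_coeff_vec \<delta> k) * cis (2 * pi * (int_vec k \<bullet> (x - z))))"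
  have [measurable]: "(\<lambda>z. cis (2 * pi * (int_vec k \<bullet> (x - z)))) \<in> borel_measurable borel" for k :: "int^'n"
    by (intro borel_measurable_continuous_onI continuous_intros)
  have fm: "?f k \<in> borel_measurable cube_measure" for k
    by (intro measurable_cube) measurable
  have "k_long \<delta> \<kappa> x = (LINT z|cube_measure. LINT k|count_space UNIV.
      \<kappa> (z + int_vec k) * complex_of_real (gauss \<delta> (x - (z + int_vec k))))"
    unfolding k_long_eq cube_measure_def
    by (rule integral_tiling[OF unit_cube_borel tile_unit_cube integrable_mult_gauss[OF assms]])
  also have "\<dots> = (LINT z|cube_measure. \<kappa> z * complex_of_real (LINT k|count_space UNIV. gauss \<delta> (x - z - int_vec k)))"
    by (simp add: periodic diff_diff_eq)
  also have "\<dots> = (LINT z|cube_measure. LINT k|count_space UNIV. ?f k z)"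
    unfolding poisson_summation_gauss[OF assms] by simp
  also have "\<dots> = (LINT k|count_space UNIV. LINT z|cube_measure. ?f k z)"
    by (rule integral_count_space_swap[OF cube.sigma_finite_measure_axioms fm
          integrable_heat_coeff_vec[OF assms] integrable_norm[OF integrable_cube]]) (simp add: norm_mult)
  also have "\<dots> = (LINT k|count_space UNIV. long_coeff \<delta> k * cis (2 * pi * (int_vec k \<bullet> x)))"
  proof (rule Bochner_Integration.integral_cong[OF refl])
    fix k
    have eq: "?f k z = complex_of_real (heat_coeff_vec \<delta> k) * cis (2 * pi * (int_vec k \<bullet> x)) * (\<kappa> z * cis (- (2 * pi * (int_vec k \<bullet> z))))" for z
      by (simp add: cis_mult inner_diff_right algebra_simps)
    show "(LINT z|cube_measure. ?f k z) = long_coeff \<delta> k * cis (2 * pi * (int_vec k \<bullet> x))"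
      unfolding eq integral_mult_right_zero fourier_coeff_eq[symmetric] long_coeff_def by simp
  qed
  finally show ?thesis .
qed

lemma continuous_k_long:
  assumes "\<delta> > 0"
  shows "continuous_on UNIV (k_long \<delta> \<kappa>)"
  unfolding k_long_series[OF assms, abs_def]
proof (rule continuous_on_integral_dominated)
  show "\<exists>w. integrable (count_space UNIV) w \<and> (\<forall>s\<in>C. \<forall>k\<in>space (count_space UNIV).
      norm (long_coeff \<delta> k * cis (2 * pi * (int_vec k \<bullet> s))) \<le> w k)" for C
    using integrable_long_coeff_bound[OF assms] norm_long_term_le
    by (intro exI[of _ "\<lambda>k. L1_cell \<kappa> * heat_coeff_vec \<delta> k"]) auto
qed (auto intro!: continuous_intros)

lemma fourier_coeff_k_long:
  assumes "\<delta> > 0"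
  shows "fourier_coeff (k_long \<delta> \<kappa>) j = long_coeff \<delta> j"
proof -
  let ?f = "\<lambda>k z. long_coeff \<delta> k * cis (2 * pi * (int_vec (k - j) \<bullet> z))"
  have fm: "?f k \<in> borel_measurable cube_measure" for k
    by (intro measurable_cube) measurable
  have iv: "int_vec (k - j) = int_vec k - int_vec j" for k
    by (simp add: int_vec_def vec_eq_iff)
  have "fourier_coeff (k_long \<delta> \<kappa>) j = (LINT z|cube_measure. k_long \<delta> \<kappa> z * cis (- 2 * pi * (int_vec j \<bullet> z)))"
    unfolding fourier_coeff_def
    by (rule set_integral_cell(1)) (intro borel_measurable_continuous_onI continuous_intros continuous_k_long assms)
  also have "\<dots> = (LINT z|cube_measure. LINT k|count_space UNIV. ?f k z)"
  proof (rule Bochner_Integration.integral_cong[OF refl])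
    fix z
    have "?f k z = long_coeff \<delta> k * cis (2 * pi * (int_vec k \<bullet> z)) * cis (- 2 * pi * (int_vec j \<bullet> z))" for k
      by (simp add: cis_mult iv inner_diff_left algebra_simps)
    then show "k_long \<delta> \<kappa> z * cis (- 2 * pi * (int_vec j \<bullet> z)) = (LINT k|count_space UNIV. ?f k z)"
      by (simp only: integral_mult_left_zero k_long_series[OF assms])
  qed
  also have "\<dots> = (LINT k|count_space UNIV. LINT z|cube_measure. ?f k z)"
    by (rule integral_count_space_swap[where v = "\<lambda>_. 1", OF cube.sigma_finite_measure_axioms fm
          integrable_long_coeff_bound[OF assms]]) (auto intro!: norm_long_term_le)
  also have "\<dots> = long_coeff \<delta> j"
    by (simp only: integral_mult_right_zero integral_cis_int_vec)
      (subst integral_count_space_single[of j]; simp)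
  finally show ?thesis .
qed

text \<open>The truncation error is the tail of an absolutely convergent series whose terms are at
  most \<open>L1_cell \<kappa>\<close> times the heat coefficients. The power \<delta>^(d + 1)
  collects \<delta>^2 from the truncated coordinate and \<delta>^(d - 1) from the others.\<close>

lemma norm_fourier_trunc_diff_le:
  assumes \<delta>: "0 < \<delta>" "\<delta> < 1/2" and p: "p \<ge> 1"
  shows "norm (fourier_trunc p (k_long \<delta> \<kappa>) x - k_long \<delta> \<kappa> x)
    \<le> C_long \<kappa> * exp (- 2 * pi\<^sup>2 * \<delta>\<^sup>2 * (real p)\<^sup>2) / (\<delta> ^ (CARD('n) + 1) * real p)"
proof -
  define A where "A = {k :: int^'n. \<forall>i. \<bar>k $ i\<bar> \<le> int p}"
  let ?g = "\<lambda>k. long_coeff \<delta> k * cis (2 * pi * (int_vec k \<bullet> x))"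
  have A: "finite A"
    unfolding A_def by (rule finite_modes)
  have sum: "Infinite_Set_Sum.abs_summable_on ?g UNIV"
    using integrable_long_series[OF \<delta>(1)] by (simp add: Infinite_Set_Sum.abs_summable_on_def)
  have "fourier_trunc p (k_long \<delta> \<kappa>) x = infsetsum ?g A"
    using A by (simp add: fourier_trunc_def A_def fourier_coeff_k_long[OF \<delta>(1)])
  moreover have "k_long \<delta> \<kappa> x = infsetsum ?g UNIV"
    by (simp add: k_long_series[OF \<delta>(1)] infsetsum_def)
  ultimately have "k_long \<delta> \<kappa> x - fourier_trunc p (k_long \<delta> \<kappa>) x = (LINT k|count_space (UNIV - A). ?g k)"
    using infsetsum_Diff[OF sum, of A] by (simp add: infsetsum_def)
  then have "norm (fourier_trunc p (k_long \<delta> \<kappa>) x - k_long \<delta> \<kappa> x) = norm (LINT k|count_space (UNIV - A). ?g k)"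
    by (metis norm_minus_commute)
  also have "\<dots> \<le> (LINT k|count_space (UNIV - A). norm (?g k))"
    by (rule integral_norm_bound)
  also have "\<dots> \<le> (LINT k|count_space (UNIV - A). L1_cell \<kappa> * heat_coeff_vec \<delta> k)"
  proof (rule integral_mono)
    show "integrable (count_space (UNIV - A)) (\<lambda>k. norm (?g k))"
      using abs_summable_on_subset[OF sum] by (intro integrable_norm) (simp add: Infinite_Set_Sum.abs_summable_on_def)
    show "integrable (count_space (UNIV - A)) (\<lambda>k. L1_cell \<kappa> * heat_coeff_vec \<delta> k)"
      using abs_summable_on_subset[of "\<lambda>k. L1_cell \<kappa> * heat_coeff_vec \<delta> k" UNIV] integrable_long_coeff_bound[OF \<delta>(1)]
      by (simp add: Infinite_Set_Sum.abs_summable_on_def)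
  qed (rule norm_long_term_le)
  also have "UNIV - A = {k :: int^'n. \<not> (\<forall>i. \<bar>k $ i\<bar> \<le> int p)}"
    by (auto simp: A_def)
  also have "(LINT k|count_space {k :: int^'n. \<not> (\<forall>i. \<bar>k $ i\<bar> \<le> int p)}. L1_cell \<kappa> * heat_coeff_vec \<delta> k)
      \<le> L1_cell \<kappa> * (real CARD('n) * (exp (- 2 * pi\<^sup>2 * \<delta>\<^sup>2 * (real p)\<^sup>2) / (2 * pi\<^sup>2 * \<delta>\<^sup>2 * real p))
      * ((1 + 1 / sqrt (2 * pi)) / \<delta>) ^ (CARD('n) - 1))"
    using integral_heat_coeff_vec_tail_le[where 'n = 'n, OF \<delta> p] L1_cell_nonneg
    by (simp only: integral_mult_right_zero mult_left_mono)
  also have "\<dots> = C_long \<kappa> * exp (- 2 * pi\<^sup>2 * \<delta>\<^sup>2 * (real p)\<^sup>2) / (\<delta> ^ (CARD('n) + 1) * real p)"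
  proof -
    obtain m where m: "CARD('n) = Suc m"
      by (metis zero_less_card_finite gr0_implies_Suc)
    show ?thesis
      unfolding C_long_def m using \<delta> by (simp add: power_divide power2_eq_square field_simps)
  qed
  finally show ?thesis .
qed

text \<open>Boundedness is what lets the punctured integrals of the long-range kernel converge to
  the ordinary integral.\<close>

lemma norm_k_long_le:
  assumes "\<delta> > 0"
  shows "norm (k_long \<delta> \<kappa> x) \<le> L1_cell \<kappa> * (LINT k::int^'n|count_space UNIV. heat_coeff_vec \<delta> k)"
proof -
  have "norm (k_long \<delta> \<kappa> x) \<le> (LINT k|count_space UNIV. norm (long_coeff \<delta> k * cis (2 * pi * (int_vec k \<bullet> x))))"
    unfolding k_long_series[OF assms] by (rule integral_norm_bound)
  also have "\<dots> \<le> (LINT k::int^'n|count_space UNIV. L1_cell \<kappa> * heat_coeff_vec \<delta> k)"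
    by (rule integral_mono)
      (intro integrable_norm integrable_long_series integrable_long_coeff_bound assms norm_long_term_le)+
  finally show ?thesis
    by simp
qed

end

section \<open>Decay of the short-range kernel\<close>

text \<open>Plays the part of polar coordinates. The sublevel sets of the map are balls, whose
  volume is known, and a measure finite on half-lines is determined by its values there.\<close>

lemma distr_norm_squared:
  fixes \<delta> :: real
  assumes \<delta>: "\<delta> > 0"
  defines "c \<equiv> (2 * pi * \<delta>\<^sup>2) powr (real CARD('n) / 2) / Gamma (real CARD('n) / 2)"
  shows "distr lborel borel (\<lambda>y :: real^'n. (norm y)\<^sup>2 / (2 * \<delta>\<^sup>2))
    = density lborel (\<lambda>u. ennreal (indicator {0..} u * (c * u powr (real CARD('n) / 2 - 1))))"
    (is "?M = ?N")
proof -
  let ?b = "real CARD('n) / 2"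
  have b: "?b > 0"
    by simp
  have c: "c > 0"
    unfolding c_def using \<delta> b by (intro divide_pos_pos Gamma_real_pos) auto
  have M: "emeasure ?M {..a} = ennreal (if a < 0 then 0 else c * a powr ?b / ?b)" for a
  proof (cases "a < 0")
    case True
    then have "(norm y)\<^sup>2 / (2 * \<delta>\<^sup>2) \<le> a \<longleftrightarrow> False" for y :: "real^'n"
      using order_trans[of 0 "(norm y)\<^sup>2 / (2 * \<delta>\<^sup>2)" a] by auto
    then show ?thesis
      using True by (simp add: emeasure_distr vimage_def)
  next
    case False
    define r where "r = sqrt (2 * \<delta>\<^sup>2 * a)"
    have r: "r \<ge> 0" "r\<^sup>2 = 2 * \<delta>\<^sup>2 * a"
      using False by (auto simp: r_def)
    have "{y :: real^'n. (norm y)\<^sup>2 / (2 * \<delta>\<^sup>2) \<le> a} = cball 0 r"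
    proof -
      have "(norm y)\<^sup>2 / (2 * \<delta>\<^sup>2) \<le> a \<longleftrightarrow> norm y \<le> r" for y :: "real^'n"
      proof -
        have "(norm y)\<^sup>2 / (2 * \<delta>\<^sup>2) \<le> a \<longleftrightarrow> (norm y)\<^sup>2 \<le> r\<^sup>2"
          using \<delta> by (simp add: r field_simps)
        also have "\<dots> \<longleftrightarrow> norm y \<le> r"
          using abs_le_square_iff[of "norm y" r] r(1) by simp
        finally show ?thesis .
      qed
      then show ?thesis
        by (intro set_eqI) (simp only: mem_Collect_eq mem_cball_0)
    qed
    then have "emeasure ?M {..a} = emeasure lborel (cball (0 :: real^'n) r)"
      by (simp add: emeasure_distr vimage_def)
    also have "\<dots> = ennreal (unit_ball_vol (real CARD('n)) * r ^ CARD('n))"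
      using r by (simp add: emeasure_cball)
    also have "r ^ CARD('n) = (2 * \<delta>\<^sup>2 * a) powr ?b"
    proof (cases "a = 0")
      case True
      then show ?thesis
        by (simp add: r_def)
    next
      case a: False
      then have "r > 0"
        using False \<delta> by (simp add: r_def)
      then have "r ^ CARD('n) = r powr (2 * ?b)"
        by (simp add: powr_realpow)
      also have "\<dots> = (r powr 2) powr ?b"
        by (simp only: powr_powr)
      finally show ?thesis
        using r \<open>r > 0\<close> by (simp add: powr_numeral)
    qed
    also have "unit_ball_vol (real CARD('n)) * (2 * \<delta>\<^sup>2 * a) powr ?b = c * a powr ?b / ?b"
    proof -
      have Gp: "Gamma (?b + 1) = ?b * Gamma ?b"
        using b by (intro Gamma_plus1) (metis b nonpos_Ints_nonpos not_le)
      show ?thesis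
        unfolding unit_ball_vol_def c_def Gp using False by (simp add: powr_mult field_simps)
    qed
    finally show ?thesis
      using False by simp
  qed
  have N: "emeasure ?N {..a} = ennreal (if a < 0 then 0 else c * a powr ?b / ?b)" for a
  proof -
    have "emeasure ?N {..a} = (\<integral>\<^sup>+u. ennreal (c * u powr (?b - 1)) * indicator {0..a} u \<partial>lborel)"
      by (subst emeasure_density) (auto intro!: nn_integral_cong simp: indicator_def)
    also have "\<dots> = ennreal (if a < 0 then 0 else c * a powr ?b / ?b)"
    proof (cases "a < 0")
      case False
      then have "((\<lambda>u. u powr (?b - 1)) has_integral (a powr (?b - 1 + 1) / (?b - 1 + 1))) {0..a}"
        by (intro has_integral_powr_from_0) auto
      then have "((\<lambda>u. c * u powr (?b - 1)) has_integral (c * a powr ?b / ?b)) {0..a}"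
        using has_integral_mult_right[of "\<lambda>u. u powr (?b - 1)" "a powr (?b - 1 + 1) / (?b - 1 + 1)" "{0..a}" c]
        by (simp add: mult.assoc)
      moreover have "c * u powr (?b - 1) * indicator {0..a} u = (if u \<in> {0..a} then c * u powr (?b - 1) else 0)" for u
        by (simp add: indicator_def)
      ultimately have "((\<lambda>u. c * u powr (?b - 1) * indicator {0..a} u) has_integral (c * a powr ?b / ?b)) UNIV"
        by (simp only: has_integral_restrict_UNIV)
      from nn_integral_has_integral_lborel[OF _ _ this]
      have "(\<integral>\<^sup>+u. ennreal (c * u powr (?b - 1) * indicator {0..a} u) \<partial>lborel) = ennreal (c * a powr ?b / ?b)"
        using c by simp
      moreover have "(\<integral>\<^sup>+u. ennreal (c * u powr (?b - 1)) * indicator {0..a} u \<partial>lborel)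
          = (\<integral>\<^sup>+u. ennreal (c * u powr (?b - 1) * indicator {0..a} u) \<partial>lborel)"
        by (intro nn_integral_cong) (auto simp: indicator_def)
      ultimately show ?thesis
        using False by simp
    qed (auto intro!: nn_integral_zero' simp: indicator_def)
    finally show ?thesis .
  qed
  show "?M = ?N"
  proof (rule measure_eqI_generator_eq[where E = "range atMost" and \<Omega> = UNIV and A = "\<lambda>n::nat. {..real n}"])
    show "Int_stable (range (atMost :: real \<Rightarrow> _))"
      by (auto simp: Int_stable_def)
    show "emeasure ?M X = emeasure ?N X" if "X \<in> range atMost" for X
      using that by (auto simp: M N)
    show "sets ?M = sigma_sets UNIV (range atMost)" "sets ?N = sigma_sets UNIV (range atMost)"
      by (simp_all add: borel_eq_atMost)
    show "(\<Union>i. {..real i}) = UNIV"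
      using real_arch_simple by blast
  qed (auto simp: M)
qed

text \<open>In the variable u = |y|^2 / (2 \<delta>^2) the Gaussian becomes exp (- u), and the
  powers of \<delta> cancel, leaving the Gamma density of shape d / 2.\<close>

lemma nn_integral_gauss_radial:
  fixes h :: "real \<Rightarrow> real"
  assumes \<delta>: "\<delta> > 0" and [measurable]: "h \<in> borel_measurable borel" and h: "\<And>u. 0 \<le> h u"
  shows "(\<integral>\<^sup>+y. ennreal (gauss \<delta> (y :: real^'n) * h ((norm y)\<^sup>2 / (2 * \<delta>\<^sup>2))) \<partial>lborel)
    = (\<integral>\<^sup>+u. ennreal (indicator {0..} u * (u powr (real CARD('n) / 2 - 1) * exp (- u) * h u / Gamma (real CARD('n) / 2))) \<partial>lborel)"
proof -
  let ?b = "real CARD('n) / 2"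
  let ?c = "(2 * pi * \<delta>\<^sup>2) powr ?b"
  have b: "?b > 0"
    by simp
  have G: "Gamma ?b > 0"
    by (intro Gamma_real_pos) simp
  have c: "?c > 0"
    using \<delta> by simp
  have "(\<integral>\<^sup>+y. ennreal (gauss \<delta> (y :: real^'n) * h ((norm y)\<^sup>2 / (2 * \<delta>\<^sup>2))) \<partial>lborel)
      = (\<integral>\<^sup>+u. ennreal (1 / ?c * exp (- u) * h u) \<partial>distr lborel borel (\<lambda>y :: real^'n. (norm y)\<^sup>2 / (2 * \<delta>\<^sup>2)))"
    by (subst nn_integral_distr) (auto simp: gauss_def)
  also have "\<dots> = (\<integral>\<^sup>+u. ennreal (indicator {0..} u * (?c / Gamma ?b * u powr (?b - 1))) * ennreal (1 / ?c * exp (- u) * h u) \<partial>lborel)"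
    unfolding distr_norm_squared[OF \<delta>] by (rule nn_integral_density) auto
  also have "\<dots> = (\<integral>\<^sup>+u. ennreal (indicator {0..} u * (u powr (?b - 1) * exp (- u) * h u / Gamma ?b)) \<partial>lborel)"
    using c G h by (intro nn_integral_cong) (auto simp: indicator_def ennreal_mult'[symmetric] field_simps)
  finally show ?thesis .
qed

lemma nn_integral_Gamma:
  "b > 0 \<Longrightarrow> (\<integral>\<^sup>+u. ennreal (indicator {0..} u * (u powr (b - 1) * exp (- u))) \<partial>lborel) = ennreal (Gamma b)"
  by (subst Gamma_conv_nn_integral_real) (auto simp: exp_minus field_simps)

text \<open>In the radial variable the total mass is Gamma (d/2) / Gamma (d/2). The second moment is
  2 \<delta>^2 Gamma (d/2 + 1) / Gamma (d/2), so the recurrence of Gamma yields d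
  \<delta>^2.\<close>

lemma
  assumes \<delta>: "\<delta> > 0"
  shows integrable_gauss: "integrable lborel (gauss \<delta> :: real^'n \<Rightarrow> real)"
    and integral_gauss: "(LINT y|lborel. gauss \<delta> (y :: real^'n)) = 1"
    and integrable_gauss_norm_squared: "integrable lborel (\<lambda>y :: real^'n. gauss \<delta> y * (norm y)\<^sup>2)"
    and integral_gauss_norm_squared: "(LINT y|lborel. gauss \<delta> (y :: real^'n) * (norm y)\<^sup>2) = real CARD('n) * \<delta>\<^sup>2"
proof -
  let ?b = "real CARD('n) / 2"
  have b: "?b > 0"
    by simp
  have G: "Gamma ?b > 0"
    by (intro Gamma_real_pos) simp
  have 0: "(\<integral>\<^sup>+y. ennreal (gauss \<delta> (y :: real^'n)) \<partial>lborel) = ennreal 1"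
  proof -
    have "(\<integral>\<^sup>+y. ennreal (gauss \<delta> (y :: real^'n)) \<partial>lborel)
        = (\<integral>\<^sup>+u. ennreal (1 / Gamma ?b) * ennreal (indicator {0..} u * (u powr (?b - 1) * exp (- u))) \<partial>lborel)"
      using nn_integral_gauss_radial[OF \<delta>, of "\<lambda>_. 1", where 'n = 'n] G
      by (simp add: ennreal_mult'[symmetric] mult_ac)
    also have "\<dots> = ennreal (1 / Gamma ?b) * ennreal (Gamma ?b)"
      by (subst nn_integral_cmult) (simp_all only: nn_integral_Gamma[OF b], simp)
    also have "\<dots> = ennreal 1"
      using less_imp_neq[OF G] by (subst ennreal_mult'[symmetric]) auto
    finally show ?thesis .
  qed
  have 2: "(\<integral>\<^sup>+y. ennreal (gauss \<delta> (y :: real^'n) * (norm y)\<^sup>2) \<partial>lborel) = ennreal (real CARD('n) * \<delta>\<^sup>2)"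
  proof -
    have "(\<integral>\<^sup>+y. ennreal (gauss \<delta> (y :: real^'n) * (norm y)\<^sup>2) \<partial>lborel)
        = (\<integral>\<^sup>+y. ennreal (gauss \<delta> (y :: real^'n) * (2 * \<delta>\<^sup>2 * max 0 ((norm y)\<^sup>2 / (2 * \<delta>\<^sup>2)))) \<partial>lborel)"
      using \<delta> by simp
    \<comment> \<open>The radial formula asks for a function nonnegative on the whole line, hence
      the \<open>max 0\<close>.\<close>
    also have "\<dots> = (\<integral>\<^sup>+u. ennreal (indicator {0..} u * (u powr (?b - 1) * exp (- u) * (2 * \<delta>\<^sup>2 * max 0 u) / Gamma ?b)) \<partial>lborel)"
      by (rule nn_integral_gauss_radial[OF \<delta>]) auto
    also have "\<dots> = (\<integral>\<^sup>+u. ennreal (2 * \<delta>\<^sup>2 / Gamma ?b) * ennreal (indicator {0..} u * (u powr (?b + 1 - 1) * exp (- u))) \<partial>lborel)"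
    proof (rule nn_integral_cong)
      fix u :: real
      have "u powr (?b - 1) * u = u powr ?b" if "u \<ge> 0"
        using that by (cases "u = 0") (simp_all add: powr_diff)
      then have "u powr (?b - 1) * exp (- u) * (2 * \<delta>\<^sup>2 * max 0 u) / Gamma ?b
          = 2 * \<delta>\<^sup>2 / Gamma ?b * (u powr (?b + 1 - 1) * exp (- u))" if "u \<ge> 0"
        using that by (simp add: mult_ac)
      then show "ennreal (indicator {0..} u * (u powr (?b - 1) * exp (- u) * (2 * \<delta>\<^sup>2 * max 0 u) / Gamma ?b))
          = ennreal (2 * \<delta>\<^sup>2 / Gamma ?b) * ennreal (indicator {0..} u * (u powr (?b + 1 - 1) * exp (- u)))"
        using G by (subst ennreal_mult'[symmetric]) (auto simp: indicator_def)
    qed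
    also have "\<dots> = ennreal (2 * \<delta>\<^sup>2 / Gamma ?b) * ennreal (Gamma (?b + 1))"
      by (subst nn_integral_cmult) (measurable, subst nn_integral_Gamma, auto)
    also have "\<dots> = ennreal (real CARD('n) * \<delta>\<^sup>2)"
    proof -
      have Gp: "Gamma (?b + 1) = ?b * Gamma ?b"
        using b by (intro Gamma_plus1) (metis b nonpos_Ints_nonpos not_le)
      show ?thesis
        unfolding Gp using less_imp_neq[OF G] by (subst ennreal_mult'[symmetric]) (auto simp: field_simps)
    qed
    finally show ?thesis .
  qed
  show "integrable lborel (gauss \<delta> :: real^'n \<Rightarrow> real)"
    by (rule integrableI_nn_integral_finite[OF _ _ 0]) auto
  show "(LINT y|lborel. gauss \<delta> (y :: real^'n)) = 1"
    using 0 by (subst integral_eq_nn_integral) auto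
  show "integrable lborel (\<lambda>y :: real^'n. gauss \<delta> y * (norm y)\<^sup>2)"
    by (rule integrableI_nn_integral_finite[OF _ _ 2]) auto
  show "(LINT y|lborel. gauss \<delta> (y :: real^'n) * (norm y)\<^sup>2) = real CARD('n) * \<delta>\<^sup>2"
    using 2 \<delta> by (subst integral_eq_nn_integral) auto
qed

lemma integrable_upper_Gamma:
  fixes b x :: real
  assumes "b > 0"
  shows "set_integrable lborel {0..} (\<lambda>s. s powr (b - 1) * exp (- s))"
  unfolding set_integrable_def
  by (rule integrableI_nn_integral_finite[where x = "Gamma b"])
    (use nn_integral_Gamma[OF assms] in auto)

lemma integral_gauss_tail_le:
  assumes \<delta>: "\<delta> > 0" and r: "r \<ge> 0"
  shows "(LINT y|lborel. gauss \<delta> (y :: real^'n) * indicator {y. norm y > r} y)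
    \<le> upper_Gamma (real CARD('n) / 2) (r\<^sup>2 / (2 * \<delta>\<^sup>2)) / Gamma (real CARD('n) / 2)"
proof -
  let ?b = "real CARD('n) / 2"
  let ?x = "r\<^sup>2 / (2 * \<delta>\<^sup>2)"
  let ?g = "\<lambda>u. u powr (?b - 1) * exp (- u)"
  have b: "?b > 0"
    by simp
  have G: "Gamma ?b > 0"
    by (intro Gamma_real_pos) simp
  have int: "set_integrable lborel {?x..} ?g"
    by (rule set_integrable_subset[OF integrable_upper_Gamma[OF b]]) auto
  then have nn: "(\<integral>\<^sup>+u. ennreal (indicator {?x..} u *\<^sub>R ?g u) \<partial>lborel) = ennreal (upper_Gamma ?b ?x)"
    unfolding upper_Gamma_def set_lebesgue_integral_def set_integrable_def
    by (intro nn_integral_eq_integral) auto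
  have U: "upper_Gamma ?b ?x \<ge> 0"
    unfolding upper_Gamma_def set_lebesgue_integral_def by (intro integral_nonneg_AE) auto
  have "ennreal (LINT y|lborel. gauss \<delta> (y :: real^'n) * indicator {y. norm y > r} y)
      = (\<integral>\<^sup>+y. ennreal (gauss \<delta> (y :: real^'n) * indicator {y. norm y > r} y) \<partial>lborel)"
    by (intro nn_integral_eq_integral[symmetric] Bochner_Integration.integrable_bound[OF integrable_gauss[OF \<delta>, where 'n = 'n]])
      (auto simp: indicator_def)
  also have "\<dots> \<le> (\<integral>\<^sup>+y. ennreal (gauss \<delta> (y :: real^'n) * indicator {?x..} ((norm y)\<^sup>2 / (2 * \<delta>\<^sup>2))) \<partial>lborel)"
  proof (rule nn_integral_mono, rule ennreal_leI, rule mult_left_mono)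
    fix y :: "real^'n"
    have "?x \<le> (norm y)\<^sup>2 / (2 * \<delta>\<^sup>2)" if "norm y > r"
      using that r by (intro divide_right_mono power_mono) auto
    then show "indicator {y. norm y > r} y \<le> (indicator {?x..} ((norm y)\<^sup>2 / (2 * \<delta>\<^sup>2)) :: real)"
      by (auto simp: indicator_def)
  qed simp
  also have "\<dots> = (\<integral>\<^sup>+u. ennreal (indicator {0..} u * (?g u * indicator {?x..} u / Gamma ?b)) \<partial>lborel)"
    by (rule nn_integral_gauss_radial[OF \<delta>]) auto
  also have "\<dots> = (\<integral>\<^sup>+u. ennreal (1 / Gamma ?b) * ennreal (indicator {?x..} u *\<^sub>R ?g u) \<partial>lborel)"
  proof (intro nn_integral_cong)
    fix u :: real
    have "0 \<le> ?x"
      by simp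
    then have "u \<ge> 0" if "u \<ge> ?x"
      using that by linarith
    then show "ennreal (indicator {0..} u * (?g u * indicator {?x..} u / Gamma ?b)) = ennreal (1 / Gamma ?b) * ennreal (indicator {?x..} u *\<^sub>R ?g u)"
      using G by (subst ennreal_mult'[symmetric]) (auto simp: indicator_def)
  qed
  also have "\<dots> = ennreal (1 / Gamma ?b) * ennreal (upper_Gamma ?b ?x)"
    by (subst nn_integral_cmult) (simp_all only: nn, measurable)
  also have "\<dots> = ennreal (upper_Gamma ?b ?x / Gamma ?b)"
    using G U by (subst ennreal_mult'[symmetric]) auto
  finally show ?thesis
    using U G by (subst (asm) ennreal_le_iff) auto
qed

section \<open>Lattice geometry, periodic derivatives and Taylor expansion\<close>

lemma mem_int_lattice: "x \<in> int_lattice \<longleftrightarrow> (\<exists>k. x = int_vec k)"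
proof
  assume "x \<in> int_lattice"
  then have "x = int_vec (\<chi> i. \<lfloor>x $ i\<rfloor>)"
    by (auto simp: int_lattice_def int_vec_def vec_eq_iff)
  then show "\<exists>k. x = int_vec k" ..
qed (auto simp: int_lattice_def int_vec_def)

lemma closed_int_lattice: "closed (int_lattice :: (real^'n) set)"
proof -
  have "int_lattice = (\<Inter>i. (\<lambda>x :: real^'n. x $ i) -` \<int>)"
    by (auto simp: int_lattice_def)
  also have "closed \<dots>"
    by (intro closed_INT ballI closed_vimage closed_Ints continuous_intros)
  finally show ?thesis .
qed

lemma open_Compl_int_lattice: "open (- int_lattice :: (real^'n) set)"
  by (simp add: closed_int_lattice open_Compl)

text \<open>The origin is a nearest lattice point for every point of the cell: coordinates of size
  at most 1/2 cannot be decreased by subtracting an integer.\<close>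

lemma norm_le_norm_diff_int_lattice:
  assumes "x \<in> cell" "l \<in> int_lattice"
  shows "norm x \<le> norm (x - l)"
proof (rule norm_le_componentwise_cart)
  fix i
  have "\<bar>x $ i\<bar> \<le> 1/2"
  proof -
    have "-1/2 \<le> x $ i" "x $ i \<le> 1/2"
      using assms(1) by (auto simp: mem_cell)
    then show ?thesis
      by linarith
  qed
  moreover obtain m where m: "l $ i = of_int m"
    using assms(2) by (auto simp: int_lattice_def elim: Ints_cases)
  moreover have "\<bar>x $ i\<bar> \<le> \<bar>x $ i - of_int m\<bar>"
  proof (cases "m = 0")
    case False
    then have "1 \<le> \<bar>real_of_int m\<bar>"
      by linarith
    with \<open>\<bar>x $ i\<bar> \<le> 1/2\<close> show ?thesis
      by linarith
  qed simp
  ultimately show "norm (x $ i) \<le> norm ((x - l) $ i)"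
    by simp
qed

locale smooth_periodic_kernel = periodic_kernel \<kappa> for \<kappa> :: "real^'n \<Rightarrow> complex" +
  fixes K :: real and D1 :: "real^'n \<Rightarrow> (real^'n) \<Rightarrow>\<^sub>L complex"
    and D2 :: "real^'n \<Rightarrow> (real^'n) \<Rightarrow>\<^sub>L (real^'n) \<Rightarrow>\<^sub>L complex"
  assumes K_pos: "K > 0"
    and D1: "\<And>x. x \<notin> int_lattice \<Longrightarrow> (\<kappa> has_derivative blinfun_apply (D1 x)) (at x)"
    and D2: "\<And>x. x \<notin> int_lattice \<Longrightarrow> (D1 has_derivative blinfun_apply (D2 x)) (at x)"
    and norm_kernel_le: "\<And>x. x \<in> cell - {0} \<Longrightarrow> norm (\<kappa> x) \<le> K / norm x ^ (CARD('n) - 1)"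
    and norm_D2_le: "\<And>x. x \<in> cell - {0} \<Longrightarrow> norm (D2 x) \<le> K / norm x ^ (CARD('n) + 1)"

lemma admissible_kernelD:
  fixes \<kappa> :: "real^'n \<Rightarrow> complex"
  assumes "admissible_kernel K \<kappa>"
  obtains D1 D2 where "smooth_periodic_kernel \<kappa> K D1 D2"
proof -
  from assms obtain D1 D2 where K: "K > 0"
    and per: "\<And>x k. k \<in> int_lattice \<Longrightarrow> \<kappa> (x + k) = \<kappa> x"
    and int: "set_integrable lborel cell \<kappa>"
    and D: "\<And>x. x \<in> - int_lattice \<Longrightarrow> (\<kappa> has_derivative blinfun_apply (D1 x)) (at x)"
      "\<And>x. x \<in> - int_lattice \<Longrightarrow> (D1 has_derivative blinfun_apply (D2 x)) (at x)"
    and le: "\<And>x. x \<in> cell - {0} \<Longrightarrow> norm (\<kappa> x) \<le> K / norm x ^ (CARD('n) - 1)"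
      "\<And>x. x \<in> cell - {0} \<Longrightarrow> norm (D2 x) \<le> K / norm x ^ (CARD('n) + 1)"
    unfolding admissible_kernel_def by blast
  \<comment> \<open>Measurability: the kernel is continuous off the closed lattice, and on the
    lattice it has the constant value \<open>\<kappa> 0\<close> by periodicity.\<close>
  have "continuous_on (- int_lattice) \<kappa>"
    using D(1) by (intro has_derivative_continuous_on[of _ _ "\<lambda>x. blinfun_apply (D1 x)"])
      (auto intro: has_derivative_at_withinI)
  then have "(\<lambda>x. if x \<in> - int_lattice then \<kappa> x else \<kappa> 0) \<in> borel_measurable borel"
    by (intro borel_measurable_continuous_on_if borel_open open_Compl_int_lattice continuous_on_const)
  moreover have "(if x \<in> - int_lattice then \<kappa> x else \<kappa> 0) = \<kappa> x" for x
    using per[of x 0] by auto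
  ultimately have meas: "\<kappa> \<in> borel_measurable borel"
    by simp
  have "smooth_periodic_kernel \<kappa> K D1 D2"
  proof
    show "integrable cube_measure \<kappa>"
      using int set_integral_cell(2)[OF meas] by simp
    show "\<kappa> (x + int_vec k) = \<kappa> x" for x k
      by (rule per) (auto simp: mem_int_lattice)
  qed (use meas K D le in auto)
  then show ?thesis
    by (rule that)
qed

context smooth_periodic_kernel
begin

lemma add_int_vec_mem_int_lattice [simp]: "x + int_vec k \<in> int_lattice \<longleftrightarrow> x \<in> int_lattice"
proof -
  have "a + real_of_int m \<in> \<int> \<longleftrightarrow> a \<in> \<int>" for a m
    by (metis Ints_add Ints_diff Ints_of_int add_diff_cancel)
  then show ?thesis
    by (simp add: int_lattice_def int_vec_def)
qed

lemma D1_periodic: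
  assumes "x \<notin> int_lattice"
  shows "D1 (x + int_vec k) = D1 x"
proof -
  have "(\<kappa> has_derivative blinfun_apply (D1 (x + int_vec k))) (at (x + int_vec k))"
    using assms by (intro D1) simp
  then have "((\<lambda>z. \<kappa> (z + int_vec k)) has_derivative blinfun_apply (D1 (x + int_vec k))) (at x)"
    using has_derivative_compose[of "\<lambda>z. z + int_vec k" "\<lambda>h. h" x UNIV \<kappa> "blinfun_apply (D1 (x + int_vec k))"]
      has_derivative_add_const[OF has_derivative_ident[of "at x"], of "int_vec k"] by simp
  then have "(\<kappa> has_derivative blinfun_apply (D1 (x + int_vec k))) (at x)"
    by (simp add: periodic)
  then show ?thesis
    using has_derivative_unique[OF _ D1[OF assms]] by (auto intro: blinfun_eqI)
qed

lemma D2_periodic: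
  assumes "x \<notin> int_lattice"
  shows "D2 (x + int_vec k) = D2 x"
proof -
  have "(D1 has_derivative blinfun_apply (D2 (x + int_vec k))) (at (x + int_vec k))"
    using assms by (intro D2) simp
  then have "((\<lambda>z. D1 (z + int_vec k)) has_derivative blinfun_apply (D2 (x + int_vec k))) (at x)"
    using has_derivative_compose[of "\<lambda>z. z + int_vec k" "\<lambda>h. h" x UNIV D1 "blinfun_apply (D2 (x + int_vec k))"]
      has_derivative_add_const[OF has_derivative_ident[of "at x"], of "int_vec k"] by simp
  \<comment> \<open>Periodicity of \<open>D1\<close> holds off the lattice only, so the derivative
    is transferred through the open complement of the lattice.\<close>
  then have "(D1 has_derivative blinfun_apply (D2 (x + int_vec k))) (at x)"
    by (rule has_derivative_transform_within_open[OF _ open_Compl_int_lattice]) (use assms D1_periodic in auto)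
  then show ?thesis
    using has_derivative_unique[OF _ D2[OF assms]] by (auto intro: blinfun_eqI)
qed

text \<open>
  The derivative bounds are only assumed on \<open>cell\<close>, while the Taylor segments may leave it; there
  periodicity replaces the distance to \<open>0\<close> by the distance to the lattice.
\<close>

lemma norm_D2_le_dist_lattice:
  assumes \<rho>: "\<rho> > 0" and dist: "\<And>l. l \<in> int_lattice \<Longrightarrow> \<rho> \<le> norm (z - l)"
  shows "norm (D2 z) \<le> K / \<rho> ^ (CARD('n) + 1)"
proof -
  have z: "z \<notin> int_lattice"
    using dist[of z] \<rho> by auto
  obtain k where k: "z - int_vec k \<in> unit_cube"
    using tile_unit_cube by blast
  have n: "\<rho> \<le> norm (z - int_vec k)"
    by (rule dist) (auto simp: mem_int_lattice)
  have z': "z - int_vec k \<notin> int_lattice"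
    using z add_int_vec_mem_int_lattice[of "z - int_vec k" k] by simp
  have "norm (D2 z) = norm (D2 (z - int_vec k))"
    using D2_periodic[OF z', of k] by simp
  also have "\<dots> \<le> K / norm (z - int_vec k) ^ (CARD('n) + 1)"
    using k n \<rho> unit_cube_subset_cell by (intro norm_D2_le) auto
  also have "\<dots> \<le> K / \<rho> ^ (CARD('n) + 1)"
    using n \<rho> K_pos by (intro divide_left_mono power_mono mult_pos_pos zero_less_power) auto
  finally show ?thesis .
qed

text \<open>The bound on \<open>D2\<close> makes \<open>D1\<close> grow at most linearly in t along
  the segment. Comparing with a quadratic in t, instead of using the largest growth, keeps the
  factor 1/2.\<close>

lemma norm_taylor_le:
  assumes seg: "\<And>t. t \<in> {0..1} \<Longrightarrow> x - t *\<^sub>R y \<notin> int_lattice"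
    and M: "\<And>t. t \<in> {0..1} \<Longrightarrow> norm (D2 (x - t *\<^sub>R y)) \<le> M"
  shows "norm (\<kappa> x - \<kappa> (x - y) - D1 x y) \<le> M / 2 * (norm y)\<^sup>2"
proof -
  have x: "x \<notin> int_lattice"
    using seg[of 0] by simp
  have D1_diff: "norm (D1 (x - t *\<^sub>R y) - D1 x) \<le> t * norm y * M" if t: "t \<in> {0..1}" for t
  proof -
    have mem: "s * t \<in> {0..1}" if "s \<in> {0..1}" for s
      using that t by (auto simp: mult_le_one)
    have "norm (D1 (x + - (t *\<^sub>R y)) - D1 x) \<le> norm (- (t *\<^sub>R y)) * M"
    proof (rule differentiable_bound_segment[where G = "- int_lattice" and f' = "\<lambda>z. blinfun_apply (D2 z)"])
      show "x + s *\<^sub>R - (t *\<^sub>R y) \<in> - int_lattice" if "s \<in> {0..1}" for s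
        using seg[OF mem[OF that]] by simp
      show "(D1 has_derivative blinfun_apply (D2 z)) (at z within - int_lattice)" if "z \<in> - int_lattice" for z
        using that by (auto intro: has_derivative_at_withinI D2)
      show "onorm (blinfun_apply (D2 (x + s *\<^sub>R - (t *\<^sub>R y)))) \<le> M" if "s \<in> {0..1}" for s
        using M[OF mem[OF that]] by (simp add: norm_blinfun.rep_eq)
    qed
    then show ?thesis
      using t by simp
  qed
  \<comment> \<open>Chosen so that the derivative of g vanishes at t = 0 and g 1 - g 0 is the Taylor
    remainder up to sign.\<close>
  define g where "g t = \<kappa> (x - t *\<^sub>R y) + t *\<^sub>R D1 x y" for t :: real
  have g': "(g has_vector_derivative (- D1 (x - t *\<^sub>R y) y + D1 x y)) (at t)" if "t \<in> {0..1}" for t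
  proof -
    have "((\<lambda>t. \<kappa> (x - t *\<^sub>R y)) has_derivative (\<lambda>s. D1 (x - t *\<^sub>R y) (- (s *\<^sub>R y)))) (at t)"
      by (rule has_derivative_compose[where f = "\<lambda>t. x - t *\<^sub>R y" and g = \<kappa> and f' = "\<lambda>s. - (s *\<^sub>R y)", OF _ D1[OF seg[OF that]]])
        (auto intro!: derivative_eq_intros)
    then have "(g has_derivative (\<lambda>s. D1 (x - t *\<^sub>R y) (- (s *\<^sub>R y)) + s *\<^sub>R D1 x y)) (at t)"
      unfolding g_def[abs_def] by (auto intro!: derivative_eq_intros)
    then show ?thesis
      by (simp add: has_vector_derivative_def blinfun.bilinear_simps algebra_simps)
  qed
  let ?\<phi> = "\<lambda>t. M * (norm y)\<^sup>2 * t\<^sup>2 / 2"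
  have "norm (g 1 - g 0) \<le> ?\<phi> 1 - ?\<phi> 0"
  proof (rule differentiable_bound_general[of 0 1 g ?\<phi> "\<lambda>t. - D1 (x - t *\<^sub>R y) y + D1 x y" "\<lambda>t. M * (norm y)\<^sup>2 * t"])
    show "continuous_on {0..1} g"
      using has_vector_derivative_continuous[OF g'] by (intro continuous_at_imp_continuous_on) auto
    show "(?\<phi> has_vector_derivative M * (norm y)\<^sup>2 * t) (at t)" for t
      by (auto intro!: derivative_eq_intros simp: has_real_derivative_iff_has_vector_derivative[symmetric])
    show "norm (- D1 (x - t *\<^sub>R y) y + D1 x y) \<le> M * (norm y)\<^sup>2 * t" if "0 < t" "t < 1" for t
    proof -
      have "norm (- D1 (x - t *\<^sub>R y) y + D1 x y) = norm ((D1 (x - t *\<^sub>R y) - D1 x) y)"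
        by (simp add: blinfun.bilinear_simps norm_minus_commute)
      also have "\<dots> \<le> norm (D1 (x - t *\<^sub>R y) - D1 x) * norm y"
        by (rule norm_blinfun)
      also have "\<dots> \<le> t * norm y * M * norm y"
        using D1_diff[of t] that by (intro mult_right_mono) auto
      finally show ?thesis
        by (simp add: power2_eq_square mult_ac)
    qed
    show "(g has_vector_derivative (- D1 (x - t *\<^sub>R y) y + D1 x y)) (at t)" if "0 < t" "t < 1" for t
      using that by (intro g') auto
  qed (auto intro!: continuous_intros)
  also have "norm (g 1 - g 0) = norm (\<kappa> x - \<kappa> (x - y) - D1 x y)"
    by (simp add: g_def norm_minus_commute algebra_simps)
  finally show ?thesis
    by simp
qed

end

section \<open>Gaussian sums over shifted lattices\<close>

text \<open>For m \<noteq> 0 put l = |m| - 1. Then |w - m| \<ge> l + 1/2, and (l + 1/2)^2 \<ge> l +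
  1/4, so with a \<ge> 2 the term is at most exp (- a/4) exp (- l/2). Both half-lines give geometric
  series of ratio q.\<close>

lemma
  fixes a w :: real
  assumes a: "a \<ge> 2" and w: "\<bar>w\<bar> \<le> 1/2"
  defines "E \<equiv> \<lambda>m::int. exp (- (a * (w - real_of_int m)\<^sup>2))" and "q \<equiv> exp (- 1/2) :: real"
  shows integrable_exp_lattice: "integrable (count_space UNIV) E"
    and integrable_exp_lattice_nonzero: "integrable (count_space UNIV) (\<lambda>m. indicator (- {0}) m * E m)"
    and integral_exp_lattice_le: "(LINT m|count_space UNIV. E m) \<le> 2 / (1 - q)"
    and integral_exp_lattice_nonzero_le:
      "(LINT m|count_space UNIV. indicator (- {0}) m * E m) \<le> 2 / (1 - q) * exp (- a / 4)"
proof -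
  have q: "0 < q" "q < 1"
    by (auto simp: q_def)
  have E: "E m \<le> exp (- a / 4) / q * q ^ nat \<bar>m\<bar>" if "m \<noteq> 0" for m
  proof -
    define l where "l = real (nat \<bar>m\<bar>) - 1"
    have l: "l \<ge> 0"
      using that by (simp add: l_def)
    have "\<bar>w - real_of_int m\<bar> \<ge> l + 1/2"
      using w by (auto simp: l_def)
    then have "(l + 1/2)\<^sup>2 \<le> \<bar>w - real_of_int m\<bar>\<^sup>2"
      using l by (intro power_mono) auto
    then have "l\<^sup>2 + l + 1/4 \<le> (w - real_of_int m)\<^sup>2"
      by (simp add: power2_eq_square algebra_simps)
    then have "l + 1/4 \<le> (w - real_of_int m)\<^sup>2"
      using zero_le_power2[of l] by linarith
    then have "a * (l + 1/4) \<le> a * (w - real_of_int m)\<^sup>2"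
      using a by (intro mult_left_mono) auto
    then have "a * l + a / 4 \<le> a * (w - real_of_int m)\<^sup>2"
      by (simp add: distrib_left)
    moreover have "1/2 * l \<le> a * l"
      using a l by (intro mult_right_mono) auto
    ultimately have "- (a * (w - real_of_int m)\<^sup>2) \<le> - a / 4 - 1/2 * l"
      by linarith
    also have "\<dots> = - a / 4 + 1/2 + real (nat \<bar>m\<bar>) * (- 1/2)"
      by (simp add: l_def field_simps)
    finally have "- (a * (w - real_of_int m)\<^sup>2) \<le> - a / 4 + 1/2 + real (nat \<bar>m\<bar>) * (- 1/2)" .
    then have "E m \<le> exp (- a / 4 + 1/2 + real (nat \<bar>m\<bar>) * (- 1/2))"
      by (simp add: E_def)
    also have "\<dots> = exp (- a / 4) / q * q ^ nat \<bar>m\<bar>"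
      unfolding q_def exp_add exp_of_nat_mult by (simp add: exp_minus field_simps)
    finally show ?thesis .
  qed
  define B where "B = {m::int. \<bar>m\<bar> > int 0}"
  have B: "B = - {0}"
    by (auto simp: B_def)
  define g where "g = (\<lambda>m::int. exp (- a / 4) / q * q ^ nat \<bar>m\<bar>)"
  have gB: "integrable (count_space B) g" "(LINT m|count_space B. g m) = exp (- a / 4) / q * (2 * q / (1 - q))"
    unfolding g_def B_def using q integrable_geometric_int_tail[of q 0] integral_geometric_int_tail[of q 0]
    by auto
  have EB: "integrable (count_space B) E"
    by (rule Bochner_Integration.integrable_bound[OF gB(1)])
      (use E q in \<open>auto simp: B g_def E_def AE_count_space\<close>)
  then have E_abs: "Infinite_Set_Sum.abs_summable_on E B"
    by (simp add: Infinite_Set_Sum.abs_summable_on_def)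
  have E0: "Infinite_Set_Sum.abs_summable_on E {0}"
    by (rule abs_summable_on_finite) simp
  have "UNIV = {0} \<union> B"
    by (auto simp: B)
  then have split: "infsetsum E UNIV = infsetsum E {0} + infsetsum E B"
    using infsetsum_Un_disjoint[OF E0 E_abs] by (simp add: B)
  show "integrable (count_space UNIV) E"
    using abs_summable_on_union[OF E0 E_abs] by (simp add: B Infinite_Set_Sum.abs_summable_on_def)
  have nz: "(LINT m|count_space UNIV. indicator (- {0}) m * E m) = infsetsum E B"
    unfolding B infsetsum_altdef set_lebesgue_integral_def by simp
  show "integrable (count_space UNIV) (\<lambda>m. indicator (- {0}) m * E m)"
    using E_abs unfolding B abs_summable_on_altdef set_integrable_def by simp
  have "infsetsum E B \<le> exp (- a / 4) / q * (2 * q / (1 - q))"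
    unfolding infsetsum_def gB(2)[symmetric]
  proof (rule integral_mono[OF EB gB(1)])
    show "E m \<le> g m" if "m \<in> space (count_space B)" for m
      using E[of m] that by (simp add: g_def B)
  qed
  also have "\<dots> = 2 / (1 - q) * exp (- a / 4)"
    using q by simp
  finally have le: "infsetsum E B \<le> 2 / (1 - q) * exp (- a / 4)" .
  then show "(LINT m|count_space UNIV. indicator (- {0}) m * E m) \<le> 2 / (1 - q) * exp (- a / 4)"
    by (simp only: nz)
  have "exp (- a / 4) \<le> q"
    using a by (simp add: q_def)
  then have "2 / (1 - q) * exp (- a / 4) \<le> 2 / (1 - q) * q"
    using q by (intro mult_left_mono) auto
  moreover have "infsetsum E {0} \<le> 1"
    using a by (simp add: E_def)
  \<comment> \<open>As exp (- a/4) \<le> q, the terms m \<noteq> 0 stay below the claimed bound by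
    2, which leaves room for the term m = 0, at most 1.\<close>
  moreover have "2 / (1 - q) - 2 / (1 - q) * q = 2"
  proof -
    have "2 / (1 - q) * (1 - q) = 2"
      by (rule nonzero_eq_divide_eq[THEN iffD1, OF _ refl]) (use q in simp)
    then show ?thesis
      by (simp only: right_diff_distrib mult_1_right)
  qed
  ultimately show "(LINT m|count_space UNIV. E m) \<le> 2 / (1 - q)"
    using split le unfolding infsetsum_def by linarith
qed

lemma gauss_eq_exp_prod:
  fixes y :: "real^'n"
  assumes "\<delta> > 0"
  shows "gauss \<delta> y = 1 / (2 * pi * \<delta>\<^sup>2) powr (real CARD('n) / 2) * (\<Prod>i\<in>UNIV. exp (- (1 / (2 * \<delta>\<^sup>2) * (y $ i)\<^sup>2)))"
proof -
  have "exp (- ((norm y)\<^sup>2 / (2 * \<delta>\<^sup>2))) = (\<Prod>i\<in>UNIV. exp (- (1 / (2 * \<delta>\<^sup>2) * (y $ i)\<^sup>2)))"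
    by (simp add: exp_sum[symmetric] norm_vec_def L2_set_def sum_nonneg sum_negf sum_divide_distrib)
  then show ?thesis
    by (simp add: gauss_def)
qed

text \<open>
  For \<open>w\<close> in the cell, the term \<open>k = 0\<close> accounts for the summand \<open>1\<close>. Any other \<open>k\<close> has a nonzero
  coordinate \<open>k $ i\<close>, for which the one-dimensional sum is at most
  \<open>2 / (1 - exp (- 1/2)) * exp (- 1 / (8 * \<delta>\<^sup>2))\<close>, and \<open>r \<le> 1/2\<close>.
\<close>

lemma
  fixes w :: "real^'n"
  assumes \<delta>: "0 < \<delta>" "\<delta> < 1/2" and r: "0 \<le> r" "r \<le> 1/2"
  defines "g \<equiv> \<lambda>w k. gauss \<delta> (w - int_vec k) * indicator {y. norm y > r} (w - int_vec k)"
  shows integrable_gauss_lattice_tail: "integrable (count_space UNIV) (g w)"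
    and integral_gauss_lattice_tail_le: "(LINT k|count_space UNIV. g w k)
      \<le> (1 + real CARD('n) * (2 / (1 - exp (- 1/2))) ^ CARD('n)) * exp (- (r\<^sup>2 / (2 * \<delta>\<^sup>2)))
        / (2 * pi * \<delta>\<^sup>2) powr (real CARD('n) / 2)"
proof -
  show int: "integrable (count_space UNIV) (g w)" for w
    by (rule Bochner_Integration.integrable_bound[OF integrable_gauss_lattice[OF \<delta>(1), of w]])
      (auto simp: g_def indicator_def)
  define a where "a = 1 / (2 * \<delta>\<^sup>2)"
  define c where "c = (2 * pi * \<delta>\<^sup>2) powr (real CARD('n) / 2)"
  define Q where "Q = 2 / (1 - exp (- 1/2) :: real)"
  have c: "c > 0"
    using \<delta> by (simp add: c_def)
  have Q: "Q \<ge> 0"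
    by (simp add: Q_def)
  have "\<delta>\<^sup>2 \<le> (1/2)\<^sup>2"
    using \<delta> by (intro power_mono) auto
  then have a: "a \<ge> 2"
    using \<delta> by (simp add: a_def field_simps power2_eq_square)
  have r2: "exp (- a / 4) \<le> exp (- a * r\<^sup>2)"
  proof -
    have "r\<^sup>2 \<le> (1/2)\<^sup>2"
      using r by (intro power_mono) auto
    then have "a * r\<^sup>2 \<le> a * (1/4)"
      using a by (intro mult_left_mono) (auto simp: power2_eq_square)
    then show ?thesis
      by simp
  qed
  have main: "(LINT k|count_space UNIV. g w k) \<le> (1 + real CARD('n) * Q ^ CARD('n)) * exp (- a * r\<^sup>2) / c"
    if w: "w \<in> cell" for w
  proof -
    let ?E = "\<lambda>i m. exp (- (a * (w $ i - real_of_int m)\<^sup>2))"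
    let ?f = "\<lambda>i j m. if j = i then indicator (- {0}) m * ?E j m else ?E j m"
    let ?F = "\<lambda>i (k::int^'n). \<Prod>j\<in>UNIV. ?f i j (k $ j)"
    have wi: "\<bar>w $ i\<bar> \<le> 1/2" for i
    proof -
      have "-1/2 \<le> w $ i" "w $ i \<le> 1/2"
        using w by (auto simp: mem_cell)
      then show ?thesis
        by linarith
    qed
    note E = integrable_exp_lattice[OF a wi] integral_exp_lattice_le[OF a wi]
      integrable_exp_lattice_nonzero[OF a wi] integral_exp_lattice_nonzero_le[OF a wi]
    have f: "integrable (count_space UNIV) (?f i j)" for i j
      using E(1,3)[of j] by (cases "j = i") auto
    have F: "integrable (count_space UNIV) (?F i)"
      "(LINT k|count_space UNIV. ?F i k) = (\<Prod>j\<in>UNIV. LINT m|count_space UNIV. ?f i j m)" for i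
      by (rule integrable_count_space_prod_vec[of "?f i", OF f] integral_count_space_prod_vec[of "?f i", OF f])+
    have F_le: "(LINT k|count_space UNIV. ?F i k) \<le> Q ^ CARD('n) * exp (- a * r\<^sup>2)" for i
    proof -
      have nn: "0 \<le> (LINT m|count_space UNIV. ?E j m)" for j
        by (rule integral_nonneg_AE) simp
      have nn': "0 \<le> (LINT m|count_space UNIV. indicator (- {0}) m * ?E j m)" for j
        by (rule integral_nonneg_AE) simp
      have "(LINT k|count_space UNIV. ?F i k) = (\<Prod>j\<in>UNIV. LINT m|count_space UNIV. ?f i j m)"
        by (rule F(2))
      also have "\<dots> = (LINT m|count_space UNIV. ?f i i m) * (\<Prod>j\<in>UNIV - {i}. LINT m|count_space UNIV. ?f i j m)"
        by (subst prod.remove[of _ i]) auto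
      also have "(\<Prod>j\<in>UNIV - {i}. LINT m|count_space UNIV. ?f i j m) = (\<Prod>j\<in>UNIV - {i}. LINT m|count_space UNIV. ?E j m)"
        by (intro prod.cong) auto
      also have "(LINT m|count_space UNIV. ?f i i m) * \<dots> \<le> (Q * exp (- a / 4)) * (\<Prod>j\<in>UNIV - {i}. Q)"
      proof (rule mult_mono)
        show "(LINT m|count_space UNIV. ?f i i m) \<le> Q * exp (- a / 4)"
          using E(4)[of i] by (simp add: Q_def)
        show "(\<Prod>j\<in>UNIV - {i}. LINT m|count_space UNIV. ?E j m) \<le> (\<Prod>j\<in>UNIV - {i}. Q)"
          using E(2) nn by (intro prod_mono) (auto simp: Q_def)
      qed (use Q nn in \<open>auto intro!: prod_nonneg\<close>)
      also have "\<dots> = Q ^ CARD('n) * exp (- a / 4)"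
      proof -
        have "Q * (\<Prod>j\<in>UNIV - {i}. Q) = Q ^ CARD('n)"
          using prod.remove[of "UNIV :: 'n set" i "\<lambda>_. Q"] by simp
        moreover have "Q * exp (- a / 4) * (\<Prod>j\<in>UNIV - {i}. Q) = Q * (\<Prod>j\<in>UNIV - {i}. Q) * exp (- a / 4)"
          by (simp only: mult_ac)
        ultimately show ?thesis
          by (simp only:)
      qed
      also have "\<dots> \<le> Q ^ CARD('n) * exp (- a * r\<^sup>2)"
        using Q r2 by (intro mult_left_mono) auto
      finally show ?thesis .
    qed
    have g_le: "g w k \<le> 1 / c * (indicator {0} k * exp (- a * r\<^sup>2) + (\<Sum>i\<in>UNIV. ?F i k))" for k
    proof -
      have F0: "0 \<le> ?F i k" for i
        by (intro prod_nonneg) auto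
      have gw: "g w k = 1 / c * ((\<Prod>j\<in>UNIV. ?E j (k $ j)) * indicator {y. norm y > r} (w - int_vec k))"
        unfolding g_def gauss_eq_exp_prod[OF \<delta>(1)] a_def c_def by (simp add: int_vec_def)
      have "(\<Prod>j\<in>UNIV. ?E j (k $ j)) * indicator {y. norm y > r} (w - int_vec k)
          \<le> indicator {0} k * exp (- a * r\<^sup>2) + (\<Sum>i\<in>UNIV. ?F i k)"
      proof (cases "k = 0")
        case True
        have "(\<Prod>j\<in>UNIV. ?E j (k $ j)) = exp (- a * (norm w)\<^sup>2)"
          using True by (simp add: exp_sum[symmetric] norm_vec_def L2_set_def sum_nonneg sum_negf sum_distrib_left)
        moreover have "exp (- a * (norm w)\<^sup>2) \<le> exp (- a * r\<^sup>2)" if "norm w > r"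
          using that r a by (simp add: mult_left_mono power_mono)
        moreover have "int_vec k = 0"
          using True by (simp add: int_vec_def vec_eq_iff)
        ultimately show ?thesis
          using True sum_nonneg[of UNIV "\<lambda>i. ?F i k"] F0 by (auto simp: indicator_def add_increasing2)
      next
        case False
        then obtain i where i: "k $ i \<noteq> 0"
          by (auto simp: vec_eq_iff)
        have "(\<Prod>j\<in>UNIV. ?E j (k $ j)) = ?F i k"
          using i by (intro prod.cong) auto
        also have "\<dots> \<le> (\<Sum>i\<in>UNIV. ?F i k)"
          using F0 by (intro member_le_sum) auto
        finally have 1: "(\<Prod>j\<in>UNIV. ?E j (k $ j)) \<le> (\<Sum>i\<in>UNIV. ?F i k)" .
        have "(\<Prod>j\<in>UNIV. ?E j (k $ j)) * indicator {y. norm y > r} (w - int_vec k) \<le> (\<Prod>j\<in>UNIV. ?E j (k $ j))"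
          by (auto simp: indicator_def prod_nonneg)
        also note 1
        finally show ?thesis
          using False by simp
      qed
      then show ?thesis
        unfolding gw using c by (intro mult_left_mono) auto
    qed
    have i0: "integrable (count_space UNIV) (\<lambda>k::int^'n. indicator {0} k * exp (- a * r\<^sup>2))"
      by (intro integrable_mult_left integrable_real_indicator) auto
    have "(LINT k|count_space UNIV. g w k)
        \<le> (LINT k|count_space UNIV. 1 / c * (indicator {0} k * exp (- a * r\<^sup>2) + (\<Sum>i\<in>UNIV. ?F i k)))"
      by (rule integral_mono[OF int _ g_le]) (intro integrable_mult_right Bochner_Integration.integrable_add i0 Bochner_Integration.integrable_sum F(1))
    also have "\<dots> = 1 / c * ((LINT k|count_space UNIV. indicator {0 :: int^'n} k * exp (- a * r\<^sup>2)) + (\<Sum>i\<in>UNIV. LINT k|count_space UNIV. ?F i k))"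
      using i0 F(1) by (simp only: integral_mult_right_zero Bochner_Integration.integral_add Bochner_Integration.integral_sum Bochner_Integration.integrable_sum)
    also have "(LINT k|count_space UNIV. indicator {0 :: int^'n} k * exp (- a * r\<^sup>2)) = exp (- a * r\<^sup>2)"
      by (subst integral_count_space_single[of 0]) auto
    also have "1 / c * (exp (- a * r\<^sup>2) + (\<Sum>i\<in>UNIV. LINT k|count_space UNIV. ?F i k))
        \<le> 1 / c * (exp (- a * r\<^sup>2) + (\<Sum>i\<in>(UNIV::'n set). Q ^ CARD('n) * exp (- a * r\<^sup>2)))"
      using c by (intro mult_left_mono add_left_mono sum_mono F_le) auto
    also have "\<dots> = (1 + real CARD('n) * Q ^ CARD('n)) * exp (- a * r\<^sup>2) / c"
      by (simp add: field_simps)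
    finally show ?thesis .
  qed
  \<comment> \<open>A lattice translation moves w into the cell and merely reindexes the
    sum.\<close>
  obtain l where l: "w - int_vec l \<in> unit_cube"
    using tile_unit_cube by blast
  have b: "bij_betw (\<lambda>k. k + l) UNIV UNIV"
    by (rule bij_betwI[of _ _ _ "\<lambda>k. k - l"]) auto
  have "(LINT k|count_space UNIV. g w k) = (LINT k|count_space UNIV. g w (k + l))"
    by (rule integral_bij_count_space[OF b, symmetric])
  also have "\<dots> = (LINT k|count_space UNIV. g (w - int_vec l) k)"
  proof -
    have eq: "w - int_vec (k + l) = w - int_vec l - int_vec k" for k
      by (simp add: int_vec_def vec_eq_iff)
    show ?thesis
      unfolding g_def eq ..
  qed
  also have "\<dots> \<le> (1 + real CARD('n) * Q ^ CARD('n)) * exp (- a * r\<^sup>2) / c"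
    using l unit_cube_subset_cell by (intro main) auto
  finally show "(LINT k|count_space UNIV. g w k)
      \<le> (1 + real CARD('n) * (2 / (1 - exp (- 1/2))) ^ CARD('n)) * exp (- (r\<^sup>2 / (2 * \<delta>\<^sup>2)))
        / (2 * pi * \<delta>\<^sup>2) powr (real CARD('n) / 2)"
    by (simp add: Q_def a_def c_def)
qed

text \<open>Periodicity folds the integral onto the cube, where the lattice sum of the Gaussian tail
  is bounded uniformly in the base point; only the integral of the norm of the kernel
  remains.\<close>

lemma (in periodic_kernel) norm_long_tail_le:
  assumes \<delta>: "0 < \<delta>" "\<delta> < 1/2" and r: "0 \<le> r" "r \<le> 1/2"
  shows "norm (LINT y|lborel. \<kappa> (x - y) * complex_of_real (gauss \<delta> y * indicator {y. norm y > r} y))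
    \<le> L1_cell \<kappa> * ((1 + real CARD('n) * (2 / (1 - exp (- 1/2))) ^ CARD('n)) * exp (- (r\<^sup>2 / (2 * \<delta>\<^sup>2)))
        / (2 * pi * \<delta>\<^sup>2) powr (real CARD('n) / 2))"
    (is "norm ?I \<le> _ * ?B")
proof -
  let ?g = "\<lambda>y. gauss \<delta> y * indicator {y. norm y > r} y"
  let ?F = "\<lambda>z. \<kappa> z * complex_of_real (?g (x - z))"
  have F: "integrable lborel ?F"
    by (rule Bochner_Integration.integrable_bound[OF integrable_mult_gauss[OF \<delta>(1), of x]])
      (auto simp: norm_mult indicator_def)
  have "?I = (LINT z|lborel. ?F z)"
    using lborel_reflect(1)[of ?F x] by simp
  also have "\<dots> = (LINT z|cube_measure. LINT k|count_space UNIV. ?F (z + int_vec k))"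
    unfolding cube_measure_def by (rule integral_tiling[OF unit_cube_borel tile_unit_cube F])
  also have "\<dots> = (LINT z|cube_measure. \<kappa> z * complex_of_real (LINT k|count_space UNIV. ?g (x - z - int_vec k)))"
    by (simp add: periodic diff_diff_eq flip: of_real_mult)
  finally have I: "?I = (LINT z|cube_measure. \<kappa> z * complex_of_real (LINT k|count_space UNIV. ?g (x - z - int_vec k)))" .
  have B: "?B \<ge> 0"
    by (intro divide_nonneg_nonneg mult_nonneg_nonneg add_nonneg_nonneg zero_le_power) auto
  show ?thesis
  \<comment> \<open>In the nonintegrable case the Bochner integral is 0 by convention and the bound
    is trivial.\<close>
  proof (cases "integrable cube_measure (\<lambda>z. \<kappa> z * complex_of_real (LINT k|count_space UNIV. ?g (x - z - int_vec k)))")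
    case True
    have "norm ?I \<le> (LINT z|cube_measure. norm (\<kappa> z) * ?B)"
      unfolding I
    proof (rule Bochner_Integration.integral_norm_bound_integral[OF True])
      show "integrable cube_measure (\<lambda>z. norm (\<kappa> z) * ?B)"
        by (intro integrable_mult_left integrable_norm integrable_cube)
      fix z
      have "0 \<le> (LINT k|count_space UNIV. ?g (x - z - int_vec k))"
        by (rule integral_nonneg_AE) simp
      then show "norm (\<kappa> z * complex_of_real (LINT k|count_space UNIV. ?g (x - z - int_vec k))) \<le> norm (\<kappa> z) * ?B"
        unfolding norm_mult norm_of_real using integral_gauss_lattice_tail_le[OF \<delta> r, of "x - z"]
        by (intro mult_left_mono) (simp_all only: abs_of_nonneg norm_ge_zero)
    qed
    then show ?thesis
      by (simp only: integral_mult_left_zero L1_cell_eq[symmetric])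
  next
    case False
    then show ?thesis
      unfolding I not_integrable_integral_eq[OF False] using B L1_cell_nonneg by simp
  qed
qed

section \<open>Inner and outer contributions to the short-range kernel\<close>

lemma upper_Gamma_const_nonneg:
  assumes "upper_Gamma_const b C"
  shows "C \<ge> 0"
proof -
  have "0 \<le> upper_Gamma b 1"
    unfolding upper_Gamma_def set_lebesgue_integral_def by (intro integral_nonneg_AE) auto
  also have "\<dots> \<le> C * (1 powr (b - 1) + 1 powr (- 1)) * exp (- 1)"
    using assms unfolding upper_Gamma_const_def by (metis zero_less_one)
  finally show ?thesis
    by (simp add: zero_le_mult_iff)
qed

context smooth_periodic_kernel
begin

text \<open>The linear Taylor term of \<open>\<kappa>\<close> is odd and integrates to zero against the Gaussian over the ball.\<close>

lemma norm_short_inner_le: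
  fixes x :: "real^'n"
  assumes d: "CARD('n) \<ge> 2" and \<delta>: "\<delta> > 0" and x: "x \<in> cell" "x \<noteq> 0"
  defines "r \<equiv> norm x / sqrt (real CARD('n))"
  shows "norm (LINT y|lborel. complex_of_real (gauss \<delta> y * indicator (cball 0 r) y) * (\<kappa> x - \<kappa> (x - y)))
    \<le> real CARD('n) * K / (2 * (1 - 1 / sqrt (real CARD('n))) ^ (CARD('n) + 1)) * (\<delta>\<^sup>2 / norm x ^ (CARD('n) + 1))"
proof -
  define s where "s = 1 - 1 / sqrt (real CARD('n))"
  have s: "s > 0"
    using d by (simp add: s_def)
  \<comment> \<open>For |y| \<le> r the segment from x to x - y keeps at least this distance from
    every lattice point. Its power d + 1 is the source of (1 - 1 / sqrt d)^(d + 1) in the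
    denominator.\<close>
  define \<rho> where "\<rho> = norm x * s"
  have \<rho>: "\<rho> > 0"
    using x s by (simp add: \<rho>_def)
  define M where "M = K / \<rho> ^ (CARD('n) + 1)"
  have M: "M \<ge> 0"
    using K_pos \<rho> by (simp add: M_def)
  have xr: "norm x - r = \<rho>"
    by (simp add: \<rho>_def s_def r_def algebra_simps)
  have dist: "\<rho> \<le> norm (x - t *\<^sub>R y - l)" if "y \<in> cball 0 r" "t \<in> {0..1}" "l \<in> int_lattice" for y t l
  proof -
    have "norm (t *\<^sub>R y) \<le> 1 * r"
      using that mult_mono[of t 1 "norm y" r] by auto
    moreover have "norm x \<le> norm (x - l)"
      using x that by (intro norm_le_norm_diff_int_lattice)
    moreover have "norm (x - l) - norm (t *\<^sub>R y) \<le> norm (x - l - t *\<^sub>R y)"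
      by (rule norm_triangle_ineq2)
    ultimately have "norm x - r \<le> norm (x - l - t *\<^sub>R y)"
      by linarith
    then show ?thesis
      by (simp add: xr algebra_simps)
  qed
  have taylor: "norm (\<kappa> x - \<kappa> (x - y) - D1 x y) \<le> M / 2 * (norm y)\<^sup>2" if y: "y \<in> cball 0 r" for y
  proof (rule norm_taylor_le)
    fix t :: real assume t: "t \<in> {0..1}"
    show "x - t *\<^sub>R y \<notin> int_lattice"
      using dist[OF y t, of "x - t *\<^sub>R y"] \<rho> by auto
    show "norm (D2 (x - t *\<^sub>R y)) \<le> M"
      unfolding M_def by (rule norm_D2_le_dist_lattice[OF \<rho>]) (rule dist[OF y t])
  qed
  let ?w = "\<lambda>y. complex_of_real (gauss \<delta> y * indicator (cball 0 r) y)"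
  have [measurable]: "(\<lambda>y. blinfun_apply (D1 x) y) \<in> borel_measurable borel"
    by (intro borel_measurable_continuous_onI continuous_intros)
  have [measurable]: "cball (0 :: real^'n) r \<in> sets borel" "(\<lambda>y. \<kappa> x - \<kappa> (x - y)) \<in> borel_measurable borel"
    by (simp, intro borel_measurable_diff measurable_compose[OF _ meas]) simp_all
  have i1: "integrable lborel (\<lambda>y. ?w y * (\<kappa> x - \<kappa> (x - y)))"
  proof (rule Bochner_Integration.integrable_bound)
    show "integrable lborel (\<lambda>y. norm (\<kappa> x) * gauss \<delta> y + norm (\<kappa> (x - y) * complex_of_real (gauss \<delta> y)))"
      by (intro Bochner_Integration.integrable_add integrable_mult_right integrable_gauss \<delta> integrable_norm integrable_k_long)
    show "AE y in lborel. norm (?w y * (\<kappa> x - \<kappa> (x - y))) \<le> norm (norm (\<kappa> x) * gauss \<delta> y + norm (\<kappa> (x - y) * complex_of_real (gauss \<delta> y)))"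
    proof (rule AE_I2)
      fix y
      have "norm (?w y * (\<kappa> x - \<kappa> (x - y))) \<le> gauss \<delta> y * norm (\<kappa> x - \<kappa> (x - y))"
        by (auto simp: norm_mult indicator_def)
      also have "\<dots> \<le> gauss \<delta> y * (norm (\<kappa> x) + norm (\<kappa> (x - y)))"
        by (intro mult_left_mono norm_triangle_ineq4) auto
      finally show "norm (?w y * (\<kappa> x - \<kappa> (x - y))) \<le> norm (norm (\<kappa> x) * gauss \<delta> y + norm (\<kappa> (x - y) * complex_of_real (gauss \<delta> y)))"
        by (simp add: norm_mult algebra_simps)
    qed
  qed measurable
  have i2: "integrable lborel (\<lambda>y. ?w y * D1 x y)"
  proof (rule Bochner_Integration.integrable_bound)
    show "integrable lborel (\<lambda>y :: real^'n. gauss \<delta> y * (norm (D1 x) * r))"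
      by (intro integrable_mult_left integrable_gauss \<delta>)
    show "AE y in lborel. norm (?w y * D1 x y) \<le> norm (gauss \<delta> y * (norm (D1 x) * r))"
    proof (rule AE_I2)
      fix y :: "real^'n"
      have "norm (D1 x y) \<le> norm (D1 x) * r" if "norm y \<le> r"
        by (rule order_trans[OF norm_blinfun mult_left_mono[OF that]]) simp
      moreover have "r \<ge> 0"
        by (simp add: r_def)
      ultimately show "norm (?w y * D1 x y) \<le> norm (gauss \<delta> y * (norm (D1 x) * r))"
        by (auto simp: norm_mult indicator_def intro!: mult_left_mono)
    qed
  qed measurable
  have odd: "(LINT y|lborel. ?w y * D1 x y) = 0"
  proof -
    have "(LINT y|lborel. ?w (0 - y) * D1 x (0 - y)) = (LINT y|lborel. ?w y * D1 x y)"
      by (rule lborel_reflect(1)[of "\<lambda>y. ?w y * D1 x y" 0]) measurable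
    moreover have "?w (0 - y) * D1 x (0 - y) = - (?w y * D1 x y)" for y
      by (simp add: gauss_def blinfun.bilinear_simps indicator_def)
    ultimately have "- (LINT y|lborel. ?w y * D1 x y) = (LINT y|lborel. ?w y * D1 x y)"
      by simp
    then show ?thesis
      by simp
  qed
  have "(LINT y|lborel. ?w y * (\<kappa> x - \<kappa> (x - y)))
      = (LINT y|lborel. ?w y * (\<kappa> x - \<kappa> (x - y)) - ?w y * D1 x y)"
    using odd by (subst Bochner_Integration.integral_diff[OF i1 i2]) simp
  also have "norm \<dots> \<le> (LINT y|lborel. M / 2 * (gauss \<delta> (y :: real^'n) * (norm y)\<^sup>2))"
  proof (rule Bochner_Integration.integral_norm_bound_integral)
    show "integrable lborel (\<lambda>y. ?w y * (\<kappa> x - \<kappa> (x - y)) - ?w y * D1 x y)"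
      by (intro Bochner_Integration.integrable_diff i1 i2)
    show "integrable lborel (\<lambda>y :: real^'n. M / 2 * (gauss \<delta> y * (norm y)\<^sup>2))"
      by (intro integrable_mult_right integrable_gauss_norm_squared \<delta>)
    fix y :: "real^'n"
    have "norm (?w y * (\<kappa> x - \<kappa> (x - y)) - ?w y * D1 x y) = gauss \<delta> y * (indicator (cball 0 r) y * norm (\<kappa> x - \<kappa> (x - y) - D1 x y))"
      by (simp only: right_diff_distrib[symmetric] norm_mult norm_of_real) (simp add: abs_mult)
    also have "\<dots> \<le> gauss \<delta> y * (M / 2 * (norm y)\<^sup>2)"
      using taylor[of y] M by (intro mult_left_mono) (auto simp: indicator_def)
    finally show "norm (?w y * (\<kappa> x - \<kappa> (x - y)) - ?w y * D1 x y) \<le> M / 2 * (gauss \<delta> y * (norm y)\<^sup>2)"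
      by (simp add: mult_ac)
  qed
  also have "\<dots> = M / 2 * (real CARD('n) * \<delta>\<^sup>2)"
    by (simp only: integral_mult_right_zero integral_gauss_norm_squared[OF \<delta>])
  also have "\<dots> = real CARD('n) * K / (2 * s ^ (CARD('n) + 1)) * (\<delta>\<^sup>2 / norm x ^ (CARD('n) + 1))"
    by (simp only: M_def \<rho>_def power_mult_distrib) (simp add: field_simps)
  finally show ?thesis
    by (simp add: s_def)
qed

text \<open>With u = |x|^2 / (2 d \<delta>^2), the incomplete Gamma bound leaves powers of |x| /
  \<delta> in front of exp (- u). The decay of the kernel at x, with \<delta> \<le> |x| and \<delta>
  < 1/2, absorbs them into \<delta>^(- d).\<close>

lemma norm_kernel_tail_le:
  fixes x :: "real^'n"
  assumes d: "CARD('n) \<ge> 2" and \<delta>: "0 < \<delta>" "\<delta> < 1/2" and x: "x \<in> cell" "norm x \<ge> \<delta>"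
    and C: "upper_Gamma_const (real CARD('n) / 2) C"
  defines "r \<equiv> norm x / sqrt (real CARD('n))"
  shows "norm (\<kappa> x) * (LINT y|lborel. gauss \<delta> (y :: real^'n) * indicator {y. norm y > r} y)
    \<le> K * C / Gamma (real CARD('n) / 2) * (1 / 2 powr (real CARD('n) / 2) + real CARD('n))
      * (exp (- (1 / (2 * real CARD('n))) * ((norm x)\<^sup>2 / \<delta>\<^sup>2)) / \<delta> ^ CARD('n))"
proof -
  define n where "n = real CARD('n)"
  define b where "b = n / 2"
  define u where "u = r\<^sup>2 / (2 * \<delta>\<^sup>2)"
  define X where "X = norm x"
  have n: "n \<ge> 2"
    using d by (simp add: n_def)
  have X: "X > 0" "X \<ge> \<delta>"
    using x \<delta> by (auto simp: X_def)
  have u_eq: "u = X\<^sup>2 / (2 * n * \<delta>\<^sup>2)"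
    using n by (simp add: u_def r_def X_def n_def power_divide)
  have u: "u > 0"
    unfolding u_eq using X n \<delta> by simp
  have G: "Gamma b > 0"
    using n by (intro Gamma_real_pos) (simp add: b_def)
  have U: "upper_Gamma b u \<ge> 0"
    unfolding upper_Gamma_def set_lebesgue_integral_def by (intro integral_nonneg_AE) auto
  have UC: "upper_Gamma b u \<le> C * (u powr (b - 1) + u powr (- 1)) * exp (- u)"
    using C u by (auto simp: upper_Gamma_const_def b_def n_def)
  have C0: "C \<ge> 0"
    by (rule upper_Gamma_const_nonneg[OF C])
  have pow: "(u powr (b - 1) + u powr (- 1)) / X ^ (CARD('n) - 1) \<le> (1 / 2 powr b + n) / \<delta> ^ CARD('n)"
  proof -
    obtain m where m: "CARD('n) = Suc (Suc m)"
      using d by (metis Suc_le_D Suc_1 add_2_eq_Suc le_Suc_ex)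
    have nm: "n = real m + 2"
      by (simp add: n_def m)
    have 1: "u powr (b - 1) / X ^ (CARD('n) - 1) \<le> 1 / 2 powr b / \<delta> ^ CARD('n)"
    proof -
      have "u powr (b - 1) = ((X / \<delta>)\<^sup>2 / (2 * n)) powr (real m / 2)"
        using \<delta> by (simp add: u_eq b_def nm power_divide field_simps)
      also have "\<dots> = ((X / \<delta>)\<^sup>2) powr (real m / 2) / (2 * n) powr (real m / 2)"
        by (rule powr_divide)
      also have "((X / \<delta>)\<^sup>2) powr (real m / 2) = (X / \<delta>) ^ m"
      proof -
        have "((X / \<delta>)\<^sup>2) powr (real m / 2) = ((X / \<delta>) powr 2) powr (real m / 2)"
          using X \<delta> by (simp add: powr_numeral)
        also have "\<dots> = (X / \<delta>) powr real m"
          unfolding powr_powr by simp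
        also have "\<dots> = (X / \<delta>) ^ m"
          using X \<delta> by (intro powr_realpow) auto
        finally show ?thesis .
      qed
      also have "(X / \<delta>) ^ m / (2 * n) powr (real m / 2) \<le> (X / \<delta>) ^ m / 2 powr (real m / 2)"
        using X \<delta> n by (intro divide_left_mono powr_mono2) auto
      finally have "u powr (b - 1) / X ^ (CARD('n) - 1) \<le> (X / \<delta>) ^ m / 2 powr (real m / 2) / X ^ (CARD('n) - 1)"
        using X by (intro divide_right_mono) auto
      also have "\<dots> = 1 / 2 powr (real m / 2) * (1 / (\<delta> ^ m * X))"
        using X by (simp add: m power_divide field_simps)
      \<comment> \<open>From \<delta> < 1/2 and \<delta> \<le> |x| follows 2 \<delta>^2 \<le> |x|.
        The factor 2 gained here completes 2 powr (m / 2) to 2 powr b, as b = m / 2 + 1.\<close>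
      also have "\<dots> \<le> 1 / 2 powr (real m / 2) * (1 / (\<delta> ^ m * (2 * \<delta> * \<delta>)))"
      proof -
        have "2 * \<delta> * \<delta> \<le> 1 * \<delta>"
          using \<delta> by (intro mult_right_mono) auto
        then have "2 * \<delta> * \<delta> \<le> X"
          using X by linarith
        then have "\<delta> ^ m * (2 * \<delta> * \<delta>) \<le> \<delta> ^ m * X"
          using \<delta> by (intro mult_left_mono) auto
        then show ?thesis
          using \<delta> X by (intro mult_left_mono divide_left_mono mult_pos_pos) auto
      qed
      also have "\<dots> = 1 / 2 powr b / \<delta> ^ CARD('n)"
      proof -
        have "2 powr b = 2 powr (real m / 2) * 2 powr 1"
          unfolding powr_add[symmetric] b_def nm by (simp add: add_divide_distrib)
        then show ?thesis
          by (simp add: m field_simps)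
      qed
      finally show ?thesis .
    qed
    have 2: "u powr (- 1) / X ^ (CARD('n) - 1) \<le> n / \<delta> ^ CARD('n)"
    proof -
      have "u powr (- 1) = inverse u"
        using u by (simp add: powr_minus)
      also have "\<dots> = 2 * n * \<delta>\<^sup>2 / X\<^sup>2"
        by (simp add: u_eq)
      finally have "u powr (- 1) / X ^ (CARD('n) - 1) = 2 * n * \<delta>\<^sup>2 / X ^ (m + 3)"
        by (simp add: m power_add power2_eq_square power3_eq_cube field_simps)
      also have "\<dots> \<le> 2 * n * \<delta>\<^sup>2 / \<delta> ^ (m + 3)"
        using X \<delta> n by (intro divide_left_mono power_mono mult_pos_pos zero_less_power) auto
      also have "\<dots> = (2 * \<delta>) * n / \<delta> ^ CARD('n)"
        using \<delta> by (simp add: m power_add power2_eq_square power3_eq_cube field_simps)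
      \<comment> \<open>Here 2 \<delta> \<le> 1 removes the remaining factor.\<close>
      also have "\<dots> \<le> 1 * n / \<delta> ^ CARD('n)"
        using \<delta> n by (intro divide_right_mono mult_right_mono) auto
      finally show ?thesis
        by simp
    qed
    show ?thesis
      using 1 2 by (simp add: add_divide_distrib)
  qed
  have "(LINT y|lborel. gauss \<delta> (y :: real^'n) * indicator {y. norm y > r} y) \<le> upper_Gamma b u / Gamma b"
    unfolding b_def u_def n_def by (rule integral_gauss_tail_le) (use \<delta> in \<open>auto simp: r_def\<close>)
  also have "\<dots> \<le> C * (u powr (b - 1) + u powr (- 1)) * exp (- u) / Gamma b"
    using UC G by (intro divide_right_mono) auto
  finally have "norm (\<kappa> x) * (LINT y|lborel. gauss \<delta> (y :: real^'n) * indicator {y. norm y > r} y)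
      \<le> K / X ^ (CARD('n) - 1) * (C * (u powr (b - 1) + u powr (- 1)) * exp (- u) / Gamma b)"
  proof (rule mult_mono[rotated])
    show "norm (\<kappa> x) \<le> K / X ^ (CARD('n) - 1)"
      unfolding X_def using x \<delta> by (intro norm_kernel_le) auto
    show "0 \<le> K / X ^ (CARD('n) - 1)"
      using K_pos X by simp
    show "0 \<le> (LINT y|lborel. gauss \<delta> (y :: real^'n) * indicator {y. norm y > r} y)"
      by (rule integral_nonneg_AE) simp
  qed
  also have "\<dots> = K * C / Gamma b * ((u powr (b - 1) + u powr (- 1)) / X ^ (CARD('n) - 1)) * exp (- u)"
    by (simp add: mult_ac)
  also have "\<dots> \<le> K * C / Gamma b * ((1 / 2 powr b + n) / \<delta> ^ CARD('n)) * exp (- u)"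
    using pow K_pos C0 G by (intro mult_right_mono mult_left_mono) auto
  also have "exp (- u) = exp (- (1 / (2 * n)) * (X\<^sup>2 / \<delta>\<^sup>2))"
    by (simp add: u_eq)
  finally show ?thesis
    by (simp add: b_def n_def X_def mult_ac)
qed

text \<open>Since the Gaussian has mass 1, the short-range kernel is the Gaussian average of
  \<open>\<kappa> x - \<kappa> (x - y)\<close>. Cancellation is exploited only in the ball of radius
  r; outside, the two terms are estimated separately.\<close>

theorem norm_k_short_le:
  fixes x :: "real^'n"
  assumes d: "CARD('n) \<ge> 2" and \<delta>: "0 < \<delta>" "\<delta> < 1/2" and x: "x \<in> cell" "norm x \<ge> \<delta>"
    and C: "upper_Gamma_const (real CARD('n) / 2) C"
  shows "norm (k_short \<delta> \<kappa> x)
    \<le> real CARD('n) * K / (2 * (1 - 1 / sqrt (real CARD('n))) ^ (CARD('n) + 1)) * (\<delta>\<^sup>2 / norm x ^ (CARD('n) + 1))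
      + c_short K C \<kappa> * (exp (- (1 / (2 * real CARD('n))) * ((norm x)\<^sup>2 / \<delta>\<^sup>2)) / \<delta> ^ CARD('n))"
proof -
  define r where "r = norm x / sqrt (real CARD('n))"
  have x0: "x \<noteq> 0"
    using x \<delta> by auto
  have r0: "r \<ge> 0"
    by (simp add: r_def)
  \<comment> \<open>A point of the cell has norm at most sqrt d / 2; the lattice tail bound requires
    exactly this restriction on r.\<close>
  have r12: "r \<le> 1/2"
  proof -
    have "(norm x)\<^sup>2 = (\<Sum>i\<in>UNIV. (x $ i)\<^sup>2)"
      by (simp add: norm_vec_def L2_set_def sum_nonneg)
    also have "\<dots> \<le> (\<Sum>i\<in>(UNIV::'n set). (1/2)\<^sup>2)"
    proof (rule sum_mono)
      fix i
      have "-1/2 \<le> x $ i" "x $ i \<le> 1/2"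
        using x by (auto simp: mem_cell)
      then have "\<bar>x $ i\<bar> \<le> \<bar>1/2 :: real\<bar>"
        by linarith
      then show "(x $ i)\<^sup>2 \<le> (1/2)\<^sup>2"
        unfolding abs_le_square_iff .
    qed
    also have "\<dots> = (sqrt (real CARD('n)) / 2)\<^sup>2"
      by (simp add: power_divide)
    finally have "norm x \<le> sqrt (real CARD('n)) / 2"
      by (rule power2_le_imp_le) simp
    then show ?thesis
      by (simp add: r_def field_simps)
  qed
  let ?out = "{y :: real^'n. norm y > r}"
  let ?I = "LINT y|lborel. complex_of_real (gauss \<delta> y * indicator (cball 0 r) y) * (\<kappa> x - \<kappa> (x - y))"
  let ?T = "LINT y|lborel. gauss \<delta> (y :: real^'n) * indicator ?out y"
  let ?J = "LINT y|lborel. \<kappa> (x - y) * complex_of_real (gauss \<delta> y * indicator ?out y)"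
  have iT: "integrable lborel (\<lambda>y :: real^'n. gauss \<delta> y * indicator ?out y)"
    by (rule Bochner_Integration.integrable_bound[OF integrable_gauss[OF \<delta>(1)]]) (auto simp: indicator_def)
  have iT': "integrable lborel (\<lambda>y :: real^'n. \<kappa> x * complex_of_real (gauss \<delta> y * indicator ?out y))"
    using iT by (intro integrable_mult_right) (simp only: integrable_of_real)
  have iJ: "integrable lborel (\<lambda>y. \<kappa> (x - y) * complex_of_real (gauss \<delta> y * indicator ?out y))"
    by (rule Bochner_Integration.integrable_bound[OF integrable_k_long[OF \<delta>(1), of x]])
      (auto simp: norm_mult indicator_def)
  have ig: "integrable lborel (\<lambda>y :: real^'n. \<kappa> x * complex_of_real (gauss \<delta> y))"
    using integrable_gauss[OF \<delta>(1), where 'n = 'n] by (intro integrable_mult_right) (simp only: integrable_of_real)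
  have i0: "integrable lborel (\<lambda>y. \<kappa> x * complex_of_real (gauss \<delta> y) - \<kappa> (x - y) * complex_of_real (gauss \<delta> y))"
    by (intro Bochner_Integration.integrable_diff ig integrable_k_long \<delta>)
  have iI: "integrable lborel (\<lambda>y. complex_of_real (gauss \<delta> y * indicator (cball 0 r) y) * (\<kappa> x - \<kappa> (x - y)))"
    by (rule Bochner_Integration.integrable_bound[OF i0])
      (auto simp: indicator_def algebra_simps)
  have "k_short \<delta> \<kappa> x = (LINT y::real^'n|lborel. \<kappa> x * complex_of_real (gauss \<delta> y)) - k_long \<delta> \<kappa> x"
    by (simp add: k_short_def integral_gauss[OF \<delta>(1)])
  also have "\<dots> = (LINT y|lborel. \<kappa> x * complex_of_real (gauss \<delta> y) - \<kappa> (x - y) * complex_of_real (gauss \<delta> y))"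
    unfolding k_long_def by (rule Bochner_Integration.integral_diff[OF ig integrable_k_long[OF \<delta>(1)], symmetric])
  also have "\<dots> = (LINT y|lborel. complex_of_real (gauss \<delta> y * indicator (cball 0 r) y) * (\<kappa> x - \<kappa> (x - y))
      + (\<kappa> x * complex_of_real (gauss \<delta> y * indicator ?out y) - \<kappa> (x - y) * complex_of_real (gauss \<delta> y * indicator ?out y)))"
    by (intro Bochner_Integration.integral_cong) (auto simp: indicator_def algebra_simps)
  also have "\<dots> = ?I + (\<kappa> x * complex_of_real ?T - ?J)"
    using iI iT' iJ by (simp only: Bochner_Integration.integral_add Bochner_Integration.integral_diff
        Bochner_Integration.integrable_diff integral_mult_right_zero integral_complex_of_real)
  finally have "norm (k_short \<delta> \<kappa> x) \<le> norm ?I + (norm (\<kappa> x * complex_of_real ?T) + norm ?J)"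
    by (simp only: order_trans[OF norm_triangle_ineq add_left_mono[OF norm_triangle_ineq4]])
  also have "norm (\<kappa> x * complex_of_real ?T) = norm (\<kappa> x) * ?T"
    by (simp add: norm_mult integral_nonneg_AE)
  finally have main: "norm (k_short \<delta> \<kappa> x) \<le> norm ?I + norm (\<kappa> x) * ?T + norm ?J"
    by simp
  let ?e = "exp (- (1 / (2 * real CARD('n))) * ((norm x)\<^sup>2 / \<delta>\<^sup>2)) / \<delta> ^ CARD('n)"
  have I: "norm ?I \<le> real CARD('n) * K / (2 * (1 - 1 / sqrt (real CARD('n))) ^ (CARD('n) + 1)) * (\<delta>\<^sup>2 / norm x ^ (CARD('n) + 1))"
    unfolding r_def by (rule norm_short_inner_le[OF d \<delta>(1) x(1) x0])
  have T: "norm (\<kappa> x) * ?T \<le> K * C / Gamma (real CARD('n) / 2) * (1 / 2 powr (real CARD('n) / 2) + real CARD('n)) * ?e"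
    unfolding r_def by (rule norm_kernel_tail_le[OF d \<delta> x C])
  have J: "norm ?J \<le> L1_cell \<kappa> / (2 * pi) powr (real CARD('n) / 2) * (1 + 2 ^ CARD('n) * real CARD('n) / (1 - exp (- 1/2)) ^ CARD('n)) * ?e"
  proof -
    have "(2 * pi * \<delta>\<^sup>2) powr (real CARD('n) / 2) = (2 * pi) powr (real CARD('n) / 2) * (\<delta> powr 2) powr (real CARD('n) / 2)"
      using \<delta> by (simp add: powr_mult powr_numeral)
    also have "(\<delta> powr 2) powr (real CARD('n) / 2) = \<delta> ^ CARD('n)"
      using \<delta> unfolding powr_powr by (simp add: powr_realpow)
    finally have p: "(2 * pi * \<delta>\<^sup>2) powr (real CARD('n) / 2) = (2 * pi) powr (real CARD('n) / 2) * \<delta> ^ CARD('n)" .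
    have e: "- (r\<^sup>2 / (2 * \<delta>\<^sup>2)) = - (1 / (2 * real CARD('n))) * ((norm x)\<^sup>2 / \<delta>\<^sup>2)"
      by (simp add: r_def power_divide)
    show ?thesis
      using norm_long_tail_le[OF \<delta> r0 r12, of x] unfolding p e by (simp add: power_divide mult_ac)
  qed
  have "c_short K C \<kappa> * ?e = L1_cell \<kappa> / (2 * pi) powr (real CARD('n) / 2) * (1 + 2 ^ CARD('n) * real CARD('n) / (1 - exp (- 1/2)) ^ CARD('n)) * ?e
      + K * C / Gamma (real CARD('n) / 2) * (1 / 2 powr (real CARD('n) / 2) + real CARD('n)) * ?e"
    unfolding c_short_def Let_def by (rule distrib_right)
  then show ?thesis
    using main I T J by linarith
qed

end

section \<open>Surface measure of Lipschitz hypersurfaces\<close>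

text \<open>Padding by empty sets makes the cover a sequence; as k \<ge> 1 they have weight
  0.\<close>

lemma hausdorff_pre_finite_cover:
  assumes I: "finite I" and cover: "A \<subseteq> (\<Union>i\<in>I. B i)" and k: "k \<ge> 1"
    and B: "\<And>i. i \<in> I \<Longrightarrow> bounded (B i)" "\<And>i. i \<in> I \<Longrightarrow> diameter (B i) \<le> D" and D: "0 \<le> D" "D \<le> \<eta>"
  shows "hausdorff_pre k \<eta> A \<le> ennreal (real (card I) * (unit_ball_vol (real k) * (D / 2) ^ k))"
proof -
  obtain h where h: "bij_betw h {0..<card I} I"
    using ex_bij_betw_nat_finite[OF I] by blast
  define C where "C m = (if m < card I then B (h m) else {})" for m
  have hI: "h m \<in> I" if "m < card I" for m
    using h that by (auto simp: bij_betw_def)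
  let ?w = "\<lambda>m. ennreal (unit_ball_vol (real k) * (diameter (C m) / 2) ^ k)"
  have "A \<subseteq> (\<Union>m. C m)"
  proof
    fix x assume "x \<in> A"
    then obtain i where i: "i \<in> I" "x \<in> B i"
      using cover by blast
    then obtain m where "m < card I" "h m = i"
      using h by (auto simp: bij_betw_def image_iff) (metis atLeastLessThan_iff imageE)
    then show "x \<in> (\<Union>m. C m)"
      using i by (auto simp: C_def intro!: exI[of _ m])
  qed
  moreover have "bounded (C m) \<and> diameter (C m) \<le> \<eta>" for m
    using B hI D by (auto simp: C_def intro: order_trans)
  ultimately have "hausdorff_pre k \<eta> A \<le> (\<Sum>m. ?w m)"
    unfolding hausdorff_pre_def by (intro INF_lower) auto
  also have "\<dots> = (\<Sum>m<card I. ?w m)"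
    using k by (intro suminf_finite) (auto simp: C_def power_0_left)
  also have "\<dots> \<le> (\<Sum>m<card I. ennreal (unit_ball_vol (real k) * (D / 2) ^ k))"
  proof (rule sum_mono)
    fix m assume "m \<in> {..<card I}"
    then have "bounded (C m)" "diameter (C m) \<le> D"
      using B hI by (auto simp: C_def)
    then show "?w m \<le> ennreal (unit_ball_vol (real k) * (D / 2) ^ k)"
      by (intro ennreal_leI mult_left_mono power_mono divide_right_mono) (auto simp: diameter_ge_0)
  qed
  also have "\<dots> = ennreal (real (card I) * (unit_ball_vol (real k) * (D / 2) ^ k))"
    using D by (simp add: ennreal_mult ennreal_of_nat_eq_real_of_nat)
  finally show ?thesis .
qed

lemma tangential_diff: "tangential a u - tangential a v = tangential a (u - v)"
  by (simp add: tangential_def algebra_simps)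

lemma tangential_inner: "norm a = 1 \<Longrightarrow> tangential a z \<bullet> a = 0"
  by (simp add: tangential_def inner_diff_left dot_square_norm)

lemma norm_tangential_le:
  assumes "norm a = 1"
  shows "norm (tangential a z) \<le> norm z"
proof -
  have "(norm z)\<^sup>2 = (norm (tangential a z + (z \<bullet> a) *\<^sub>R a))\<^sup>2"
    by (simp add: tangential_def)
  also have "\<dots> = (norm (tangential a z))\<^sup>2 + (z \<bullet> a)\<^sup>2"
    using norm_add_Pythagorean[of "tangential a z" "(z \<bullet> a) *\<^sub>R a"] tangential_inner[OF assms, of z] assms
    by (simp add: orthogonal_def power_mult_distrib)
  finally have "(norm (tangential a z))\<^sup>2 \<le> (norm z)\<^sup>2"
    by simp
  then show ?thesis
    by (rule power2_le_imp_le) simp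
qed

text \<open>The l1 norm of the unit vector a is at least 1, so some |a $ i0| is at least 1 / d.
  Orthogonality then expresses the coordinate i0 of z through the others. The index depends on a
  alone, so it serves all z.\<close>

lemma norm_le_of_orthogonal:
  fixes a z :: "real^'n"
  assumes a: "norm a = 1"
  obtains i0 where "\<And>z \<eta>. z \<bullet> a = 0 \<Longrightarrow> \<eta> \<ge> 0 \<Longrightarrow> (\<And>j. j \<noteq> i0 \<Longrightarrow> \<bar>z $ j\<bar> \<le> \<eta>) \<Longrightarrow> norm z \<le> 2 * (real CARD('n))\<^sup>2 * \<eta>"
proof -
  let ?n = "real CARD('n)"
  have n: "?n \<ge> 1"
    by simp
  have "\<exists>i. \<bar>a $ i\<bar> \<ge> 1 / ?n"
  proof (rule ccontr)
    assume "\<not> ?thesis"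
    then have "(\<Sum>i\<in>UNIV. \<bar>a $ i\<bar>) < (\<Sum>i\<in>(UNIV::'n set). 1 / ?n)"
      by (intro sum_strict_mono) (auto simp: not_le)
    with norm_le_l1_cart[of a] a show False
      by simp
  qed
  then obtain i0 where i0: "\<bar>a $ i0\<bar> \<ge> 1 / ?n"
    by blast
  show ?thesis
  proof (rule that[of i0])
    fix z :: "real^'n" and \<eta> :: real
    assume z: "z \<bullet> a = 0" "\<eta> \<ge> 0" "\<And>j. j \<noteq> i0 \<Longrightarrow> \<bar>z $ j\<bar> \<le> \<eta>"
    have aj: "\<bar>a $ j\<bar> \<le> 1" for j
      using component_le_norm_cart[of a j] a by simp
    have "z $ i0 * a $ i0 = - (\<Sum>j\<in>UNIV - {i0}. z $ j * a $ j)"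
      using z(1) sum.remove[of UNIV i0 "\<lambda>j. z $ j * a $ j"] by (simp add: inner_vec_def)
    then have "\<bar>z $ i0\<bar> * \<bar>a $ i0\<bar> \<le> (\<Sum>j\<in>UNIV - {i0}. \<bar>z $ j\<bar> * \<bar>a $ j\<bar>)"
      by (metis (no_types, lifting) abs_minus_cancel abs_mult sum.cong sum_abs)
    also have "\<dots> \<le> (\<Sum>j\<in>UNIV - {i0}. \<eta> * 1)"
      using z aj by (intro sum_mono mult_mono) auto
    also have "\<dots> \<le> ?n * \<eta>"
      using z(2) by (auto simp: card_Diff_singleton intro!: mult_right_mono)
    finally have 1: "\<bar>z $ i0\<bar> * \<bar>a $ i0\<bar> \<le> ?n * \<eta>" .
    have "\<bar>z $ i0\<bar> * (1 / ?n) \<le> \<bar>z $ i0\<bar> * \<bar>a $ i0\<bar>"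
      using i0 by (intro mult_left_mono) auto
    then have "\<bar>z $ i0\<bar> * (1 / ?n) \<le> ?n * \<eta>"
      using 1 by linarith
    then have zi0: "\<bar>z $ i0\<bar> \<le> ?n\<^sup>2 * \<eta>"
      by (simp add: field_simps power2_eq_square)
    have "norm z \<le> (\<Sum>j\<in>UNIV. \<bar>z $ j\<bar>)"
      by (rule norm_le_l1_cart)
    also have "\<dots> = \<bar>z $ i0\<bar> + (\<Sum>j\<in>UNIV - {i0}. \<bar>z $ j\<bar>)"
      by (rule sum.remove) auto
    also have "(\<Sum>j\<in>UNIV - {i0}. \<bar>z $ j\<bar>) \<le> (\<Sum>j\<in>UNIV - {i0}. \<eta>)"
      using z by (intro sum_mono) auto
    also have "\<dots> \<le> ?n * \<eta>"
      using z(2) by (auto simp: card_Diff_singleton intro!: mult_right_mono)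
    also have "\<dots> \<le> ?n\<^sup>2 * \<eta>"
      using z(2) n by (intro mult_right_mono) (auto simp: power2_eq_square)
    finally show "norm z \<le> 2 * ?n\<^sup>2 * \<eta>"
      using zi0 by linarith
  qed
qed

text \<open>
  The coordinates of the tangential projection other than the one in which the axis \<open>a\<close> is largest
  control the projection, so a grid in these \<open>d - 1\<close> coordinates gives economical coverings of a
  Lipschitz graph.
\<close>

lemma hausdorff_outer_graph_le:
  fixes A :: "(real^'n) set"
  assumes n: "CARD('n) \<ge> 2" and a: "norm a = 1" and D: "D > 0" and L: "L \<ge> 0"
    and diam: "\<And>y y'. y \<in> A \<Longrightarrow> y' \<in> A \<Longrightarrow> norm (y - y') \<le> D"
    and graph: "\<And>y y'. y \<in> A \<Longrightarrow> y' \<in> A \<Longrightarrow> norm (y - y') \<le> (1 + L) * norm (tangential a (y - y'))"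
  shows "hausdorff_outer (CARD('n) - 1) A
    \<le> ennreal (unit_ball_vol (real (CARD('n) - 1)) * (4 * (real CARD('n))\<^sup>2 * (1 + L) * D) ^ (CARD('n) - 1))"
proof (cases "A = {}")
  case True
  then show ?thesis
    using n by (simp add: hausdorff_outer_empty)
next
  case False
  then obtain y0 where y0: "y0 \<in> A"
    by blast
  define k where "k = CARD('n) - 1"
  have k: "k \<ge> 1"
    using n by (simp add: k_def)
  \<comment> \<open>Points in one grid cell differ by at most 2 D / N in the controlled coordinates.
    Orthogonality costs 2 d^2 and the graph 1 + L, which gives diameter at most K D / N.\<close>
  define K where "K = 4 * (real CARD('n))\<^sup>2 * (1 + L)"
  have K: "K > 0"
    using L by (auto simp: K_def intro!: mult_pos_pos)
  obtain i0 where i0: "\<And>z \<eta>. z \<bullet> a = 0 \<Longrightarrow> \<eta> \<ge> 0 \<Longrightarrow> (\<And>j. j \<noteq> i0 \<Longrightarrow> \<bar>z $ j\<bar> \<le> \<eta>) \<Longrightarrow> norm z \<le> 2 * (real CARD('n))\<^sup>2 * \<eta>"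
    using norm_le_of_orthogonal[OF a] by blast
  define c where "c y j = tangential a (y - y0) $ j" for y j
  have c_bound: "\<bar>c y j\<bar> \<le> D" if "y \<in> A" for y j
    using component_le_norm_cart[of "tangential a (y - y0)" j] norm_tangential_le[OF a, of "y - y0"] diam[OF that y0]
    by (simp add: c_def)
  have c_diff: "c y j - c y' j = tangential a (y - y') $ j" for y y' j
    unfolding c_def by (simp add: tangential_diff flip: vector_minus_component)
  have "hausdorff_pre k \<eta> A \<le> ennreal (unit_ball_vol (real k) * (K * D) ^ k)" if \<eta>: "\<eta> > 0" for \<eta>
  proof -
    obtain N0 :: nat where N0: "K * D / \<eta> < real N0"
      using reals_Archimedean2 by blast
    define N where "N = Suc N0"
    have N: "N \<ge> 1" "K * D / real N \<le> \<eta>"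
    proof -
      have "K * D / \<eta> \<le> real N"
        using N0 by (simp add: N_def)
      then show "K * D / real N \<le> \<eta>"
        using \<eta> by (simp add: N_def field_simps)
    qed (simp add: N_def)
    \<comment> \<open>Index of the grid cell of width 2 D / N in [- D, D]. The right endpoint gets
      index N, whence N + 1 values for each coordinate.\<close>
    define m where "m y j = nat \<lfloor>(c y j + D) * real N / (2 * D)\<rfloor>" for y j
    define I where "I = PiE (UNIV - {i0}) (\<lambda>_. {0..N})"
    define B where "B g = {y \<in> A. \<forall>j\<in>UNIV - {i0}. m y j = g j}" for g
    have mN: "m y j \<le> N" if "y \<in> A" for y j
    proof -
      have "(c y j + D) * real N / (2 * D) \<le> 2 * D * real N / (2 * D)"
        using c_bound[OF that, of j] D by (intro divide_right_mono mult_right_mono) auto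
      then have "\<lfloor>(c y j + D) * real N / (2 * D)\<rfloor> \<le> int N"
        using D by (simp add: floor_le_iff)
      then show ?thesis
        by (simp add: m_def)
    qed
    have close: "norm (y - y') \<le> K * D / real N" if "y \<in> B g" "y' \<in> B g" for y y' g
    proof -
      have A: "y \<in> A" "y' \<in> A"
        using that by (auto simp: B_def)
      have "\<bar>tangential a (y - y') $ j\<bar> \<le> 2 * D / real N" if j: "j \<noteq> i0" for j
      proof -
        let ?s = "\<lambda>y. (c y j + D) * real N / (2 * D)"
        have pos: "?s y \<ge> 0" "?s y' \<ge> 0"
          using c_bound[OF A(1), of j] c_bound[OF A(2), of j] D by auto
        have "m y j = m y' j"
          using that \<open>y \<in> B g\<close> \<open>y' \<in> B g\<close> by (simp add: B_def)
        then have "\<lfloor>?s y\<rfloor> = \<lfloor>?s y'\<rfloor>"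
          using pos unfolding m_def by (metis eq_nat_nat_iff zero_le_floor)
        then have "\<bar>?s y - ?s y'\<bar> \<le> 1"
          by linarith
        moreover have "?s y - ?s y' = (c y j - c y' j) * (real N / (2 * D))"
          unfolding diff_divide_distrib[symmetric] by (simp add: algebra_simps)
        ultimately have "\<bar>c y j - c y' j\<bar> * (real N / (2 * D)) \<le> 1"
          using D by (simp add: abs_mult)
        then show ?thesis
          using D N unfolding c_diff by (simp add: field_simps)
      qed
      then have "norm (tangential a (y - y')) \<le> 2 * (real CARD('n))\<^sup>2 * (2 * D / real N)"
        using D by (intro i0 tangential_inner a) auto
      then have "(1 + L) * norm (tangential a (y - y')) \<le> (1 + L) * (2 * (real CARD('n))\<^sup>2 * (2 * D / real N))"
        using L by (intro mult_left_mono) auto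
      then show ?thesis
        using graph[OF A] by (simp add: K_def mult_ac)
    qed
    have "hausdorff_pre k \<eta> A \<le> ennreal (real (card I) * (unit_ball_vol (real k) * (K * D / real N / 2) ^ k))"
    proof (rule hausdorff_pre_finite_cover[of I A B])
      show "finite I"
        unfolding I_def by (intro finite_PiE) auto
      show "A \<subseteq> (\<Union>g\<in>I. B g)"
      proof
        fix y assume y: "y \<in> A"
        have "restrict (m y) (UNIV - {i0}) \<in> I"
          using mN[OF y] by (auto simp: I_def)
        moreover have "y \<in> B (restrict (m y) (UNIV - {i0}))"
          using y by (auto simp: B_def)
        ultimately show "y \<in> (\<Union>g\<in>I. B g)"
          by blast
      qed
      show "bounded (B g)" for g
        using diam y0 by (intro boundedI[of _ "D + norm y0"])
          (smt (verit, best) B_def mem_Collect_eq norm_triangle_sub)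
      show "diameter (B g) \<le> K * D / real N" for g
        using close[of _ g] K D by (intro diameter_le) auto
    qed (use k N K D in auto)
    also have "\<dots> \<le> ennreal (unit_ball_vol (real k) * (K * D) ^ k)"
    proof (rule ennreal_leI)
      \<comment> \<open>The number of cells grows like N^k while each weight shrinks like N^(- k).
        As (N + 1) / (2 N) \<le> 1, the total is bounded independently of the mesh and of
        \<eta>.\<close>
      have "card I = (N + 1) ^ k"
        unfolding I_def by (subst card_PiE) (auto simp: k_def card_Diff_singleton)
      then have "real (card I) = (real N + 1) ^ k"
        by (simp add: add.commute)
      then have "real (card I) * (unit_ball_vol (real k) * (K * D / real N / 2) ^ k)
          = unit_ball_vol (real k) * ((real N + 1) * (K * D / real N / 2)) ^ k"
        by (simp only: power_mult_distrib mult_ac)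
      also have "\<dots> \<le> unit_ball_vol (real k) * (K * D) ^ k"
      proof (intro mult_left_mono power_mono)
        have "K * D * (real N + 1) \<le> K * D * (2 * real N)"
          using N K D by (intro mult_left_mono) auto
        then show "(real N + 1) * (K * D / real N / 2) \<le> K * D"
          using N by (simp add: field_simps)
      qed (use K D in auto)
      finally show "real (card I) * (unit_ball_vol (real k) * (K * D / real N / 2) ^ k) \<le> unit_ball_vol (real k) * (K * D) ^ k" .
    qed
    finally show ?thesis .
  qed
  then show ?thesis
    unfolding hausdorff_outer_def k_def[symmetric] K_def[symmetric] by (intro SUP_least) auto
qed

lemma hausdorff_outer_UN_le:
  assumes "k \<ge> 1" "finite F"
  shows "hausdorff_outer k (\<Union>c\<in>F. B c) \<le> (\<Sum>c\<in>F. hausdorff_outer k (B c))"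
  using assms(2)
proof (induction F rule: finite_induct)
  case (insert c F)
  have "hausdorff_outer k (\<Union>c\<in>insert c F. B c) \<le> hausdorff_outer k (B c) + hausdorff_outer k (\<Union>c\<in>F. B c)"
    using hausdorff_outer_Un[OF assms(1), of "B c" "\<Union>c\<in>F. B c"] by simp
  also have "\<dots> \<le> hausdorff_outer k (B c) + (\<Sum>c\<in>F. hausdorff_outer k (B c))"
    by (intro add_left_mono insert.IH)
  finally show ?case
    using insert by simp
qed (simp add: hausdorff_outer_empty[OF assms(1)])

text \<open>The constant of upper Ahlfors regularity: at most L charts, each contributing the graph
  bound for a set of diameter 2 r, which turns the factor 4 there into 8.\<close>

definition ahlfors_const :: "nat \<Rightarrow> real \<Rightarrow> real" where
  "ahlfors_const n L = L * (unit_ball_vol (real (n - 1)) * (8 * (real n)\<^sup>2 * (1 + L)) ^ (n - 1))"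

lemma lipschitz_chart_graph_le:
  assumes c: "lipschitz_chart L S c" and y: "y \<in> S \<inter> cylinder c" "y' \<in> S \<inter> cylinder c"
  shows "norm (y - y') \<le> (1 + L) * norm (tangential (axis_dir c) (y - y'))"
proof -
  let ?a = "axis_dir c"
  let ?t = "\<lambda>y. tangential ?a (y - ctr c)"
  have a: "norm ?a = 1"
    using c by (simp add: lipschitz_chart_def)
  have lip: "L-lipschitz_on {z. z \<bullet> ?a = 0 \<and> norm z < rad c} (graph_fun c)"
    using c by (simp add: lipschitz_chart_def)
  have g: "(y - ctr c) \<bullet> ?a = graph_fun c (?t y)" "(y' - ctr c) \<bullet> ?a = graph_fun c (?t y')"
    "?t y \<in> {z. z \<bullet> ?a = 0 \<and> norm z < rad c}" "?t y' \<in> {z. z \<bullet> ?a = 0 \<and> norm z < rad c}"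
    using c y tangential_inner[OF a] by (auto simp: lipschitz_chart_def cylinder_def)
  have t: "?t y - ?t y' = tangential ?a (y - y')"
    by (simp add: tangential_diff)
  have "(y - y') \<bullet> ?a = graph_fun c (?t y) - graph_fun c (?t y')"
    using g(1,2) by (simp add: inner_diff_left)
  then have "\<bar>(y - y') \<bullet> ?a\<bar> \<le> L * norm (tangential ?a (y - y'))"
    using lipschitz_onD[OF lip g(3,4)] by (simp add: dist_real_def dist_norm t)
  moreover have "norm (y - y') \<le> norm (tangential ?a (y - y')) + norm (((y - y') \<bullet> ?a) *\<^sub>R ?a)"
    using norm_triangle_ineq[of "tangential ?a (y - y')" "((y - y') \<bullet> ?a) *\<^sub>R ?a"] by (simp add: tangential_def)
  moreover have "norm (((y - y') \<bullet> ?a) *\<^sub>R ?a) = \<bar>(y - y') \<bullet> ?a\<bar>"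
    using a by simp
  ultimately show ?thesis
    unfolding distrib_right by linarith
qed

text \<open>The ball is cut by the cylinders and each piece is a Lipschitz graph of diameter at most
  2 r. Thus r need not be small compared with the cylinders, and the centre need not lie on
  S.\<close>

lemma hausdorff_outer_ball_le:
  fixes S :: "(real^'n) set"
  assumes n: "CARD('n) \<ge> 2" and atlas: "lipschitz_atlas L S \<A>" and r: "r > 0"
  shows "hausdorff_outer (CARD('n) - 1) (S \<inter> cball x r) \<le> ennreal (ahlfors_const CARD('n) L * r ^ (CARD('n) - 1))"
proof -
  let ?k = "CARD('n) - 1"
  have fin: "finite \<A>" and card: "real (card \<A>) \<le> L" and cov: "S \<subseteq> (\<Union>c\<in>\<A>. cylinder c)"
    and ch: "\<And>c. c \<in> \<A> \<Longrightarrow> lipschitz_chart L S c"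
    using atlas by (auto simp: lipschitz_atlas_def)
  have L: "L \<ge> 0"
    using card order_trans[of 0 "real (card \<A>)" L] by simp
  let ?B = "\<lambda>c. S \<inter> cylinder c \<inter> cball x r"
  let ?C = "unit_ball_vol (real ?k) * (4 * (real CARD('n))\<^sup>2 * (1 + L) * (2 * r)) ^ ?k"
  have C: "?C \<ge> 0"
    using L r by auto
  have "hausdorff_outer ?k (S \<inter> cball x r) \<le> hausdorff_outer ?k (\<Union>c\<in>\<A>. ?B c)"
    using cov by (intro hausdorff_outer_mono) auto
  also have "\<dots> \<le> (\<Sum>c\<in>\<A>. hausdorff_outer ?k (?B c))"
    using n by (intro hausdorff_outer_UN_le fin) auto
  also have "\<dots> \<le> (\<Sum>c\<in>\<A>. ennreal ?C)"
  proof (rule sum_mono)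
    fix c assume c: "c \<in> \<A>"
    show "hausdorff_outer ?k (?B c) \<le> ennreal ?C"
    proof (rule hausdorff_outer_graph_le[OF n, of "axis_dir c"])
      show "norm (axis_dir c) = 1"
        using ch[OF c] by (simp add: lipschitz_chart_def)
      fix y y' assume y: "y \<in> ?B c" "y' \<in> ?B c"
      then show "norm (y - y') \<le> 2 * r"
        using dist_triangle2[of y y' x] by (auto simp: dist_norm[symmetric] dist_commute)
      show "norm (y - y') \<le> (1 + L) * norm (tangential (axis_dir c) (y - y'))"
        using y by (intro lipschitz_chart_graph_le[OF ch[OF c]]) auto
    qed (use r L in auto)
  qed
  also have "\<dots> = ennreal (real (card \<A>) * ?C)"
    using C by (simp add: ennreal_mult ennreal_of_nat_eq_real_of_nat)
  also have "\<dots> \<le> ennreal (L * ?C)"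
    by (intro ennreal_leI mult_right_mono card C)
  also have "L * ?C = ahlfors_const CARD('n) L * r ^ ?k"
    by (simp add: ahlfors_const_def power_mult_distrib[symmetric] mult_ac)
  finally show ?thesis .
qed

section \<open>Growth of balls and integrals of negative powers on the surface\<close>

locale lipschitz_surface =
  fixes S :: "(real^'n) set" and \<A> :: "'n graph_chart set" and L :: real
  assumes atlas: "lipschitz_atlas L S \<A>" and dim: "CARD('n) \<ge> 2"
begin

lemma compact_S: "compact S"
  using atlas by (simp add: lipschitz_atlas_def)

lemma borel_S [measurable]: "S \<in> sets borel"
  using compact_S by (simp add: borel_compact)

lemma space_surface [simp]: "space (surface_measure S) = S"
  by (simp add: surface_measure_def space_restrict_space)

lemma sets_surface [measurable_cong]: "sets (surface_measure S) = sets (restrict_space borel S)"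
  by (simp add: surface_measure_def sets_restrict_space)

lemma measurable_surface: "f \<in> borel_measurable borel \<Longrightarrow> f \<in> borel_measurable (surface_measure S)"
  unfolding surface_measure_def by (intro measurable_restrict_space1) simp

lemma measurable_indicator_scaleR:
  fixes h :: "real^'n \<Rightarrow> complex"
  assumes "B \<in> sets borel" "h \<in> borel_measurable (surface_measure S)"
  shows "(\<lambda>y. indicator B y *\<^sub>R h y) \<in> borel_measurable (surface_measure S)"
  by (rule borel_measurable_scaleR[OF measurable_surface[OF borel_measurable_indicator[OF assms(1)]] assms(2)])

lemma borel_Int_surface: "B \<in> sets borel \<Longrightarrow> S \<inter> B \<in> sets (surface_measure S)"
  by (auto simp: sets_surface sets_restrict_space)

lemma measurable_surface_continuous:
  fixes f :: "real^'n \<Rightarrow> 'b::topological_space"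
  shows "continuous_on S f \<Longrightarrow> f \<in> borel_measurable (surface_measure S)"
  using borel_measurable_continuous_on_restrict[of S f] measurable_cong_sets[OF sets_surface refl] by blast

lemma ahlfors_const_nonneg: "0 \<le> ahlfors_const CARD('n) L"
proof -
  have "L \<ge> 0"
    using atlas order_trans[of 0 "real (card \<A>)" L] by (simp add: lipschitz_atlas_def)
  then show ?thesis
    by (auto simp: ahlfors_const_def intro!: mult_nonneg_nonneg)
qed

lemma emeasure_surface_ball_le:
  assumes "r > 0"
  shows "emeasure (surface_measure S) (S \<inter> cball x r) \<le> ennreal (ahlfors_const CARD('n) L * r ^ (CARD('n) - 1))"
proof -
  have "emeasure (surface_measure S) (S \<inter> cball x r) = emeasure (hausdorff_measure (CARD('n) - 1)) (S \<inter> cball x r)"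
    unfolding surface_measure_def by (rule emeasure_restrict_space) auto
  also have "\<dots> = hausdorff_outer (CARD('n) - 1) (S \<inter> cball x r)"
    using dim by (intro emeasure_hausdorff_measure) auto
  also have "\<dots> \<le> ennreal (ahlfors_const CARD('n) L * r ^ (CARD('n) - 1))"
    by (rule hausdorff_outer_ball_le[OF dim atlas assms])
  finally show ?thesis .
qed

lemma finite_measure_surface: "finite_measure (surface_measure S)"
proof (rule finite_measureI)
  obtain R where R: "R > 0" "S \<subseteq> cball 0 R"
    using compact_imp_bounded[OF compact_S] unfolding bounded_pos by (meson mem_cball_0 subsetI)
  then have "emeasure (surface_measure S) (space (surface_measure S)) = emeasure (surface_measure S) (S \<inter> cball 0 R)"
    by (simp add: Int_absorb2)
  also have "\<dots> < \<infinity>"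
    using emeasure_surface_ball_le[OF R(1), of 0] by (simp add: order_le_less_trans)
  finally show "emeasure (surface_measure S) (space (surface_measure S)) \<noteq> \<infinity>"
    by simp
qed

sublocale surface: finite_measure "surface_measure S"
  by (rule finite_measure_surface)

lemma nn_integral_far_le:
  assumes \<epsilon>: "\<epsilon> > 0"
  shows "(\<integral>\<^sup>+y. ennreal (indicator (- cball x \<epsilon>) y * (1 / norm (x - y) ^ (CARD('n) + 1))) \<partial>surface_measure S)
    \<le> ennreal (2 ^ (CARD('n) + 1) * ahlfors_const CARD('n) L / \<epsilon>\<^sup>2)"
proof -
  let ?n = "CARD('n)" and ?A = "ahlfors_const CARD('n) L"
  let ?c = "\<lambda>j::nat. 1 / (2 ^ j * \<epsilon>) ^ (?n + 1)"
  let ?B = "\<lambda>j::nat. cball x (2 ^ Suc j * \<epsilon>)"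
  have pw: "ennreal (indicator (- cball x \<epsilon>) y * (1 / norm (x - y) ^ (?n + 1))) \<le> (\<Sum>j. ennreal (?c j) * indicator (?B j) y)" for y
  proof (cases "norm (x - y) > \<epsilon>")
    case True
    \<comment> \<open>The least j with P j is a successor, and its predecessor numbers the dyadic
      shell around x that contains y.\<close>
    define P where "P j \<longleftrightarrow> norm (x - y) \<le> 2 ^ j * \<epsilon>" for j :: nat
    obtain j0 where "norm (x - y) / \<epsilon> < 2 ^ j0"
      using real_arch_pow[of 2] by auto
    then have "P j0"
      using \<epsilon> by (simp add: P_def field_simps)
    then have P: "P (LEAST j. P j)"
      by (rule LeastI)
    have "\<not> P 0"
      using True by (simp add: P_def)
    then obtain j where j: "(LEAST j. P j) = Suc j"
      using P by (metis not0_implies_Suc)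
    have "\<not> P j"
      using not_less_Least[of j P] j by simp
    then have lo: "2 ^ j * \<epsilon> \<le> norm (x - y)"
      by (simp add: P_def)
    have "ennreal (indicator (- cball x \<epsilon>) y * (1 / norm (x - y) ^ (?n + 1))) \<le> ennreal (?c j) * indicator (?B j) y"
    proof -
      have "y \<in> ?B j"
        using P j by (simp add: P_def dist_norm)
      moreover have "1 / norm (x - y) ^ (?n + 1) \<le> ?c j"
        using lo \<epsilon> order_less_trans[OF \<epsilon> True] by (intro divide_left_mono power_mono mult_pos_pos zero_less_power) auto
      ultimately show ?thesis
        by (auto simp: indicator_def intro!: ennreal_leI)
    qed
    also have "\<dots> = (\<Sum>i\<in>{j}. ennreal (?c i) * indicator (?B i) y)"
      by (simp only: sum.insert finite.emptyI empty_iff sum.empty not_False_eq_True add_0_right)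
    also have "\<dots> \<le> (\<Sum>j. ennreal (?c j) * indicator (?B j) y)"
      by (intro sum_le_suminf) auto
    finally show ?thesis .
  qed (simp add: dist_norm)
  have "(\<integral>\<^sup>+y. ennreal (indicator (- cball x \<epsilon>) y * (1 / norm (x - y) ^ (?n + 1))) \<partial>surface_measure S)
      \<le> (\<integral>\<^sup>+y. (\<Sum>j. ennreal (?c j) * indicator (?B j) y) \<partial>surface_measure S)"
    by (intro nn_integral_mono pw)
  also have "\<dots> = (\<Sum>j. \<integral>\<^sup>+y. ennreal (?c j) * indicator (?B j) y \<partial>surface_measure S)"
    by (intro nn_integral_suminf measurable_surface borel_measurable_times_ennreal borel_measurable_const
        borel_measurable_indicator borel_closed closed_cball)
  also have "\<dots> \<le> (\<Sum>j. ennreal (2 ^ (?n - 1) * ?A / \<epsilon>\<^sup>2 * (1/4) ^ j))"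
  proof (intro suminf_le allI)
    fix j
    have "(\<integral>\<^sup>+y. ennreal (?c j) * indicator (?B j) y \<partial>surface_measure S)
        = (\<integral>\<^sup>+y. ennreal (?c j) * indicator (S \<inter> ?B j) y \<partial>surface_measure S)"
      by (intro nn_integral_cong) (auto simp: indicator_def)
    also have "\<dots> = ennreal (?c j) * emeasure (surface_measure S) (S \<inter> ?B j)"
      by (intro nn_integral_cmult_indicator borel_Int_surface) auto
    also have "\<dots> \<le> ennreal (?c j) * ennreal (?A * (2 ^ Suc j * \<epsilon>) ^ (?n - 1))"
      using \<epsilon> by (intro mult_left_mono emeasure_surface_ball_le) auto
    also have "\<dots> = ennreal (?c j * (?A * (2 ^ Suc j * \<epsilon>) ^ (?n - 1)))"
      using \<epsilon> ahlfors_const_nonneg by (intro ennreal_mult[symmetric]) auto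
    \<comment> \<open>The decay exponent d + 1 exceeds the growth exponent d - 1 by 2, so the shell
      j contributes a multiple of 4^(- j) / \<epsilon>^2.\<close>
    also have "?c j * (?A * (2 ^ Suc j * \<epsilon>) ^ (?n - 1)) = 2 ^ (?n - 1) * ?A / \<epsilon>\<^sup>2 * (1/4) ^ j"
    proof -
      obtain m where m: "?n = Suc m"
        using dim by (metis Suc_le_D Suc_1)
      define X where "X = 2 ^ j * \<epsilon>"
      have p4: "(2 ^ j)\<^sup>2 = (4 :: real) ^ j"
        by (simp add: power2_eq_square flip: power_mult_distrib)
      have X: "X > 0" "X\<^sup>2 = \<epsilon>\<^sup>2 * 4 ^ j"
        using \<epsilon> p4 by (simp_all add: X_def power_mult_distrib mult.commute)
      have "?c j * (?A * (2 ^ Suc j * \<epsilon>) ^ (?n - 1)) = 1 / (X\<^sup>2 * X ^ m) * (?A * (2 * X) ^ m)"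
        by (simp add: m X_def power2_eq_square mult_ac)
      also have "\<dots> = 2 ^ m * ?A / X\<^sup>2"
        using X(1) by (simp add: power_mult_distrib)
      finally show ?thesis
        unfolding X(2) by (simp add: m power_one_over field_simps)
    qed
    finally show "(\<integral>\<^sup>+y. ennreal (?c j) * indicator (?B j) y \<partial>surface_measure S) \<le> ennreal (2 ^ (?n - 1) * ?A / \<epsilon>\<^sup>2 * (1/4) ^ j)" .
  qed auto
  also have "\<dots> = ennreal (2 ^ (?n - 1) * ?A / \<epsilon>\<^sup>2 * (1 / (1 - 1/4)))"
    using ahlfors_const_nonneg by (intro suminf_ennreal_eq sums_mult geometric_sums) auto
  also have "\<dots> \<le> ennreal (2 ^ (?n + 1) * ?A / \<epsilon>\<^sup>2)"
  proof (rule ennreal_leI)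
    obtain m where m: "?n = Suc m"
      using dim by (metis Suc_le_D Suc_1)
    have "2 ^ m * (4/3) \<le> (2 ^ m * 4 :: real)"
      by simp
    then have "2 ^ m * (4/3) * (?A / \<epsilon>\<^sup>2) \<le> 2 ^ m * 4 * (?A / \<epsilon>\<^sup>2)"
      using ahlfors_const_nonneg by (intro mult_right_mono) auto
    then show "2 ^ (?n - 1) * ?A / \<epsilon>\<^sup>2 * (1 / (1 - 1/4)) \<le> 2 ^ (?n + 1) * ?A / \<epsilon>\<^sup>2"
      by (simp add: m mult_ac)
  qed
  finally show ?thesis .
qed

lemma integrable_surface_bounded:
  fixes f :: "real^'n \<Rightarrow> 'b::{banach, second_countable_topology}"
  assumes "f \<in> borel_measurable (surface_measure S)" "\<And>y. y \<in> S \<Longrightarrow> norm (f y) \<le> B"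
  shows "integrable (surface_measure S) f"
  using assms by (intro surface.integrable_const_bound[of _ B]) auto

lemma integrable_surface_continuous:
  fixes f :: "real^'n \<Rightarrow> 'b::{banach, second_countable_topology}"
  assumes "continuous_on S f"
  shows "integrable (surface_measure S) f"
proof -
  obtain B where "\<And>y. y \<in> S \<Longrightarrow> norm (f y) \<le> B"
    using compact_continuous_image[OF assms compact_S] compact_imp_bounded bounded_iff by (metis imageI)
  then show ?thesis
    by (intro integrable_surface_bounded measurable_surface_continuous assms)
qed

end

section \<open>From essential suprema in charts to pointwise bounds\<close>

lemma sup_norm_on_le_W2inf_norm_on: "sup_norm_on U u \<le> W2inf_norm_on U u"
  unfolding W2inf_norm_on_def by (intro INF_greatest) (auto intro: le_supI1)

text \<open>For a continuous function on an open set, a violation at one point would spread to a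
  nonempty open set, which is not null.\<close>

lemma norm_le_sup_norm_on:
  fixes u :: "real^'n \<Rightarrow> complex"
  assumes U: "open U" and u: "continuous_on U u" and N: "sup_norm_on U u \<le> ennreal N" and z: "z \<in> U" "N \<ge> 0"
  shows "norm (u z) \<le> N"
proof (rule ccontr)
  assume "\<not> ?thesis"
  then have zN: "norm (u z) > N"
    by simp
  define V where "V = U \<inter> (\<lambda>z. norm (u z)) -` {N<..}"
  have V: "open V" "V \<noteq> {}"
    unfolding V_def using U u zN z by (auto intro!: continuous_open_preimage continuous_intros)
  have "AE z in lebesgue_on U. ennreal (norm (u z)) \<le> ennreal N"
    using esssup_AE[where M = "lebesgue_on U" and f = "\<lambda>z. ennreal (norm (u z))"]
  proof eventually_elim
    case (elim z)
    then show ?case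
      using N unfolding sup_norm_on_def by (rule order_trans)
  qed
  then have "AE z in lebesgue. z \<in> U \<longrightarrow> norm (u z) \<le> N"
    using U z(2) by (subst (asm) AE_restrict_space_iff) (auto simp: borel_open)
  then obtain Z where Z: "Z \<in> null_sets lebesgue" "{z. \<not> (z \<in> U \<longrightarrow> norm (u z) \<le> N)} \<subseteq> Z"
    unfolding eventually_ae_filter by auto
  then have "V \<subseteq> Z"
    by (auto simp: V_def)
  then have "negligible V"
    using Z(1) negligible_subset by (auto simp: negligible_iff_null_sets)
  then show False
    using open_not_negligible[OF V] by simp
qed

text \<open>In a chart around y the domain is open and the pullback of f is continuous, so the
  essential bound contained in the Sobolev norm holds at the parameter of y.\<close>

lemma norm_le_W2inf_norm:
  assumes atlas: "lipschitz_atlas L S \<A>" and f: "f \<in> W2inf S \<A>" and y: "y \<in> S"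
  shows "norm (f y) \<le> enn2real (W2inf_norm \<A> f)"
proof -
  from atlas y obtain c where c: "c \<in> \<A>" "y \<in> cylinder c" "lipschitz_chart L S c"
    by (auto simp: lipschitz_atlas_def)
  let ?a = "axis_dir c" and ?U = "chart_dom c"
  let ?t = "\<lambda>z. tangential ?a z"
  let ?p = "\<lambda>z. ctr c + ?t z + graph_fun c (?t z) *\<^sub>R ?a"
  have a: "norm ?a = 1" and lip: "L-lipschitz_on {z. z \<bullet> ?a = 0 \<and> norm z < rad c} (graph_fun c)"
    and S: "S \<inter> cylinder c = {y \<in> cylinder c. (y - ctr c) \<bullet> ?a = graph_fun c (?t (y - ctr c))}"
    using c(3) by (auto simp: lipschitz_chart_def)
  have aa: "?a \<bullet> ?a = 1"
    using a by (simp add: dot_square_norm)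
  have t_cont: "continuous_on X ?t" for X
    unfolding tangential_def by (intro continuous_intros)
  have tt: "?t z \<bullet> ?a = 0" for z
    by (rule tangential_inner[OF a])
  define U1 where "U1 = ?t -` {z. norm z < rad c}"
  have U1: "open U1"
    unfolding U1_def by (intro open_vimage t_cont) (simp add: open_Collect_less continuous_on_norm_id)
  have g_cont: "continuous_on U1 (\<lambda>z. graph_fun c (?t z))"
    by (rule continuous_on_compose2[OF lipschitz_on_continuous_on[OF lip] t_cont]) (auto simp: U1_def tt)
  have U_eq: "?U = U1 \<inter> (\<lambda>z. graph_fun c (?t z)) -` {- (hgt c / 2)<..<hgt c / 2}"
    by (auto simp: chart_dom_def U1_def abs_less_iff)
  have U: "open ?U"
    unfolding U_eq by (intro continuous_open_preimage g_cont U1) auto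
  have g_cont': "continuous_on ?U (\<lambda>z. graph_fun c (?t z))"
    by (rule continuous_on_subset[OF g_cont]) (auto simp: U_eq)
  \<comment> \<open>The parametrised point has tangential part \<open>?t z\<close> and axial part
    equal to the graph value; it therefore lies in the cylinder and on the graph.\<close>
  have pS: "?p z \<in> S" if "z \<in> ?U" for z
  proof -
    have d: "?p z - ctr c = ?t z + graph_fun c (?t z) *\<^sub>R ?a"
      by simp
    have 1: "(?p z - ctr c) \<bullet> ?a = graph_fun c (?t z)"
      unfolding d by (simp add: inner_add_left tt aa)
    have "?t (?p z - ctr c) = ?p z - ctr c - graph_fun c (?t z) *\<^sub>R ?a"
      by (simp only: tangential_def[of _ "?p z - ctr c"] 1)
    then have 2: "?t (?p z - ctr c) = ?t z"
      by simp
    have "?p z \<in> cylinder c"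
      unfolding cylinder_def mem_Collect_eq 1 2 using that by (simp add: chart_dom_def)
    then have "?p z \<in> {y \<in> cylinder c. (y - ctr c) \<bullet> ?a = graph_fun c (?t (y - ctr c))}"
      by (simp only: mem_Collect_eq 1 2)
    then show ?thesis
      unfolding S[symmetric] by (rule IntD1)
  qed
  have fS: "continuous_on S f" and fin: "W2inf_norm \<A> f < \<infinity>"
    using f by (auto simp: W2inf_def)
  have u: "continuous_on ?U (pullback c f)"
    unfolding pullback_def[abs_def]
    by (rule continuous_on_compose2[OF fS]) (intro continuous_intros t_cont g_cont', use pS in auto)
  have "sup_norm_on ?U (pullback c f) \<le> W2inf_norm_on ?U (pullback c f)"
    by (rule sup_norm_on_le_W2inf_norm_on)
  also have "\<dots> \<le> W2inf_norm \<A> f"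
    unfolding W2inf_norm_def using c(1) by (rule SUP_upper)
  also have "\<dots> = ennreal (enn2real (W2inf_norm \<A> f))"
    using fin by simp
  finally have N: "sup_norm_on ?U (pullback c f) \<le> ennreal (enn2real (W2inf_norm \<A> f))" .
  have y_eq: "(y - ctr c) \<bullet> ?a = graph_fun c (?t (y - ctr c))"
  proof -
    have "y \<in> S \<inter> cylinder c"
      using y c(2) by simp
    then show ?thesis
      unfolding S by simp
  qed
  have "y - ctr c \<in> ?U"
    using c(2) y_eq by (simp add: cylinder_def chart_dom_def)
  from norm_le_sup_norm_on[OF U u N this] have "norm (pullback c f (y - ctr c)) \<le> enn2real (W2inf_norm \<A> f)"
    by simp
  moreover have "?p (y - ctr c) = y"
    unfolding y_eq[symmetric] by (simp add: tangential_def)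
  ultimately show ?thesis
    by (simp add: pullback_def)
qed

section \<open>Layer operators\<close>

text \<open>\<open>W\<close> is a pointwise bound for f, to be instantiated by the Sobolev norm.
  Letting the size of f enter the error estimates through \<open>W\<close> makes the final constant
  uniform in f.\<close>

locale surface_layer = lipschitz_surface S \<A> L + smooth_periodic_kernel \<kappa> K D1 D2
  for S :: "(real^'n) set" and \<A> L and \<kappa> :: "real^'n \<Rightarrow> complex" and K D1 D2 +
  fixes f :: "real^'n \<Rightarrow> complex" and W :: real
  assumes f_cont: "continuous_on S f" and f_bound: "\<And>y. y \<in> S \<Longrightarrow> norm (f y) \<le> W"
    and W_nonneg: "W \<ge> 0" and S_subset: "S \<subseteq> cbox 0 (\<chi> i. 1/2)"
begin

abbreviation \<sigma> :: "(real^'n) measure" where "\<sigma> \<equiv> surface_measure S"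

text \<open>S lies in the ball of radius d around 0, so the ball bound gives a total area depending
  only on the Lipschitz character and the dimension.\<close>

definition surface_bound :: real where
  "surface_bound = ahlfors_const CARD('n) L * real CARD('n) ^ (CARD('n) - 1)"

lemma f_measurable [measurable]: "f \<in> borel_measurable \<sigma>"
  by (rule measurable_surface_continuous[OF f_cont])

lemma diff_mem_cell: "x \<in> S \<Longrightarrow> y \<in> S \<Longrightarrow> x - y \<in> cell"
proof -
  assume *: "x \<in> S" "y \<in> S"
  have "0 \<le> x $ i \<and> x $ i \<le> 1/2 \<and> 0 \<le> y $ i \<and> y $ i \<le> 1/2" for i
    using * S_subset by (auto simp: mem_box_cart subset_eq)
  then show ?thesis
    by (auto simp: mem_cell algebra_simps add_increasing add_mono) (smt (verit, best))+
qed

lemma emeasure_surface_le: "emeasure \<sigma> S \<le> ennreal surface_bound"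
proof -
  have "S \<subseteq> cball 0 (real CARD('n))"
  proof
    fix x assume "x \<in> S"
    then have x: "0 \<le> x $ i \<and> x $ i \<le> 1/2" for i
      using S_subset by (auto simp: mem_box_cart subset_eq)
    have "norm x \<le> (\<Sum>i\<in>UNIV. \<bar>x $ i\<bar>)"
      by (rule norm_le_l1_cart)
    also have "\<dots> \<le> (\<Sum>i\<in>(UNIV::'n set). 1)"
      using x by (intro sum_mono) (smt (verit, best) field_sum_of_halves)
    finally show "x \<in> cball 0 (real CARD('n))"
      by simp
  qed
  then have "emeasure \<sigma> S = emeasure \<sigma> (S \<inter> cball 0 (real CARD('n)))"
    by (simp add: Int_absorb2)
  also have "\<dots> \<le> ennreal surface_bound"
    unfolding surface_bound_def by (rule emeasure_surface_ball_le) simp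
  finally show ?thesis .
qed

lemma surface_bound_nonneg: "surface_bound \<ge> 0"
  using ahlfors_const_nonneg by (simp add: surface_bound_def)

lemma L1_norm_eq: "L1_norm S f = ennreal (LINT y|\<sigma>. norm (f y))"
  unfolding L1_norm_def
  by (intro nn_integral_eq_integral integrable_norm integrable_surface_continuous f_cont) auto

lemma L1_norm_le: "L1_norm S f \<le> ennreal (W * surface_bound)"
proof -
  have "L1_norm S f \<le> (\<integral>\<^sup>+y. ennreal W \<partial>\<sigma>)"
    unfolding L1_norm_def using f_bound by (intro nn_integral_mono ennreal_leI) simp
  also have "\<dots> = ennreal W * emeasure \<sigma> S"
    by simp
  also have "\<dots> \<le> ennreal W * ennreal surface_bound"
    by (intro mult_left_mono emeasure_surface_le) simp
  finally show ?thesis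
    using W_nonneg by (simp add: ennreal_mult')
qed

lemma continuous_shift_kernel:
  "continuous_on UNIV g \<Longrightarrow> continuous_on S (\<lambda>y. g (x - y) * f y)"
  by (intro continuous_intros f_cont) (auto intro!: continuous_on_compose2[of UNIV g] continuous_intros)

text \<open>Source of the measurability that a finite \<open>Linf_norm\<close> requires, for
  operators with a continuous kernel. Compactness of S bounds the kernel on the differences x -
  y.\<close>

lemma continuous_layer_op:
  assumes g: "continuous_on UNIV g"
  shows "continuous_on UNIV (layer_op S g f)"
  unfolding layer_op_def[abs_def]
proof (rule continuous_on_integral_dominated)
  show "continuous_on UNIV (\<lambda>x. g (x - y) * f y)" for y
    by (intro continuous_intros) (auto intro!: continuous_on_compose2[OF g] continuous_intros)
  show "(\<lambda>y. g (x - y) * f y) \<in> borel_measurable \<sigma>" for x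
    by (intro measurable_surface_continuous continuous_shift_kernel g)
  fix C :: "(real^'n) set" assume "compact C"
  then have "compact {x - y | x y. x \<in> C \<and> y \<in> S}"
    using compact_S by (rule compact_differences)
  then have "bounded (g ` {x - y | x y. x \<in> C \<and> y \<in> S})"
    by (intro compact_imp_bounded compact_continuous_image continuous_on_subset[OF g]) auto
  then obtain B where B: "\<And>x y. x \<in> C \<Longrightarrow> y \<in> S \<Longrightarrow> norm (g (x - y)) \<le> B"
    unfolding bounded_iff by blast
  show "\<exists>w. integrable \<sigma> w \<and> (\<forall>x\<in>C. \<forall>y\<in>space \<sigma>. norm (g (x - y) * f y) \<le> w y)"
    using B by (intro exI[of _ "\<lambda>y. B * norm (f y)"])
      (auto simp: norm_mult intro!: integrable_norm integrable_surface_continuous f_cont continuous_on_norm mult_right_mono)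
qed

lemma layer_op_measurable: "continuous_on UNIV g \<Longrightarrow> layer_op S g f \<in> borel_measurable \<sigma>"
  by (intro measurable_surface_continuous continuous_on_subset[OF continuous_layer_op]) auto

lemma norm_layer_op_diff_le:
  assumes g: "continuous_on UNIV g" "continuous_on UNIV h" and E: "\<And>z. norm (g z - h z) \<le> E"
  shows "norm (layer_op S g f x - layer_op S h f x) \<le> E * (LINT y|\<sigma>. norm (f y))"
proof -
  have i: "integrable \<sigma> (\<lambda>y. g (x - y) * f y)" "integrable \<sigma> (\<lambda>y. h (x - y) * f y)"
    by (intro integrable_surface_continuous continuous_shift_kernel g)+
  have "layer_op S g f x - layer_op S h f x = (LINT y|\<sigma>. g (x - y) * f y - h (x - y) * f y)"
    unfolding layer_op_def by (rule Bochner_Integration.integral_diff[OF i, symmetric])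
  also have "norm \<dots> \<le> (LINT y|\<sigma>. E * norm (f y))"
  proof (rule Bochner_Integration.integral_norm_bound_integral)
    show "integrable \<sigma> (\<lambda>y. g (x - y) * f y - h (x - y) * f y)"
      by (intro Bochner_Integration.integrable_diff i)
    show "integrable \<sigma> (\<lambda>y. E * norm (f y))"
      by (intro integrable_mult_right integrable_norm integrable_surface_continuous f_cont)
    show "norm (g (x - y) * f y - h (x - y) * f y) \<le> E * norm (f y)" for y
      unfolding left_diff_distrib[symmetric] norm_mult by (intro mult_right_mono E) simp
  qed
  finally show ?thesis
    by simp
qed

definition long_error :: "real \<Rightarrow> nat \<Rightarrow> real" where
  "long_error \<delta> p = C_long \<kappa> * exp (- 2 * pi\<^sup>2 * \<delta>\<^sup>2 * (real p)\<^sup>2) / (\<delta> ^ (CARD('n) + 1) * real p)"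

lemma Linf_norm_long_le:
  assumes \<delta>: "0 < \<delta>" "\<delta> < 1/2" and p: "p \<ge> 1"
  shows "Linf_norm S (\<lambda>x. layer_op S (fourier_trunc p (k_long \<delta> \<kappa>)) f x - layer_op S (k_long \<delta> \<kappa>) f x)
    \<le> ennreal (long_error \<delta> p) * L1_norm S f"
proof -
  let ?d = "\<lambda>x. layer_op S (fourier_trunc p (k_long \<delta> \<kappa>)) f x - layer_op S (k_long \<delta> \<kappa>) f x"
  note c = continuous_fourier_trunc[of p "k_long \<delta> \<kappa>"] continuous_k_long[OF \<delta>(1)]
  have m: "?d \<in> borel_measurable \<sigma>"
    by (intro borel_measurable_diff layer_op_measurable c)
  have E: "0 \<le> long_error \<delta> p"
    unfolding long_error_def by (rule order_trans[OF norm_ge_zero norm_fourier_trunc_diff_le[OF \<delta> p]])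
  have "norm (?d x) \<le> long_error \<delta> p * (LINT y|\<sigma>. norm (f y))" for x
    unfolding long_error_def by (intro norm_layer_op_diff_le c norm_fourier_trunc_diff_le \<delta> p)
  then have "esssup \<sigma> (\<lambda>x. ennreal (norm (?d x))) \<le> ennreal (long_error \<delta> p * (LINT y|\<sigma>. norm (f y)))"
    using m by (intro esssup_I AE_I2 ennreal_leI) auto
  then show ?thesis
    unfolding Linf_norm_def L1_norm_eq using m E by (simp add: ennreal_mult')
qed

section \<open>Principal values and the far part of the short-range operator\<close>

text \<open>Removing a ball of radius \<eta> < 1 changes the integral of a bounded function by at
  most a multiple of \<eta>^(d - 1), hence of \<eta> since d \<ge> 2. So the principal value is the
  ordinary integral.\<close>

lemma tendsto_punctured_integral:
  fixes h :: "real^'n \<Rightarrow> complex"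
  assumes h: "h \<in> borel_measurable \<sigma>" and B: "\<And>y. y \<in> S \<Longrightarrow> norm (h y) \<le> B"
  shows "((\<lambda>\<eta>. LINT y:(UNIV - cball x \<eta>)|\<sigma>. h y) \<longlongrightarrow> (LINT y|\<sigma>. h y)) (at_right 0)"
proof -
  let ?A = "ahlfors_const CARD('n) L"
  have int: "integrable \<sigma> h"
    by (rule integrable_surface_bounded[OF h B])
  have int': "integrable \<sigma> (\<lambda>y. indicator (UNIV - cball x \<eta>) y *\<^sub>R h y)" for \<eta>
  proof (rule Bochner_Integration.integrable_bound[OF int])
    show "(\<lambda>y. indicator (UNIV - cball x \<eta>) y *\<^sub>R h y) \<in> borel_measurable \<sigma>"
      by (intro measurable_indicator_scaleR h) auto
  qed (auto simp: indicator_def)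
  have le: "norm ((LINT y:(UNIV - cball x \<eta>)|\<sigma>. h y) - (LINT y|\<sigma>. h y)) \<le> \<bar>B\<bar> * ?A * \<eta>"
    if \<eta>: "0 < \<eta>" "\<eta> < 1" for \<eta>
  proof -
    have "(LINT y:(UNIV - cball x \<eta>)|\<sigma>. h y) - (LINT y|\<sigma>. h y)
        = (LINT y|\<sigma>. indicator (UNIV - cball x \<eta>) y *\<^sub>R h y - h y)"
      unfolding set_lebesgue_integral_def by (rule Bochner_Integration.integral_diff[OF int' int, symmetric])
    also have "norm \<dots> \<le> (LINT y|\<sigma>. \<bar>B\<bar> * indicator (S \<inter> cball x \<eta>) y)"
    proof (rule Bochner_Integration.integral_norm_bound_integral[OF Bochner_Integration.integrable_diff[OF int' int]])
      show "integrable \<sigma> (\<lambda>y. \<bar>B\<bar> * indicator (S \<inter> cball x \<eta>) y)"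
        by (intro integrable_mult_right integrable_real_indicator borel_Int_surface)
          (auto simp: surface.emeasure_eq_measure)
      show "norm (indicator (UNIV - cball x \<eta>) y *\<^sub>R h y - h y) \<le> \<bar>B\<bar> * indicator (S \<inter> cball x \<eta>) y"
        if "y \<in> space \<sigma>" for y
        using that B[of y] by (auto simp: indicator_def)
    qed
    also have "\<dots> = \<bar>B\<bar> * measure \<sigma> (S \<inter> cball x \<eta>)"
      by (simp add: borel_Int_surface Int_commute Int_left_commute)
    also have "\<dots> \<le> \<bar>B\<bar> * (?A * \<eta>)"
    proof (rule mult_left_mono)
      have "measure \<sigma> (S \<inter> cball x \<eta>) \<le> ?A * \<eta> ^ (CARD('n) - 1)"
        using emeasure_surface_ball_le[OF \<eta>(1), of x] ahlfors_const_nonneg \<eta>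
        by (simp add: surface.emeasure_eq_measure)
      also have "\<dots> \<le> ?A * \<eta> ^ 1"
        using \<eta> ahlfors_const_nonneg dim by (intro mult_left_mono power_decreasing) auto
      finally show "measure \<sigma> (S \<inter> cball x \<eta>) \<le> ?A * \<eta>"
        by simp
    qed simp
    finally show ?thesis
      by (simp only: mult.assoc)
  qed
  have lim: "((\<lambda>\<eta>. \<bar>B\<bar> * ?A * \<eta>) \<longlongrightarrow> 0) (at_right 0)"
    by (rule tendsto_mult_right_zero) (rule tendsto_ident_at)
  have ev: "\<forall>\<^sub>F \<eta> in at_right 0. norm ((LINT y:(UNIV - cball x \<eta>)|\<sigma>. h y) - (LINT y|\<sigma>. h y)) \<le> \<bar>B\<bar> * ?A * \<eta>"
    using eventually_at_right_real[OF zero_less_one] by eventually_elim (auto intro!: le)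
  have "((\<lambda>\<eta>. (LINT y:(UNIV - cball x \<eta>)|\<sigma>. h y) - (LINT y|\<sigma>. h y)) \<longlongrightarrow> 0) (at_right 0)"
    by (rule Lim_null_comparison[OF ev lim])
  then show ?thesis
    by (simp add: LIM_zero_iff)
qed

lemma k_long_measurable [measurable]: "\<delta> > 0 \<Longrightarrow> k_long \<delta> \<kappa> \<in> borel_measurable borel"
  by (intro borel_measurable_continuous_onI continuous_k_long)

lemma k_short_measurable: "\<delta> > 0 \<Longrightarrow> k_short \<delta> \<kappa> \<in> borel_measurable borel"
  unfolding k_short_def[abs_def] by measurable

lemma measurable_shift_kernel:
  fixes g :: "real^'n \<Rightarrow> complex"
  assumes "g \<in> borel_measurable borel"
  shows "(\<lambda>y. g (x - y) * f y) \<in> borel_measurable \<sigma>"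
proof -
  have "(\<lambda>y. g (x - y)) \<in> borel_measurable \<sigma>"
    by (intro measurable_surface measurable_compose[OF _ assms]) simp
  then show ?thesis
    by measurable
qed

lemma set_integrable_kernel_outside:
  assumes x: "x \<in> S" and \<eta>: "\<eta> > 0"
  shows "set_integrable \<sigma> (UNIV - cball x \<eta>) (\<lambda>y. \<kappa> (x - y) * f y)"
  unfolding set_integrable_def
proof (rule integrable_surface_bounded)
  show "(\<lambda>y. indicator (UNIV - cball x \<eta>) y *\<^sub>R (\<kappa> (x - y) * f y)) \<in> borel_measurable \<sigma>"
    by (intro measurable_indicator_scaleR measurable_shift_kernel meas) auto
  fix y assume y: "y \<in> S"
  show "norm (indicator (UNIV - cball x \<eta>) y *\<^sub>R (\<kappa> (x - y) * f y)) \<le> K / \<eta> ^ (CARD('n) - 1) * W"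
  proof (cases "y \<in> cball x \<eta>")
    case False
    then have n: "norm (x - y) > \<eta>"
      by (simp add: dist_norm)
    then have "norm (\<kappa> (x - y)) \<le> K / norm (x - y) ^ (CARD('n) - 1)"
      using \<eta> x y by (intro norm_kernel_le) (auto simp: diff_mem_cell)
    also have "\<dots> \<le> K / \<eta> ^ (CARD('n) - 1)"
      using n \<eta> K_pos order_less_trans[OF \<eta> n] by (intro divide_left_mono power_mono mult_pos_pos zero_less_power) auto
    finally have "norm (\<kappa> (x - y)) * norm (f y) \<le> K / \<eta> ^ (CARD('n) - 1) * W"
      using f_bound[OF y] K_pos \<eta> by (intro mult_mono) auto
    then show ?thesis
      using False by (simp add: norm_mult)
  qed (use K_pos \<eta> W_nonneg in auto)
qed

lemma set_integrable_k_long: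
  assumes "\<delta> > 0" "B \<in> sets borel"
  shows "set_integrable \<sigma> B (\<lambda>y. k_long \<delta> \<kappa> (x - y) * f y)"
  unfolding set_integrable_def
proof (rule Bochner_Integration.integrable_bound)
  show "integrable \<sigma> (\<lambda>y. k_long \<delta> \<kappa> (x - y) * f y)"
    by (intro integrable_surface_continuous continuous_shift_kernel continuous_k_long assms)
  show "(\<lambda>y. indicator B y *\<^sub>R (k_long \<delta> \<kappa> (x - y) * f y)) \<in> borel_measurable \<sigma>"
    by (intro measurable_indicator_scaleR measurable_shift_kernel k_long_measurable assms)
qed (auto simp: indicator_def)

definition far_op :: "real \<Rightarrow> real \<Rightarrow> real^'n \<Rightarrow> complex" where
  "far_op \<delta> \<epsilon> x = (LINT y:(UNIV - cball x \<epsilon>)|\<sigma>. k_short \<delta> \<kappa> (x - y) * f y)"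

text \<open>On each punctured surface the kernel splits into its long and short parts. The long part
  converges as an ordinary integral, and for \<eta> < \<epsilon> the short part outside the
  \<epsilon>-ball does not depend on \<eta>. The only singular limit left is the local one.\<close>

lemma pv_op_decompose:
  assumes x: "x \<in> S" and \<delta>: "\<delta> > 0" and \<epsilon>: "\<epsilon> > 0"
    and ex: "pv_exists S (cball x \<epsilon>) (k_short \<delta> \<kappa>) f x"
  shows "pv_op S \<kappa> f x = layer_op S (k_long \<delta> \<kappa>) f x + pv_local_op \<epsilon> S (k_short \<delta> \<kappa>) f x + far_op \<delta> \<epsilon> x"
proof -
  let ?l = "\<lambda>y. k_long \<delta> \<kappa> (x - y) * f y" and ?s = "\<lambda>y. k_short \<delta> \<kappa> (x - y) * f y"
  have si: "set_integrable \<sigma> (UNIV - cball x \<eta>) ?s" if "\<eta> > 0" for \<eta>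
  proof -
    have "set_integrable \<sigma> (UNIV - cball x \<eta>) (\<lambda>y. \<kappa> (x - y) * f y - ?l y)"
      by (intro set_integral_diff set_integrable_kernel_outside set_integrable_k_long x that \<delta>) auto
    then show ?thesis
      by (simp add: k_short_def algebra_simps)
  qed
  have split: "pv_trunc S UNIV \<kappa> f x \<eta>
      = (LINT y:(UNIV - cball x \<eta>)|\<sigma>. ?l y) + pv_trunc S (cball x \<epsilon>) (k_short \<delta> \<kappa>) f x \<eta> + far_op \<delta> \<epsilon> x"
    if \<eta>: "0 < \<eta>" "\<eta> < \<epsilon>" for \<eta>
  proof -
    have "pv_trunc S UNIV \<kappa> f x \<eta> = (LINT y:(UNIV - cball x \<eta>)|\<sigma>. ?l y + ?s y)"
      by (simp add: pv_trunc_def k_short_def algebra_simps)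
    also have "\<dots> = (LINT y:(UNIV - cball x \<eta>)|\<sigma>. ?l y) + (LINT y:(UNIV - cball x \<eta>)|\<sigma>. ?s y)"
      by (intro set_integral_add set_integrable_k_long si \<delta> \<eta>) auto
    also have "UNIV - cball x \<eta> = (cball x \<epsilon> - cball x \<eta>) \<union> (UNIV - cball x \<epsilon>)"
      using \<eta> by auto
    also have "(LINT y:((cball x \<epsilon> - cball x \<eta>) \<union> (UNIV - cball x \<epsilon>))|\<sigma>. ?s y)
        = (LINT y:(cball x \<epsilon> - cball x \<eta>)|\<sigma>. ?s y) + (LINT y:(UNIV - cball x \<epsilon>)|\<sigma>. ?s y)"
    proof (rule set_integral_Un)
      have "set_integrable \<sigma> (UNIV - cball x \<eta>) ?s"
        by (rule si[OF \<eta>(1)])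
      then have "integrable \<sigma> (\<lambda>y. indicator (cball x \<epsilon>) y *\<^sub>R (indicator (UNIV - cball x \<eta>) y *\<^sub>R ?s y))"
        unfolding set_integrable_def
      proof (rule Bochner_Integration.integrable_bound)
        show "(\<lambda>y. indicator (cball x \<epsilon>) y *\<^sub>R (indicator (UNIV - cball x \<eta>) y *\<^sub>R ?s y)) \<in> borel_measurable \<sigma>"
          by (intro measurable_indicator_scaleR measurable_shift_kernel k_short_measurable \<delta>) auto
      qed (auto simp: indicator_def)
      moreover have "indicator (cball x \<epsilon>) y *\<^sub>R (indicator (UNIV - cball x \<eta>) y *\<^sub>R ?s y) = indicator (cball x \<epsilon> - cball x \<eta>) y *\<^sub>R ?s y" for y
        by (auto simp: indicator_def)
      ultimately show "set_integrable \<sigma> (cball x \<epsilon> - cball x \<eta>) ?s"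
        unfolding set_integrable_def by (simp only:)
    qed (use si \<epsilon> in auto)
    finally show ?thesis
      by (simp add: pv_trunc_def far_op_def \<open>UNIV - cball x \<eta> = (cball x \<epsilon> - cball x \<eta>) \<union> (UNIV - cball x \<epsilon>)\<close>[symmetric] add.assoc)
  qed
  have lim_l: "((\<lambda>\<eta>. LINT y:(UNIV - cball x \<eta>)|\<sigma>. ?l y) \<longlongrightarrow> layer_op S (k_long \<delta> \<kappa>) f x) (at_right 0)"
    unfolding layer_op_def
  proof (rule tendsto_punctured_integral)
    show "?l \<in> borel_measurable \<sigma>"
      by (intro measurable_shift_kernel k_long_measurable \<delta>)
    show "norm (?l y) \<le> L1_cell \<kappa> * (LINT k::int^'n|count_space UNIV. heat_coeff_vec \<delta> k) * W" if "y \<in> S" for y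
      unfolding norm_mult using f_bound[OF that] norm_k_long_le[OF \<delta>, of "x - y"]
      by (intro mult_mono) (auto intro: order_trans[OF norm_ge_zero])
  qed
  obtain l where l: "(pv_trunc S (cball x \<epsilon>) (k_short \<delta> \<kappa>) f x \<longlongrightarrow> l) (at_right 0)"
    using ex by (auto simp: pv_exists_def)
  then have l_eq: "pv_local_op \<epsilon> S (k_short \<delta> \<kappa>) f x = l"
    unfolding pv_local_op_def by (intro tendsto_Lim) auto
  have "((\<lambda>\<eta>. (LINT y:(UNIV - cball x \<eta>)|\<sigma>. ?l y) + pv_trunc S (cball x \<epsilon>) (k_short \<delta> \<kappa>) f x \<eta> + far_op \<delta> \<epsilon> x)
      \<longlongrightarrow> layer_op S (k_long \<delta> \<kappa>) f x + l + far_op \<delta> \<epsilon> x) (at_right 0)"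
    by (intro tendsto_add lim_l l tendsto_const)
  then have "(pv_trunc S UNIV \<kappa> f x \<longlongrightarrow> layer_op S (k_long \<delta> \<kappa>) f x + l + far_op \<delta> \<epsilon> x) (at_right 0)"
  proof (rule Lim_transform_eventually)
    show "\<forall>\<^sub>F \<eta> in at_right 0. (LINT y:(UNIV - cball x \<eta>)|\<sigma>. ?l y) + pv_trunc S (cball x \<epsilon>) (k_short \<delta> \<kappa>) f x \<eta> + far_op \<delta> \<epsilon> x
        = pv_trunc S UNIV \<kappa> f x \<eta>"
      using eventually_at_right_real[OF \<epsilon>] by eventually_elim (simp add: split)
  qed
  then show ?thesis
    unfolding pv_op_def l_eq by (intro tendsto_Lim) auto
qed

text \<open>Joint measurability of the integrand yields measurability in x, without which the total
  error would have infinite \<open>Linf_norm\<close>.\<close>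

lemma far_op_measurable:
  assumes "\<delta> > 0"
  shows "far_op \<delta> \<epsilon> \<in> borel_measurable \<sigma>"
  unfolding far_op_def[abs_def] set_lebesgue_integral_def
proof (rule surface.borel_measurable_lebesgue_integral)
  note [measurable] = k_short_measurable[OF assms]
  have id: "(\<lambda>x. x) \<in> \<sigma> \<rightarrow>\<^sub>M borel"
    by (rule measurable_surface) simp
  have [measurable]: "fst \<in> \<sigma> \<Otimes>\<^sub>M \<sigma> \<rightarrow>\<^sub>M borel" "snd \<in> \<sigma> \<Otimes>\<^sub>M \<sigma> \<rightarrow>\<^sub>M borel" "(\<lambda>p. f (snd p)) \<in> borel_measurable (\<sigma> \<Otimes>\<^sub>M \<sigma>)"
    using measurable_compose[OF measurable_fst id] measurable_compose[OF measurable_snd id]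
      measurable_compose[OF measurable_snd f_measurable] by auto
  have "(\<lambda>(x, y). indicator (UNIV - cball x \<epsilon>) y *\<^sub>R (k_short \<delta> \<kappa> (x - y) * f y))
      = (\<lambda>p. if dist (fst p) (snd p) > \<epsilon> then k_short \<delta> \<kappa> (fst p - snd p) * f (snd p) else 0)"
    by (auto simp: fun_eq_iff indicator_def)
  also have "\<dots> \<in> borel_measurable (\<sigma> \<Otimes>\<^sub>M \<sigma>)"
    by measurable
  finally show "(\<lambda>(x, y). indicator (UNIV - cball x \<epsilon>) y *\<^sub>R (k_short \<delta> \<kappa> (x - y) * f y)) \<in> borel_measurable (\<sigma> \<Otimes>\<^sub>M \<sigma>)" .
qed

text \<open>The algebraic part of the decay is kept pointwise and integrated over dyadic shells. The
  exponential part is replaced by its value at distance \<epsilon> and multiplied by the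
  area.\<close>

lemma norm_far_op_le:
  assumes x: "x \<in> S" and \<delta>: "0 < \<delta>" "\<delta> < 1/2" and \<epsilon>: "\<delta> < \<epsilon>" and C: "upper_Gamma_const (real CARD('n) / 2) C"
  shows "norm (far_op \<delta> \<epsilon> x) \<le> W *
    (real CARD('n) * K / (2 * (1 - 1 / sqrt (real CARD('n))) ^ (CARD('n) + 1)) * \<delta>\<^sup>2 * (2 ^ (CARD('n) + 1) * ahlfors_const CARD('n) L / \<epsilon>\<^sup>2)
      + c_short K C \<kappa> * (exp (- (1 / (2 * real CARD('n))) * (\<epsilon>\<^sup>2 / \<delta>\<^sup>2)) / \<delta> ^ CARD('n)) * surface_bound)"
proof -
  let ?n = "CARD('n)"
  define P where "P = real ?n * K / (2 * (1 - 1 / sqrt (real ?n)) ^ (?n + 1)) * \<delta>\<^sup>2"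
  define R where "R = c_short K C \<kappa> * (exp (- (1 / (2 * real ?n)) * (\<epsilon>\<^sup>2 / \<delta>\<^sup>2)) / \<delta> ^ ?n)"
  let ?F = "2 ^ (?n + 1) * ahlfors_const ?n L / \<epsilon>\<^sup>2"
  have P: "P \<ge> 0"
    using K_pos dim by (auto simp: P_def intro!: mult_nonneg_nonneg divide_nonneg_nonneg)
  have cs: "c_short K C \<kappa> \<ge> 0"
    unfolding c_short_def Let_def
    using K_pos L1_cell_nonneg upper_Gamma_const_nonneg[OF C]
    by (intro add_nonneg_nonneg mult_nonneg_nonneg divide_nonneg_nonneg zero_le_power order_less_imp_le[OF Gamma_real_pos]) auto
  then have R: "R \<ge> 0"
    using \<delta> by (simp add: R_def)
  have F: "?F \<ge> 0"
    using ahlfors_const_nonneg by simp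
  let ?h = "\<lambda>y. ennreal (indicator (- cball x \<epsilon>) y * (1 / norm (x - y) ^ (?n + 1)))"
  have pw: "ennreal (norm (indicator (UNIV - cball x \<epsilon>) y *\<^sub>R (k_short \<delta> \<kappa> (x - y) * f y)))
      \<le> ennreal (W * P) * ?h y + ennreal (W * R)" if y: "y \<in> S" for y
  proof (cases "y \<in> cball x \<epsilon>")
    case False
    then have n: "norm (x - y) > \<epsilon>"
      by (simp add: dist_norm)
    have "norm (k_short \<delta> \<kappa> (x - y)) \<le> real ?n * K / (2 * (1 - 1 / sqrt (real ?n)) ^ (?n + 1)) * (\<delta>\<^sup>2 / norm (x - y) ^ (?n + 1))
        + c_short K C \<kappa> * (exp (- (1 / (2 * real ?n)) * ((norm (x - y))\<^sup>2 / \<delta>\<^sup>2)) / \<delta> ^ ?n)"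
      using n \<epsilon> by (intro norm_k_short_le dim \<delta> diff_mem_cell x y C) auto
    also have "real ?n * K / (2 * (1 - 1 / sqrt (real ?n)) ^ (?n + 1)) * (\<delta>\<^sup>2 / norm (x - y) ^ (?n + 1)) = P * (1 / norm (x - y) ^ (?n + 1))"
      by (simp add: P_def)
    also have "c_short K C \<kappa> * (exp (- (1 / (2 * real ?n)) * ((norm (x - y))\<^sup>2 / \<delta>\<^sup>2)) / \<delta> ^ ?n) \<le> R"
    proof -
      have "\<epsilon>\<^sup>2 \<le> (norm (x - y))\<^sup>2"
        using n \<epsilon> \<delta> by (intro power_mono) auto
      then have "1 / (2 * real ?n) * (\<epsilon>\<^sup>2 / \<delta>\<^sup>2) \<le> 1 / (2 * real ?n) * ((norm (x - y))\<^sup>2 / \<delta>\<^sup>2)"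
        by (intro mult_left_mono divide_right_mono) auto
      then show ?thesis
        unfolding R_def using cs \<delta> by (intro mult_left_mono divide_right_mono) auto
    qed
    finally have k: "norm (k_short \<delta> \<kappa> (x - y)) \<le> P * (1 / norm (x - y) ^ (?n + 1)) + R"
      by simp
    have "norm (k_short \<delta> \<kappa> (x - y) * f y) \<le> (P * (1 / norm (x - y) ^ (?n + 1)) + R) * W"
      unfolding norm_mult using k f_bound[OF y] by (intro mult_mono) (auto intro: order_trans[OF norm_ge_zero])
    then have "ennreal (norm (k_short \<delta> \<kappa> (x - y) * f y)) \<le> ennreal (W * P * (1 / norm (x - y) ^ (?n + 1)) + W * R)"
      by (intro ennreal_leI) (simp add: algebra_simps)
    also have "\<dots> = ennreal (W * P) * ennreal (1 / norm (x - y) ^ (?n + 1)) + ennreal (W * R)"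
    proof -
      have "ennreal (W * P * (1 / norm (x - y) ^ (?n + 1))) = ennreal (W * P) * ennreal (1 / norm (x - y) ^ (?n + 1))"
        using W_nonneg P by (intro ennreal_mult mult_nonneg_nonneg) auto
      then show ?thesis
        using W_nonneg P R by (subst ennreal_plus) (auto intro!: mult_nonneg_nonneg)
    qed
    finally show ?thesis
      using False by simp
  qed simp
  have hm: "?h \<in> borel_measurable \<sigma>"
    by (intro measurable_surface measurable_compose[OF _ measurable_ennreal] borel_measurable_times borel_measurable_indicator) auto
  \<comment> \<open>True without integrability as well, since the integral then has the default
    value 0.\<close>
  have "ennreal (norm (far_op \<delta> \<epsilon> x)) \<le> (\<integral>\<^sup>+y. ennreal (norm (indicator (UNIV - cball x \<epsilon>) y *\<^sub>R (k_short \<delta> \<kappa> (x - y) * f y))) \<partial>\<sigma>)"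
  proof (cases "integrable \<sigma> (\<lambda>y. indicator (UNIV - cball x \<epsilon>) y *\<^sub>R (k_short \<delta> \<kappa> (x - y) * f y))")
    case True
    then show ?thesis
      unfolding far_op_def set_lebesgue_integral_def by (rule integral_norm_bound_ennreal)
  qed (simp add: far_op_def set_lebesgue_integral_def not_integrable_integral_eq)
  also have "\<dots> \<le> (\<integral>\<^sup>+y. ennreal (W * P) * ?h y + ennreal (W * R) \<partial>\<sigma>)"
    by (intro nn_integral_mono pw) simp
  also have "\<dots> = ennreal (W * P) * (\<integral>\<^sup>+y. ?h y \<partial>\<sigma>) + ennreal (W * R) * emeasure \<sigma> S"
    using hm by (subst nn_integral_add) (auto simp: nn_integral_cmult)
  also have "\<dots> \<le> ennreal (W * P) * ennreal ?F + ennreal (W * R) * ennreal surface_bound"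
    using \<delta> \<epsilon> by (intro add_mono mult_left_mono nn_integral_far_le emeasure_surface_le) auto
  also have "\<dots> = ennreal (W * P * ?F + W * R * surface_bound)"
  proof -
    have "ennreal (W * P) * ennreal ?F = ennreal (W * P * ?F)"
      using W_nonneg P F by (intro ennreal_mult[symmetric] mult_nonneg_nonneg)
    moreover have "ennreal (W * R) * ennreal surface_bound = ennreal (W * R * surface_bound)"
      using W_nonneg R surface_bound_nonneg by (intro ennreal_mult[symmetric] mult_nonneg_nonneg)
    ultimately show ?thesis
      using W_nonneg P R F surface_bound_nonneg by (simp only: ennreal_plus mult_nonneg_nonneg)
  qed
  finally have "norm (far_op \<delta> \<epsilon> x) \<le> W * P * ?F + W * R * surface_bound"
  proof (subst (asm) ennreal_le_iff)
    show "0 \<le> W * P * ?F + W * R * surface_bound"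
      by (intro add_nonneg_nonneg mult_nonneg_nonneg W_nonneg P R F surface_bound_nonneg)
  qed
  then show ?thesis
    by (simp add: P_def R_def algebra_simps)
qed

end

context surface_layer
begin

definition far_error :: "real \<Rightarrow> real \<Rightarrow> real \<Rightarrow> real" where
  "far_error C \<delta> \<epsilon> = W *
    (real CARD('n) * K / (2 * (1 - 1 / sqrt (real CARD('n))) ^ (CARD('n) + 1)) * \<delta>\<^sup>2 * (2 ^ (CARD('n) + 1) * ahlfors_const CARD('n) L / \<epsilon>\<^sup>2)
      + c_short K C \<kappa> * (exp (- (1 / (2 * real CARD('n))) * (\<epsilon>\<^sup>2 / \<delta>\<^sup>2)) / \<delta> ^ CARD('n)) * surface_bound)"

lemma Linf_norm_total_le:
  assumes \<delta>: "0 < \<delta>" "\<delta> < 1/2" and \<epsilon>: "\<delta> < \<epsilon>" and p: "p \<ge> 1"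
    and C: "upper_Gamma_const (real CARD('n) / 2) C"
    and ex: "\<And>x. x \<in> S \<Longrightarrow> pv_exists S (cball x \<epsilon>) (k_short \<delta> \<kappa>) f x"
    and T: "Linf_norm S (\<lambda>x. pv_local_op \<epsilon> S (k_short \<delta> \<kappa>) f x - T x) \<le> ennreal E" "E \<ge> 0"
  shows "Linf_norm S (\<lambda>x. (layer_op S (fourier_trunc p (k_long \<delta> \<kappa>)) f x + T x) - pv_op S \<kappa> f x)
    \<le> ennreal (long_error \<delta> p * (W * surface_bound) + E + far_error C \<delta> \<epsilon>)"
proof -
  let ?a = "\<lambda>x. layer_op S (fourier_trunc p (k_long \<delta> \<kappa>)) f x - layer_op S (k_long \<delta> \<kappa>) f x"
  let ?b = "\<lambda>x. pv_local_op \<epsilon> S (k_short \<delta> \<kappa>) f x - T x"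
  let ?t = "\<lambda>x. (layer_op S (fourier_trunc p (k_long \<delta> \<kappa>)) f x + T x) - pv_op S \<kappa> f x"
  note c = continuous_fourier_trunc[of p "k_long \<delta> \<kappa>"] continuous_k_long[OF \<delta>(1)]
  have am: "?a \<in> borel_measurable \<sigma>"
    by (intro borel_measurable_diff layer_op_measurable c)
  \<comment> \<open>T is an arbitrary map, so measurability of the local error is deduced from its
    finite norm.\<close>
  have bm: "?b \<in> borel_measurable \<sigma>"
  proof (rule ccontr)
    assume "?b \<notin> borel_measurable \<sigma>"
    then have "Linf_norm S ?b = \<infinity>"
      by (simp add: Linf_norm_def)
    with T(1) show False
      by (simp add: top_unique)
  qed
  \<comment> \<open>By the decomposition of the principal value, the total error is the truncation
    error minus the local error minus the far part.\<close>
  have eq: "?t x = ?a x - ?b x - far_op \<delta> \<epsilon> x" if "x \<in> S" for x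
    using pv_op_decompose[OF that \<delta>(1) _ ex[OF that]] \<delta> \<epsilon> by simp
  have "(\<lambda>x. ?a x - ?b x - far_op \<delta> \<epsilon> x) \<in> borel_measurable \<sigma>"
    by (intro borel_measurable_diff[OF borel_measurable_diff[OF am bm]] far_op_measurable \<delta>)
  then have tm: "?t \<in> borel_measurable \<sigma>"
    using eq by (subst measurable_cong[of \<sigma> _ "\<lambda>x. ?a x - ?b x - far_op \<delta> \<epsilon> x"]) auto
  have E0: "0 \<le> long_error \<delta> p"
    unfolding long_error_def by (rule order_trans[OF norm_ge_zero norm_fourier_trunc_diff_le[OF \<delta> p]])
  have "esssup \<sigma> (\<lambda>x. ennreal (norm (?b x))) \<le> ennreal E"
    using T(1) bm by (simp add: Linf_norm_def)
  \<comment> \<open>The local error is controlled only almost everywhere; the other two bounds hold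
    at every point of S.\<close>
  then have "AE x in \<sigma>. ennreal (norm (?b x)) \<le> ennreal E"
    using esssup_AE[where M = \<sigma> and f = "\<lambda>x. ennreal (norm (?b x))"] by (auto elim!: eventually_mono intro: order_trans)
  then have "AE x in \<sigma>. ennreal (norm (?t x)) \<le> ennreal (long_error \<delta> p * (W * surface_bound) + E + far_error C \<delta> \<epsilon>)"
  proof (rule AE_mp, intro AE_I2 impI ennreal_leI)
    fix x assume x: "x \<in> space \<sigma>" and b: "ennreal (norm (?b x)) \<le> ennreal E"
    then have b': "norm (?b x) \<le> E"
      using T(2) by simp
    have "norm (?a x) \<le> long_error \<delta> p * (LINT y|\<sigma>. norm (f y))"
      unfolding long_error_def by (intro norm_layer_op_diff_le c norm_fourier_trunc_diff_le \<delta> p)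
    also have "(LINT y|\<sigma>. norm (f y)) \<le> W * surface_bound"
      using L1_norm_le W_nonneg surface_bound_nonneg unfolding L1_norm_eq by simp
    finally have a': "norm (?a x) \<le> long_error \<delta> p * (W * surface_bound)"
      using E0 by (simp add: mult_left_mono)
    have f': "norm (far_op \<delta> \<epsilon> x) \<le> far_error C \<delta> \<epsilon>"
      unfolding far_error_def using x by (intro norm_far_op_le \<delta> \<epsilon> C) simp
    have "norm (?t x) \<le> norm (?a x) + norm (?b x) + norm (far_op \<delta> \<epsilon> x)"
      using x eq[of x] by (simp only: space_surface) (rule order_trans[OF norm_triangle_ineq4 add_right_mono[OF norm_triangle_ineq4]])
    then show "norm (?t x) \<le> long_error \<delta> p * (W * surface_bound) + E + far_error C \<delta> \<epsilon>"
      using a' b' f' by linarith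
  qed
  then show ?thesis
    unfolding Linf_norm_def using tm by (auto intro!: esssup_I)
qed

end

section \<open>Choice of the scales and the uniform constant\<close>

lemma powr_times_exp_bigo:
  fixes A B s D :: real
  assumes "B > 0" "s > 0"
  shows "(\<lambda>p::nat. real p powr A * exp (- B * real p powr s)) \<in> O(\<lambda>p. real p powr - D)"
  using assms by real_asymp

text \<open>
  The exponents in the error bound of \<open>theorem2p1\<close>; \<open>t\<close> is chosen such that \<open>t (q + d) = 2 - 2 t\<close>,
  which balances \<open>(\<delta> / \<epsilon>)\<^sup>2\<close> and \<open>\<epsilon>\<^bsup>d + q\<^esup>\<close>.
\<close>

lemma error_scaling:
  fixes p \<gamma> t q d :: real and n :: nat
  assumes p: "p > 0" and t: "t = 2 / (q + d + 2)" and q: "q \<ge> 0" and d: "d = real n"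
    and \<delta>: "\<delta> = p powr (- \<gamma>)" and \<epsilon>: "\<epsilon> = \<delta> powr t"
  shows "exp (- 2 * pi\<^sup>2 * \<delta>\<^sup>2 * p\<^sup>2) / (\<delta> ^ (n + 1) * p) = p powr (- 1 + \<gamma> * (d + 1)) * exp (- 2 * pi\<^sup>2 * p powr (2 - 2 * \<gamma>))"
    and "\<epsilon> powr (d + q) = p powr (- \<gamma> * t * (q + d))"
    and "\<delta>\<^sup>2 / \<epsilon>\<^sup>2 = p powr (- \<gamma> * t * (q + d))"
    and "exp (- (1 / (2 * d)) * (\<epsilon>\<^sup>2 / \<delta>\<^sup>2)) / \<delta> ^ n = p powr (d * \<gamma>) * exp (- (1 / (2 * d)) * p powr (\<gamma> * (2 - 2 * t)))"
    and "- \<gamma> * (1 + (q + d - 2) / (q + d + 2)) = - \<gamma> * t * (q + d)"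
proof -
  have \<delta>n: "\<delta> ^ m = p powr (- \<gamma> * real m)" for m
    using p by (simp add: \<delta> powr_powr flip: powr_realpow)
  have \<epsilon>p: "\<epsilon> = p powr (- \<gamma> * t)"
    by (simp add: \<epsilon> \<delta> powr_powr)
  have \<epsilon>n: "\<epsilon> ^ m = p powr (- \<gamma> * t * real m)" for m
    using p by (simp add: \<epsilon>p powr_powr flip: powr_realpow)
  have pos: "q + d + 2 > 0"
    using q d by simp
  then have tq: "t * (q + d) = 2 - 2 * t"
    by (simp add: t field_simps)
  have "\<delta>\<^sup>2 * p\<^sup>2 = p powr (2 - 2 * \<gamma>)"
    using p by (simp add: \<delta>n powr_diff powr_minus powr_numeral field_simps)
  then have 1: "- 2 * pi\<^sup>2 * \<delta>\<^sup>2 * p\<^sup>2 = - 2 * pi\<^sup>2 * p powr (2 - 2 * \<gamma>)"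
    by (simp add: mult.assoc)
  have "1 / (\<delta> ^ (n + 1) * p) = p powr (- 1 + \<gamma> * (d + 1))"
  proof -
    have "\<delta> ^ (n + 1) * p = p powr (- \<gamma> * (d + 1)) * p powr 1"
      using p by (simp only: \<delta>n d) (simp add: add.commute)
    also have "\<dots> = p powr (- (- 1 + \<gamma> * (d + 1)))"
      unfolding powr_add[symmetric] by (simp add: algebra_simps)
    finally show ?thesis
      by (simp only: powr_minus divide_inverse inverse_inverse_eq mult_1_left)
  qed
  then show "exp (- 2 * pi\<^sup>2 * \<delta>\<^sup>2 * p\<^sup>2) / (\<delta> ^ (n + 1) * p) = p powr (- 1 + \<gamma> * (d + 1)) * exp (- 2 * pi\<^sup>2 * p powr (2 - 2 * \<gamma>))"
    unfolding 1 by (metis mult.commute mult_1 times_divide_eq_left)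
  show "\<epsilon> powr (d + q) = p powr (- \<gamma> * t * (q + d))"
    by (simp add: \<epsilon>p powr_powr add.commute)
  have r: "\<delta>\<^sup>2 / \<epsilon>\<^sup>2 = p powr (- \<gamma> * (2 - 2 * t))"
    unfolding \<delta>n \<epsilon>n powr_diff[symmetric] by (simp add: algebra_simps)
  also have "- \<gamma> * (2 - 2 * t) = - \<gamma> * t * (q + d)"
    by (simp add: tq[symmetric])
  finally show "\<delta>\<^sup>2 / \<epsilon>\<^sup>2 = p powr (- \<gamma> * t * (q + d))" .
  have "\<epsilon>\<^sup>2 / \<delta>\<^sup>2 = p powr (\<gamma> * (2 - 2 * t))"
    unfolding \<delta>n \<epsilon>n powr_diff[symmetric] by (simp add: algebra_simps)
  moreover have "1 / \<delta> ^ n = p powr (d * \<gamma>)"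
    unfolding \<delta>n by (simp add: powr_minus divide_inverse d mult.commute)
  ultimately show "exp (- (1 / (2 * d)) * (\<epsilon>\<^sup>2 / \<delta>\<^sup>2)) / \<delta> ^ n = p powr (d * \<gamma>) * exp (- (1 / (2 * d)) * p powr (\<gamma> * (2 - 2 * t)))"
    by (metis mult.commute mult_1 times_divide_eq_left)
  have "1 + (q + d - 2) / (q + d + 2) = t * (q + d)"
    using pos by (simp add: t field_simps)
  then show "- \<gamma> * (1 + (q + d - 2) / (q + d + 2)) = - \<gamma> * t * (q + d)"
    by simp
qed

text \<open>The two thresholds for p translate into \<delta> < 1/2 and \<epsilon> < \<epsilon>0. The
  order of the scales follows from t < 1, because \<delta> < 1.\<close>

lemma scale_bounds:
  fixes p \<gamma> t q d \<epsilon>0 :: real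
  assumes p: "p > max (2 powr (1 / \<gamma>)) (\<epsilon>0 powr (- 1 / (\<gamma> * t)))" and \<gamma>: "\<gamma> > 0"
    and t: "0 < t" "t < 1" and \<epsilon>0: "\<epsilon>0 > 0"
    and \<delta>: "\<delta> = p powr (- \<gamma>)" and \<epsilon>: "\<epsilon> = \<delta> powr t"
  shows "0 < \<delta>" "\<delta> < 1/2" "\<delta> < \<epsilon>" "\<epsilon> \<le> \<epsilon>0"
proof -
  have p2: "2 powr (1 / \<gamma>) < p" and p\<epsilon>: "\<epsilon>0 powr (- 1 / (\<gamma> * t)) < p"
    using p by auto
  have p0: "p > 0"
    using p2 by (rule order_less_trans[rotated]) simp
  show \<delta>0: "0 < \<delta>"
    using p0 by (simp add: \<delta>)
  have "(2 powr (1 / \<gamma>)) powr \<gamma> < p powr \<gamma>"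
    using p2 \<gamma> by (intro powr_less_mono2) auto
  then have "2 < p powr \<gamma>"
    using \<gamma> by (simp add: powr_powr)
  then show \<delta>12: "\<delta> < 1/2"
    using p0 by (simp add: \<delta> powr_minus field_simps)
  have "\<delta> powr 1 < \<delta> powr t"
    using \<delta>0 \<delta>12 t by (intro powr_less_mono') auto
  then show "\<delta> < \<epsilon>"
    using \<delta>0 by (simp add: \<epsilon>)
  have "(\<epsilon>0 powr (- 1 / (\<gamma> * t))) powr (\<gamma> * t) < p powr (\<gamma> * t)"
    using p\<epsilon> \<gamma> t by (intro powr_less_mono2) auto
  then have "\<epsilon>0 powr (- 1) < p powr (\<gamma> * t)"
    using \<gamma> t by (simp add: powr_powr)
  then have "1 / \<epsilon>0 < p powr (\<gamma> * t)"
    using \<epsilon>0 by (simp add: powr_minus divide_inverse)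
  then have "1 / p powr (\<gamma> * t) < \<epsilon>0"
    using \<epsilon>0 p0 by (simp add: field_simps)
  moreover have "\<epsilon> = p powr (- (\<gamma> * t))"
    by (simp add: \<epsilon> \<delta> powr_powr)
  then have "\<epsilon> = 1 / p powr (\<gamma> * t)"
    by (simp add: powr_minus divide_inverse)
  ultimately show "\<epsilon> \<le> \<epsilon>0"
    by simp
qed

text \<open>
  The coefficients of the four contributions to the error: truncation of the Fourier series, local
  approximation, and the algebraic and exponential parts of the short-range kernel outside the ball.
  The arguments \<open>a\<close>, \<open>b\<close>, \<open>c\<close>, \<open>e\<close> stand for \<open>C\<^sub>\<kappa>\<close>, \<open>\<parallel>\<kappa>\<parallel>\<close>, \<open>C\<^sub>L\<close> and the Sobolev norm of \<open>f\<close>.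
\<close>

definition error_coeffs :: "nat \<Rightarrow> real \<Rightarrow> (real \<Rightarrow> real \<Rightarrow> real) \<Rightarrow> real \<Rightarrow> real \<Rightarrow> real \<Rightarrow> real \<Rightarrow> real list" where
  "error_coeffs n C\<^sub>\<Gamma> Cs a b c e =
    (let M = ahlfors_const n c * real n ^ (n - 1) in
      [real n * b / (2 * pi\<^sup>2) * (1 + 1 / sqrt (2 * pi)) ^ (n - 1) * (e * M),
       Cs a c * e,
       e * (real n * a / (2 * (1 - 1 / sqrt (real n)) ^ (n + 1)) * (2 ^ (n + 1) * ahlfors_const n c)),
       e * ((b / (2 * pi) powr (real n / 2) * (1 + 2 ^ n * real n / (1 - exp (- 1/2)) ^ n)
          + a * C\<^sub>\<Gamma> / Gamma (real n / 2) * (1 / 2 powr (real n / 2) + real n)) * M)])"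

text \<open>Absolute values and the leading 1 give positivity for arbitrary arguments, including
  those that come from no kernel or surface.\<close>

definition error_const :: "nat \<Rightarrow> real \<Rightarrow> (real \<Rightarrow> real \<Rightarrow> real) \<Rightarrow> real \<Rightarrow> real \<Rightarrow> real \<Rightarrow> real \<Rightarrow> real" where
  "error_const n C\<^sub>\<Gamma> Cs a b c e = 1 + (\<Sum>x\<leftarrow>error_coeffs n C\<^sub>\<Gamma> Cs a b c e. \<bar>x\<bar>)"

lemma error_const_pos: "error_const n C\<^sub>\<Gamma> Cs a b c e > 0"
  unfolding error_const_def by (intro add_pos_nonneg sum_list_nonneg) auto

context surface_layer
begin

text \<open>The local approximation error and the algebraic far part both scale like
  \<open>?Z\<close>, which explains the factor 2 in the bound. Every coefficient is majorised by the
  one constant.\<close>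

lemma total_error_le:
  fixes p :: nat
  assumes scale: "0 < \<delta>" "\<delta> < 1/2" "\<delta> < \<epsilon>" "p \<ge> 1" and q: "q \<ge> 0" and t: "t = 2 / (q + d + 2)"
    and d: "d = real CARD('n)" and \<delta>: "\<delta> = real p powr (- \<gamma>)" and \<epsilon>: "\<epsilon> = \<delta> powr t"
  shows "long_error \<delta> p * (W * surface_bound) + Cs K L * W * \<epsilon> powr (d + q) + far_error C \<delta> \<epsilon>
    \<le> error_const CARD('n) C Cs K (L1_cell \<kappa>) L W
      * (real p powr (- 1 + \<gamma> * (d + 1)) * exp (- 2 * pi\<^sup>2 * real p powr (2 - 2 * \<gamma>))
        + real p powr (d * \<gamma>) * exp (- (1 / (2 * d)) * real p powr (\<gamma> * (2 - 2 * t)))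
        + 2 * real p powr (- \<gamma> * t * (q + d)))"
    (is "_ \<le> ?C * (?X + ?Y + 2 * ?Z)")
proof -
  have p: "real p > 0"
    using scale by simp
  note sc = error_scaling[OF p t q d \<delta> \<epsilon>]
  let ?n = "CARD('n)"
  define c1 where "c1 = C_long \<kappa> * (W * surface_bound)"
  define c2 where "c2 = Cs K L * W"
  define c3 where "c3 = W * (real ?n * K / (2 * (1 - 1 / sqrt (real ?n)) ^ (?n + 1)) * (2 ^ (?n + 1) * ahlfors_const ?n L))"
  define c4 where "c4 = W * (c_short K C \<kappa> * surface_bound)"
  have C: "?C = 1 + (\<bar>c1\<bar> + \<bar>c2\<bar> + \<bar>c3\<bar> + \<bar>c4\<bar>)"
    by (simp add: error_const_def error_coeffs_def Let_def c1_def c2_def c3_def c4_def C_long_def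
        c_short_def surface_bound_def)
  have "long_error \<delta> p = C_long \<kappa> * ?X"
    unfolding long_error_def sc(1)[symmetric] by simp
  then have 1: "long_error \<delta> p * (W * surface_bound) = c1 * ?X"
    by (simp add: c1_def)
  have 2: "Cs K L * W * \<epsilon> powr (d + q) = c2 * ?Z"
    unfolding c2_def sc(2) ..
  have "far_error C \<delta> \<epsilon> = c3 * (\<delta>\<^sup>2 / \<epsilon>\<^sup>2) + c4 * (exp (- (1 / (2 * d)) * (\<epsilon>\<^sup>2 / \<delta>\<^sup>2)) / \<delta> ^ ?n)"
    unfolding far_error_def c3_def c4_def d by (simp add: distrib_left mult_ac)
  then have 3: "far_error C \<delta> \<epsilon> = c3 * ?Z + c4 * ?Y"
    by (simp only: sc(3,4))
  have le: "c * z \<le> \<bar>c\<bar> * z" if "z \<ge> 0" for c z :: real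
    using that by (intro mult_right_mono) auto
  have XYZ: "?X \<ge> 0" "?Y \<ge> 0" "?Z \<ge> 0"
    by auto
  have "c1 * ?X + c2 * ?Z + (c3 * ?Z + c4 * ?Y) \<le> \<bar>c1\<bar> * ?X + \<bar>c2\<bar> * ?Z + (\<bar>c3\<bar> * ?Z + \<bar>c4\<bar> * ?Y)"
    by (intro add_mono le XYZ)
  also have "\<dots> \<le> ?C * ?X + ?C * ?Z + (?C * ?Z + ?C * ?Y)"
    by (intro add_mono mult_right_mono XYZ) (simp_all add: C)
  also have "\<dots> = ?C * (?X + ?Y + 2 * ?Z)"
    by (simp add: distrib_left)
  finally show ?thesis
    unfolding 1 2 3 .
qed

end

text \<open>As \<gamma> < 1 and t < 1, the powers of p inside both exponentials are positive, so
  these terms decay faster than any power and the algebraic term decides the rate.\<close>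

lemma error_bound_bigo:
  fixes C d \<gamma> t q :: real
  assumes \<gamma>: "0 < \<gamma>" "\<gamma> < 1" and d: "d > 0" and t: "t < 1"
  shows "(\<lambda>p::nat. C * (real p powr (- 1 + \<gamma> * (d + 1)) * exp (- 2 * pi\<^sup>2 * real p powr (2 - 2 * \<gamma>))
        + real p powr (d * \<gamma>) * exp (- (1 / (2 * d)) * real p powr (\<gamma> * (2 - 2 * t)))
        + 2 * real p powr (- \<gamma> * t * (q + d)))) \<in> O(\<lambda>p. real p powr (- \<gamma> * t * (q + d)))"
proof -
  define D where "D = \<gamma> * t * (q + d)"
  have D: "- \<gamma> * t * (q + d) = - D"
    by (simp add: D_def)
  have 1: "(\<lambda>p::nat. real p powr (- 1 + \<gamma> * (d + 1)) * exp (- (2 * pi\<^sup>2) * real p powr (2 - 2 * \<gamma>))) \<in> O(\<lambda>p. real p powr - D)"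
    using \<gamma> by (intro powr_times_exp_bigo) auto
  have 2: "(\<lambda>p::nat. real p powr (d * \<gamma>) * exp (- (1 / (2 * d)) * real p powr (\<gamma> * (2 - 2 * t)))) \<in> O(\<lambda>p. real p powr - D)"
    using \<gamma> d t by (intro powr_times_exp_bigo) auto
  have 3: "(\<lambda>p::nat. 2 * real p powr - D) \<in> O(\<lambda>p. real p powr - D)"
    by simp
  from sum_in_bigo(1)[OF sum_in_bigo(1)[OF 1 2] 3] show ?thesis
    unfolding D by (cases "C = 0") simp_all
qed

theorem theorem2p1:
  fixes Cshort :: "real \<Rightarrow> real \<Rightarrow> real" and d :: real
  assumes "d = real CARD('n::finite)"
    and "CARD('n) \<ge> 2"
    and "\<And>a b. a > 0 \<Longrightarrow> b > 0 \<Longrightarrow> Cshort a b > 0"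
  shows "\<exists>C :: real \<Rightarrow> real \<Rightarrow> real \<Rightarrow> real \<Rightarrow> real. (\<forall>a b c e. C a b c e > 0) \<and>
    (\<forall>(\<kappa> :: real^'n \<Rightarrow> complex) C\<^sub>\<kappa> (S :: (real^'n) set) (\<A> :: 'n graph_chart set) C\<^sub>L
       (f :: real^'n \<Rightarrow> complex) \<epsilon>0 q T C\<^sub>\<Gamma>.
      admissible_kernel C\<^sub>\<kappa> \<kappa> \<longrightarrow>
      C\<^sub>L > 0 \<longrightarrow> lipschitz_atlas C\<^sub>L S \<A> \<longrightarrow> S \<subseteq> cbox 0 (\<chi> i. 1/2) \<longrightarrow>
      f \<in> W2inf S \<A> \<longrightarrow>
      operators_well_defined S \<kappa> f \<longrightarrow>
      local_approximation (Cshort C\<^sub>\<kappa> C\<^sub>L) \<epsilon>0 q S \<A> \<kappa> f T \<longrightarrow>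
      upper_Gamma_const (d / 2) C\<^sub>\<Gamma> \<longrightarrow>
      (\<forall>\<delta> (p::nat). 0 < \<delta> \<longrightarrow> \<delta> < 1/2 \<longrightarrow> p \<ge> 1 \<longrightarrow>
        Linf_norm S (\<lambda>x. layer_op S (fourier_trunc p (k_long \<delta> \<kappa>)) f x
                          - layer_op S (k_long \<delta> \<kappa>) f x)
          \<le> ennreal (C_long \<kappa> * exp (- 2 * pi\<^sup>2 * \<delta>\<^sup>2 * (real p)\<^sup>2)
                      / (\<delta> ^ (CARD('n) + 1) * real p)) * L1_norm S f) \<and>
      (\<forall>\<delta> x. 0 < \<delta> \<longrightarrow> \<delta> < 1/2 \<longrightarrow> x \<in> cell \<longrightarrow> norm x \<ge> \<delta> \<longrightarrow>
        norm (k_short \<delta> \<kappa> x)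
          \<le> d * C\<^sub>\<kappa> / (2 * (1 - 1 / sqrt d) ^ (CARD('n) + 1)) * (\<delta>\<^sup>2 / norm x ^ (CARD('n) + 1))
            + c_short C\<^sub>\<kappa> C\<^sub>\<Gamma> \<kappa> * (exp (- (1 / (2 * d)) * ((norm x)\<^sup>2 / \<delta>\<^sup>2)) / \<delta> ^ CARD('n))) \<and>
      (\<forall>\<gamma> t. 0 < \<gamma> \<longrightarrow> \<gamma> < 1 \<longrightarrow> t = 2 / (q + d + 2) \<longrightarrow>
        (let bound = (\<lambda>p::nat.
               C C\<^sub>\<kappa> (L1_cell \<kappa>) C\<^sub>L (enn2real (W2inf_norm \<A> f))
               * (real p powr (- 1 + \<gamma> * (d + 1)) * exp (- 2 * pi\<^sup>2 * real p powr (2 - 2 * \<gamma>))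
                  + real p powr (d * \<gamma>) * exp (- (1 / (2 * d)) * real p powr (\<gamma> * (2 - 2 * t)))
                  + 2 * real p powr (- \<gamma> * t * (q + d))))
         in (\<forall>(p::nat) \<delta> \<epsilon>.
               real p > max (2 powr (1 / \<gamma>)) (\<epsilon>0 powr (- 1 / (\<gamma> * t))) \<longrightarrow>
               \<delta> = real p powr (- \<gamma>) \<longrightarrow> \<epsilon> = \<delta> powr t \<longrightarrow>
               Linf_norm S (\<lambda>x. (layer_op S (fourier_trunc p (k_long \<delta> \<kappa>)) f x + T \<delta> \<epsilon> f x)
                                 - pv_op S \<kappa> f x) \<le> ennreal (bound p)) \<and>
            bound \<in> O(\<lambda>p. real p powr (- \<gamma> * (1 + (q + d - 2) / (q + d + 2)))))))"
proof -
  \<comment> \<open>The constant may depend on the dimension but not on the Gamma constant, which is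
    quantified later. A fixed choice for the given d is therefore made in advance.\<close>
  define CG where "CG = (SOME C. upper_Gamma_const (d / 2) C)"
  note d = assms(1)
  show ?thesis
  proof (rule exI[of _ "error_const CARD('n) CG Cshort"], intro conjI allI impI)
    show "error_const CARD('n) CG Cshort a b c e > 0" for a b c e
      by (rule error_const_pos)
  next
    fix \<kappa> :: "real^'n \<Rightarrow> complex" and C\<^sub>\<kappa> S \<A> C\<^sub>L f \<epsilon>0 q T C\<^sub>\<Gamma>
    assume kernel: "admissible_kernel C\<^sub>\<kappa> \<kappa>" and "C\<^sub>L > 0" and atlas: "lipschitz_atlas C\<^sub>L S \<A>"
      and S: "S \<subseteq> cbox 0 (\<chi> i. 1/2)" and f: "f \<in> W2inf S \<A>" and wd: "operators_well_defined S \<kappa> f"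
      and approx: "local_approximation (Cshort C\<^sub>\<kappa> C\<^sub>L) \<epsilon>0 q S \<A> \<kappa> f T"
      and CGam: "upper_Gamma_const (d / 2) C\<^sub>\<Gamma>"
    define W where "W = enn2real (W2inf_norm \<A> f)"
    obtain D1 D2 where D: "smooth_periodic_kernel \<kappa> C\<^sub>\<kappa> D1 D2"
      using admissible_kernelD[OF kernel] by blast
    interpret surface_layer S \<A> C\<^sub>L \<kappa> C\<^sub>\<kappa> D1 D2 f W
    proof (intro surface_layer.intro surface_layer_axioms.intro lipschitz_surface.intro D atlas assms(2) S)
      show "continuous_on S f"
        using f by (simp add: W2inf_def)
      show "norm (f y) \<le> W" if "y \<in> S" for y
        unfolding W_def by (rule norm_le_W2inf_norm[OF atlas f that])
      show "0 \<le> W"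
        by (simp add: W_def)
    qed
    \<comment> \<open>The chosen constant is valid as soon as some valid one exists, and
      \<open>C\<^sub>\<Gamma>\<close> is a witness. The pointwise kernel bound keeps
      \<open>C\<^sub>\<Gamma>\<close> itself.\<close>
    have CG: "upper_Gamma_const (real CARD('n) / 2) CG"
      using someI[of "upper_Gamma_const (d / 2)", OF CGam] by (simp add: CG_def d)
    have \<epsilon>0: "\<epsilon>0 > 0" and q: "q \<ge> 0"
      using approx by (auto simp: local_approximation_def)
    show "Linf_norm S (\<lambda>x. layer_op S (fourier_trunc p (k_long \<delta> \<kappa>)) f x - layer_op S (k_long \<delta> \<kappa>) f x)
        \<le> ennreal (C_long \<kappa> * exp (- 2 * pi\<^sup>2 * \<delta>\<^sup>2 * (real p)\<^sup>2) / (\<delta> ^ (CARD('n) + 1) * real p)) * L1_norm S f"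
      if "0 < \<delta>" "\<delta> < 1/2" "p \<ge> 1" for \<delta> p
      using Linf_norm_long_le[OF that] unfolding long_error_def .
    show "norm (k_short \<delta> \<kappa> x)
          \<le> d * C\<^sub>\<kappa> / (2 * (1 - 1 / sqrt d) ^ (CARD('n) + 1)) * (\<delta>\<^sup>2 / norm x ^ (CARD('n) + 1))
            + c_short C\<^sub>\<kappa> C\<^sub>\<Gamma> \<kappa> * (exp (- (1 / (2 * d)) * ((norm x)\<^sup>2 / \<delta>\<^sup>2)) / \<delta> ^ CARD('n))"
      if "0 < \<delta>" "\<delta> < 1/2" "x \<in> cell" "norm x \<ge> \<delta>" for \<delta> x
      unfolding d by (rule norm_k_short_le) (use that assms(2) CGam d in auto)
    fix \<gamma> t :: real
    assume \<gamma>: "0 < \<gamma>" "\<gamma> < 1" and t: "t = 2 / (q + d + 2)"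
    have d2: "d \<ge> 2"
      using assms(2) by (simp add: d)
    then have t01: "0 < t" "t < 1"
      using q by (auto simp: t field_simps)
    define bound where "bound = (\<lambda>p::nat. error_const CARD('n) CG Cshort C\<^sub>\<kappa> (L1_cell \<kappa>) C\<^sub>L W
               * (real p powr (- 1 + \<gamma> * (d + 1)) * exp (- 2 * pi\<^sup>2 * real p powr (2 - 2 * \<gamma>))
                  + real p powr (d * \<gamma>) * exp (- (1 / (2 * d)) * real p powr (\<gamma> * (2 - 2 * t)))
                  + 2 * real p powr (- \<gamma> * t * (q + d))))"
    have err: "Linf_norm S (\<lambda>x. (layer_op S (fourier_trunc p (k_long \<delta> \<kappa>)) f x + T \<delta> \<epsilon> f x) - pv_op S \<kappa> f x)
        \<le> ennreal (bound p)"
      if p: "real p > max (2 powr (1 / \<gamma>)) (\<epsilon>0 powr (- 1 / (\<gamma> * t)))"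
        and \<delta>: "\<delta> = real p powr (- \<gamma>)" and \<epsilon>: "\<epsilon> = \<delta> powr t" for p \<delta> \<epsilon>
    proof -
      note sc = scale_bounds[OF p \<gamma>(1) t01 \<epsilon>0 \<delta> \<epsilon>]
      have p1: "p \<ge> 1"
        using p by (cases p) auto
      let ?E = "Cshort C\<^sub>\<kappa> C\<^sub>L * W * \<epsilon> powr (d + q)"
      have Cs: "Cshort C\<^sub>\<kappa> C\<^sub>L > 0"
        using assms(3) K_pos \<open>C\<^sub>L > 0\<close> by simp
      then have E0: "?E \<ge> 0"
        using W_nonneg by simp
      have fin: "W2inf_norm \<A> f = ennreal W"
        using f by (simp add: W2inf_def W_def)
      have "Linf_norm S (\<lambda>x. pv_local_op \<epsilon> S (k_short \<delta> \<kappa>) f x - T \<delta> \<epsilon> f x)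
          \<le> ennreal (Cshort C\<^sub>\<kappa> C\<^sub>L) * W2inf_norm \<A> f * ennreal (\<epsilon> powr (real CARD('n) + q))"
        using approx sc by (simp add: local_approximation_def)
      also have "\<dots> = ennreal ?E"
        unfolding fin d using Cs W_nonneg by (simp add: ennreal_mult)
      finally have T: "Linf_norm S (\<lambda>x. pv_local_op \<epsilon> S (k_short \<delta> \<kappa>) f x - T \<delta> \<epsilon> f x) \<le> ennreal ?E" .
      have ex: "pv_exists S (cball x \<epsilon>) (k_short \<delta> \<kappa>) f x" if "x \<in> S" for x
        using wd sc that by (simp add: operators_well_defined_def)
      have "Linf_norm S (\<lambda>x. (layer_op S (fourier_trunc p (k_long \<delta> \<kappa>)) f x + T \<delta> \<epsilon> f x) - pv_op S \<kappa> f x)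
          \<le> ennreal (long_error \<delta> p * (W * surface_bound) + ?E + far_error CG \<delta> \<epsilon>)"
        by (rule Linf_norm_total_le[OF sc(1-3) p1 CG ex T E0])
      also have "\<dots> \<le> ennreal (bound p)"
        unfolding bound_def by (intro ennreal_leI total_error_le sc p1 q t d \<delta> \<epsilon>)
      finally show ?thesis .
    qed
    \<comment> \<open>The identity between the exponents does not involve p, so the scaling lemma
      may be instantiated at p = 1.\<close>
    have "real p powr (- \<gamma> * (1 + (q + d - 2) / (q + d + 2))) = real p powr (- \<gamma> * t * (q + d))" for p :: nat
      using error_scaling(5)[of 1 t q d "CARD('n)" _ \<gamma>] t q d by simp
    then have "bound \<in> O(\<lambda>p. real p powr (- \<gamma> * (1 + (q + d - 2) / (q + d + 2))))"
      unfolding bound_def using error_bound_bigo[OF \<gamma> _ t01(2)] d2 by simp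
    with err show "let bound = (\<lambda>p::nat.
               error_const CARD('n) CG Cshort C\<^sub>\<kappa> (L1_cell \<kappa>) C\<^sub>L (enn2real (W2inf_norm \<A> f))
               * (real p powr (- 1 + \<gamma> * (d + 1)) * exp (- 2 * pi\<^sup>2 * real p powr (2 - 2 * \<gamma>))
                  + real p powr (d * \<gamma>) * exp (- (1 / (2 * d)) * real p powr (\<gamma> * (2 - 2 * t)))
                  + 2 * real p powr (- \<gamma> * t * (q + d))))
         in (\<forall>(p::nat) \<delta> \<epsilon>.
               real p > max (2 powr (1 / \<gamma>)) (\<epsilon>0 powr (- 1 / (\<gamma> * t))) \<longrightarrow>
               \<delta> = real p powr (- \<gamma>) \<longrightarrow> \<epsilon> = \<delta> powr t \<longrightarrow>
               Linf_norm S (\<lambda>x. (layer_op S (fourier_trunc p (k_long \<delta> \<kappa>)) f x + T \<delta> \<epsilon> f x)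
                                 - pv_op S \<kappa> f x) \<le> ennreal (bound p)) \<and>
            bound \<in> O(\<lambda>p. real p powr (- \<gamma> * (1 + (q + d - 2) / (q + d + 2))))"
      unfolding Let_def W_def[symmetric] bound_def[symmetric] by blast
  qed
qed

end
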